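(* Assume Assumption A (see context). There is a constant $C$, independent of $N$, $\epsilon$ and $\alpha$, such that for every $\epsilon>0$, every $N\in\mathbb{N}$ with $N\ge1$, and every $\epsilon$-optimal control $\alpha:[0,T]\to A^d$ for the mean field control problem (that is, $J(\alpha)\le\inf_{\alpha'}J(\alpha')+\epsilon$, the infimum being over all controls of the mean field control problem), $$J^N(\alpha)\le\inf_{\alpha_N}J^N(\alpha_N)+\frac{C}{\sqrt N}+\epsilon.$$ Here the infimum is over all feedback controls $\alpha_N$ of the $N$-agent optimization, and $J^N(\alpha)$ is the cost of the control $\alpha_N(t,i,m):=\alpha^i(t)$, which does not depend on $m$.
   Context: **Notation.** $d\ge2$ is an integer, $T>0$, $S_d=\{m\in\mathbb{R}^d:m_i\ge0,\ \sum_im_i=1\}$, $S_d^N=S_d\cap\frac1N\mathbb{N}^d$ (with $0\in\mathbb{N}$), $|\cdot|$ is the Euclidean norm, $\delta_i$ is the $i$-th canonical basis vector of $\mathbb{R}^d$. An initial law $m_0\in S_d$ is given. **Data.** Action space $A$, transition rates $Q_{i,j}:[0,T]\times A\times S_d\to[0,\infty)$, running costs $f^i:[0,T]\times A\times S_d\to\mathbb{R}$, terminal costs $g^i:S_d\to\mathbb{R}$, $i,j\in\{1,\dots,d\}$. Set $F(t,a^1,\dots,a^d,m)=\sum_im_if^i(t,a^i,m)$ and $G(m)=\sum_im_ig^i(m)$. **Assumption A.** (A1) $A$ is a compact metric space. (A2) Each $Q_{i,j}$ is continuous on $[0,T]\times A\times S_d$ and $|Q_{i,j}(t,a,m)-Q_{i,j}(s,a,p)|\le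 C(|t-s|+|m-p|)$ with $C$ independent of $a$. (A3) $F$ is continuous on $[0,T]\times A^d\times S_d$, $|F(t,a,m)-F(s,a,p)|\le C(|t-s|+|m-p|)$ with $C$ independent of $a\in A^d$, and $|G(m)-G(p)|\le C|m-p|$. **$N$-agent optimization (mean field formulation).** Controls are measurable feedback functions $\alpha_N:[0,T]\times\{1,\dots,d\}\times S_d^N\to A$. Given $\alpha_N$, $\mu^N$ is the time-inhomogeneous Markov chain on $S_d^N$ which jumps at time $t$ from $m$ to $m+\frac1N(\delta_j-\delta_i)$, $i\ne j$, with rate $Nm_iQ_{i,j}(t,\alpha_N(t,i,m),m)$; its initial value $\mu^N_0$ is the empirical measure of $N$ i.i.d. random variables with values in $\{1,\dots,d\}$ and law $m_0$. The cost is $$J^N(\alpha_N)=\mathbb{E}\Big[\int_0^T\sum_i\mu^N_{i,t}f^i(t,\alpha_N(t,i,\mu^N_t),\mu^N_t)\,dt+\sum_i\mu^N_{i,T}g^i(\mu^N_T)\Big].$$ **Mean field control problem.** Controls are measurable functions $\alpha=(\alpha^1,\dots,\alpha^d):[0,T]\to A^d$. The cost is $J(\alpha)=\int_0^TF(t,\alpha(t),\mu_t)\,dt+G(\mu_T)$, where $$\tfrac{d}{dt}\mu^i_t=\sum_j\big(\mu^j_tQ_{j,i}(t,\alpha^j(t),\mu_t)-\mu^i_tQ_{i,j}(t,\alpha^i(t),\mu_t)\big),\qquad\mu_0=m_0.$$ *)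

theory Defs
  imports "HOL-Probability.Probability" "HOL-Probability.Product_PMF"
begin

unbundle vec_syntax

text \<open>
  Conventions: \<open>\<real>\<^sup>d\<close> is \<^typ>\<open>real^'d\<close> and \<open>{1,\<dots>,d}\<close> is the index type \<^typ>\<open>'d\<close>. The action
  space is a subset \<open>A\<close> of a metric space (compact by \<open>assumption_A\<close>). Functions of time, of actions and of states are total;
  only their restrictions to \<open>[0,T]\<close>, \<open>A\<close> and the simplex are ever constrained.
\<close>

definition prob_simplex :: "(real^'d) set" where
  "prob_simplex = {m. (\<forall>i. 0 \<le> m $ i) \<and> (\<Sum>i\<in>UNIV. m $ i) = 1}"

definition grid :: "nat \<Rightarrow> (real^'d) set" where
  "grid N = {m \<in> prob_simplex. \<forall>i. \<exists>k::nat. m $ i = real k / real N}"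

definition action_vectors :: "'a set \<Rightarrow> ('a^'d) set" where
  "action_vectors A = {a. \<forall>i. a $ i \<in> A}"

type_synonym ('a, 'd) rates = "'d \<Rightarrow> 'd \<Rightarrow> real \<Rightarrow> 'a \<Rightarrow> real^'d \<Rightarrow> real"
type_synonym ('a, 'd) running_costs = "'d \<Rightarrow> real \<Rightarrow> 'a \<Rightarrow> real^'d \<Rightarrow> real"
type_synonym 'd terminal_costs = "'d \<Rightarrow> real^'d \<Rightarrow> real"
type_synonym ('a, 'd) feedback = "real \<Rightarrow> 'd \<Rightarrow> real^'d \<Rightarrow> 'a"

definition running_F :: "('a, 'd::finite) running_costs \<Rightarrow> real \<Rightarrow> 'a^'d \<Rightarrow> real^'d \<Rightarrow> real" where
  "running_F f t a m = (\<Sum>i\<in>UNIV. m $ i * f i t (a $ i) m)"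

definition terminal_G :: "'d::finite terminal_costs \<Rightarrow> real^'d \<Rightarrow> real" where
  "terminal_G g m = (\<Sum>i\<in>UNIV. m $ i * g i m)"

definition nonneg_rates :: "real \<Rightarrow> 'a set \<Rightarrow> ('a, 'd::finite) rates \<Rightarrow> bool" where
  "nonneg_rates T A Q \<longleftrightarrow> (\<forall>i j. \<forall>t\<in>{0..T}. \<forall>a\<in>A. \<forall>m\<in>prob_simplex. 0 \<le> Q i j t a m)"

definition assumption_A ::
  "real \<Rightarrow> 'a::metric_space set \<Rightarrow> ('a, 'd::finite) rates \<Rightarrow> ('a, 'd) running_costs
    \<Rightarrow> 'd terminal_costs \<Rightarrow> bool" where
  "assumption_A T A Q f g \<longleftrightarrow>
     compact A \<and>
     (\<forall>i j. continuous_on ({0..T} \<times> A \<times> prob_simplex) (\<lambda>(t, a, m). Q i j t a m)) \<and>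
     (\<exists>C. \<forall>i j. \<forall>t\<in>{0..T}. \<forall>s\<in>{0..T}. \<forall>a\<in>A. \<forall>m\<in>prob_simplex. \<forall>p\<in>prob_simplex.
        \<bar>Q i j t a m - Q i j s a p\<bar> \<le> C * (\<bar>t - s\<bar> + norm (m - p))) \<and>
     continuous_on ({0..T} \<times> action_vectors A \<times> prob_simplex) (\<lambda>(t, a, m). running_F f t a m) \<and>
     (\<exists>C. \<forall>t\<in>{0..T}. \<forall>s\<in>{0..T}. \<forall>a\<in>action_vectors A. \<forall>m\<in>prob_simplex. \<forall>p\<in>prob_simplex.
        \<bar>running_F f t a m - running_F f s a p\<bar> \<le> C * (\<bar>t - s\<bar> + norm (m - p))) \<and>
     (\<exists>C. \<forall>m\<in>prob_simplex. \<forall>p\<in>prob_simplex. \<bar>terminal_G g m - terminal_G g p\<bar> \<le> C * norm (m - p))"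


subsection \<open>Mean field control problem\<close>

definition mf_controls :: "real \<Rightarrow> 'a::metric_space set \<Rightarrow> (real \<Rightarrow> 'a^'d::finite) set" where
  "mf_controls T A =
     measurable (restrict_space borel {0..T}) (restrict_space borel (action_vectors A))"

definition mf_drift ::
  "('a, 'd::finite) rates \<Rightarrow> (real \<Rightarrow> 'a^'d) \<Rightarrow> real \<Rightarrow> real^'d \<Rightarrow> real^'d" where
  "mf_drift Q \<alpha> t m =
     (\<chi> i. \<Sum>j\<in>UNIV. m $ j * Q j i t (\<alpha> t $ j) m - m $ i * Q i j t (\<alpha> t $ i) m)"

text \<open>
  As controls are only measurable in time, the differential equation is understood in the sense
  of Caratheodory, i.e. in integrated form. The rates are only given on the simplex, so a
  solution is required to stay there.
\<close>

definition mf_trajectory ::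
  "real \<Rightarrow> ('a, 'd::finite) rates \<Rightarrow> real^'d \<Rightarrow> (real \<Rightarrow> 'a^'d) \<Rightarrow> (real \<Rightarrow> real^'d) \<Rightarrow> bool" where
  "mf_trajectory T Q m\<^sub>0 \<alpha> \<mu> \<longleftrightarrow>
     continuous_on {0..T} \<mu> \<and>
     (\<forall>t\<in>{0..T}. \<mu> t \<in> prob_simplex \<and> \<mu> t = m\<^sub>0 + (LBINT s:{0..t}. mf_drift Q \<alpha> s (\<mu> s)))"

text \<open>
  Under the standing assumptions the trajectory is unique on \<open>[0,T]\<close>, and only its values there
  enter the cost; so the choice below is immaterial.
\<close>

definition mf_cost ::
  "real \<Rightarrow> ('a, 'd::finite) rates \<Rightarrow> ('a, 'd) running_costs \<Rightarrow> 'd terminal_costs \<Rightarrow> real^'d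
    \<Rightarrow> (real \<Rightarrow> 'a^'d) \<Rightarrow> real" where
  "mf_cost T Q f g m\<^sub>0 \<alpha> =
     (let \<mu> = (SOME \<mu>. mf_trajectory T Q m\<^sub>0 \<alpha> \<mu>)
      in (LBINT t:{0..T}. running_F f t (\<alpha> t) (\<mu> t)) + terminal_G g (\<mu> T))"


subsection \<open>\<open>N\<close>-agent optimization\<close>

text \<open>
  The factors \<open>{1,\<dots>,d}\<close> and \<open>grid N\<close> are finite, so joint measurability in \<open>(t,i,m)\<close> amounts to
  measurability in \<open>t\<close> for all \<open>i\<close> and \<open>m\<close>.
\<close>

definition feedback_controls ::
  "real \<Rightarrow> 'a::metric_space set \<Rightarrow> nat \<Rightarrow> ('a, 'd::finite) feedback set" where
  "feedback_controls T A N =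
     {\<beta>. \<forall>i. \<forall>m\<in>grid N.
        (\<lambda>t. \<beta> t i m) \<in> measurable (restrict_space borel {0..T}) (restrict_space borel A)}"

definition open_loop :: "(real \<Rightarrow> 'a^'d::finite) \<Rightarrow> ('a, 'd) feedback" where
  "open_loop \<alpha> = (\<lambda>t i m. \<alpha> t $ i)"

text \<open>
  The sum below has at most one term; it vanishes unless \<open>m'\<close> arises from \<open>m\<close> by one agent
  changing its state.
\<close>

definition jump_rate ::
  "('a, 'd::finite) rates \<Rightarrow> nat \<Rightarrow> ('a, 'd) feedback \<Rightarrow> real \<Rightarrow> real^'d \<Rightarrow> real^'d \<Rightarrow> real" where
  "jump_rate Q N \<beta> t m m' =
     (\<Sum>(i, j) | i \<noteq> j \<and> m' = m + (1 / real N) *\<^sub>R (axis j 1 - axis i 1).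
        real N * m $ i * Q i j t (\<beta> t i m) m)"

definition empirical :: "nat \<Rightarrow> (nat \<Rightarrow> 'd) \<Rightarrow> real^'d" where
  "empirical N \<xi> = (\<chi> i. real (card {k. k < N \<and> \<xi> k = i}) / real N)"

definition initial_law :: "nat \<Rightarrow> real^'d \<Rightarrow> (real^'d) pmf" where
  "initial_law N m\<^sub>0 =
     map_pmf (empirical N) (Pi_pmf {..<N} undefined (\<lambda>_. embed_pmf (\<lambda>i. m\<^sub>0 $ i)))"

text \<open>
  The rates are only measurable in time, so the transition probabilities \<open>p s t x y\<close> from \<open>x\<close> at
  time \<open>s\<close> to \<open>y\<close> at time \<open>t\<close> are described by the integrated Kolmogorov forward equation for
  given jump rates \<open>q t x y\<close>, \<open>x \<noteq> y\<close>.
\<close>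

definition transition_probs ::
  "real \<Rightarrow> 's set \<Rightarrow> (real \<Rightarrow> 's \<Rightarrow> 's \<Rightarrow> real) \<Rightarrow> (real \<Rightarrow> real \<Rightarrow> 's \<Rightarrow> 's \<Rightarrow> real) \<Rightarrow> bool" where
  "transition_probs T S q p \<longleftrightarrow>
     (\<forall>s\<in>{0..T}. \<forall>x\<in>S. \<forall>y\<in>S.
        continuous_on {s..T} (\<lambda>t. p s t x y) \<and>
        (\<forall>t\<in>{s..T}. p s t x y = (if x = y then 1 else 0) +
           (LBINT r:{s..t}. (\<Sum>z\<in>S - {y}. p s r x z * q r z y)
                            - p s r x y * (\<Sum>z\<in>S - {y}. q r y z))))"

text \<open>
  \<open>X\<close> is, on the probability space \<open>P\<close>, a time-inhomogeneous Markov chain on the finite set \<open>S\<close> with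
  jump rates \<open>q\<close> and right-continuous paths with left limits. The last conjunct is the Markov
  property, tested on the events that generate the past up to time \<open>s\<close>.
\<close>

definition markov_jump_process ::
  "real \<Rightarrow> 's::topological_space set \<Rightarrow> (real \<Rightarrow> 's \<Rightarrow> 's \<Rightarrow> real) \<Rightarrow> 'w measure
    \<Rightarrow> (real \<Rightarrow> 'w \<Rightarrow> 's) \<Rightarrow> bool" where
  "markov_jump_process T S q P X \<longleftrightarrow>
     prob_space P \<and>
     (\<forall>t\<in>{0..T}. X t \<in> measurable P (count_space S)) \<and>
     (\<forall>\<omega>\<in>space P.
        (\<forall>t\<in>{0..<T}. ((\<lambda>s. X s \<omega>) \<longlongrightarrow> X t \<omega>) (at_right t)) \<and>
        (\<forall>t\<in>{0<..T}. \<exists>l\<in>S. ((\<lambda>s. X s \<omega>) \<longlongrightarrow> l) (at_left t))) \<and>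
     (\<exists>p. transition_probs T S q p \<and>
        (\<forall>s\<in>{0..T}. \<forall>t\<in>{s..T}. \<forall>I v. \<forall>x\<in>S. \<forall>y\<in>S. finite I \<and> I \<subseteq> {0..s} \<longrightarrow>
           measure P {\<omega> \<in> space P. (\<forall>r\<in>I. X r \<omega> = v r) \<and> X s \<omega> = x \<and> X t \<omega> = y}
           = measure P {\<omega> \<in> space P. (\<forall>r\<in>I. X r \<omega> = v r) \<and> X s \<omega> = x} * p s t x y))"

definition agent_chain ::
  "real \<Rightarrow> ('a, 'd::finite) rates \<Rightarrow> real^'d \<Rightarrow> nat \<Rightarrow> ('a, 'd) feedback \<Rightarrow> 'w measure
    \<Rightarrow> (real \<Rightarrow> 'w \<Rightarrow> real^'d) \<Rightarrow> bool" where
  "agent_chain T Q m\<^sub>0 N \<beta> P X \<longleftrightarrow>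
     markov_jump_process T (grid N) (jump_rate Q N \<beta>) P X \<and>
     (\<forall>m\<in>grid N. measure P {\<omega> \<in> space P. X 0 \<omega> = m} = pmf (initial_law N m\<^sub>0) m)"

text \<open>The cost of the feedback control \<open>\<beta>\<close>, where \<open>X\<close> is the chain controlled by \<open>\<beta>\<close>.\<close>

definition agent_cost ::
  "real \<Rightarrow> ('a, 'd::finite) running_costs \<Rightarrow> 'd terminal_costs \<Rightarrow> ('a, 'd) feedback \<Rightarrow> 'w measure
    \<Rightarrow> (real \<Rightarrow> 'w \<Rightarrow> real^'d) \<Rightarrow> real" where
  "agent_cost T f g \<beta> P X =
     (LINT \<omega>|P. (LBINT t:{0..T}. \<Sum>i\<in>UNIV. X t \<omega> $ i * f i t (\<beta> t i (X t \<omega>)) (X t \<omega>))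
               + (\<Sum>i\<in>UNIV. X T \<omega> $ i * g i (X T \<omega>)))"

end

theory Submission
  imports Defs
begin

text \<open>
  Along every path of the \<open>N\<close>-agent chain \<open>X\<close> with feedback \<open>\<beta>\<close>, the function
  \<open>t \<mapsto> (\<beta> t i (X\<^sub>t))\<^sub>i\<close> is an admissible open loop control of the mean field problem; let \<open>\<mu>\<close> be its
  trajectory. Since \<open>X - X\<^sub>0\<close> is the integral of the drift, evaluated at this control, plus a martingale \<open>M\<close>,
  Gronwall's inequality bounds the difference between the path cost of \<open>X\<close> and the mean field cost of the
  path control by a multiple of \<open>|X\<^sub>0 - m\<^sub>0| + \<integral> |M\<^sub>s| ds + |M\<^sub>T|\<close>. Both \<open>X\<^sub>0 - m\<^sub>0\<close> and \<open>M\<close> have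
  second moments of order \<open>1/N\<close>. Taking expectations, every feedback costs at least the mean field
  infimum up to \<open>C / sqrt N\<close>, and an open loop feedback, whose path control is itself, costs its mean
  field cost up to \<open>C / sqrt N\<close>. No convexity in the action is needed, because the path controls are
  compared with the infimum one by one.
\<close>


subsection \<open>Caratheodory differential equations\<close>

text \<open>The mean field cost of the random path control is never integrated over the paths, so no
  measurability in the path is asked of it. Only two integrable functions enter: the path cost
  \<open>c\<close> and a bound \<open>\<Delta>\<close> of its distance to that mean field cost. The
  infimum minus \<open>\<Delta>\<close> lies below \<open>c\<close> path by path, and this
  inequality is integrated.

  Regularity is assumed of the sum F and not of the single costs, so controls are handled as vectors
  in A^d, over a metric space that need not be second countable. The rates along a control are only
  measurable in time, which forces integrated equations throughout.

  The order 1/sqrt N arises as follows: transitions have rates of order N and squared size of order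
  1/N^2, so second moments are of order 1/N, and a weighted inequality between arithmetic and
  geometric means passes to first moments. All constants come from bounds of the data,
  \<open>T\<close> and the number of states.\<close>

lemma set_integrable_bounded:
  fixes h :: "real \<Rightarrow> 'e::{banach, second_countable_topology}"
  assumes [measurable]: "h \<in> borel_measurable borel" and "\<And>x. norm (h x) \<le> B"
  shows "set_integrable lborel {a..b} h"
proof (rule set_integrable_bound)
  show "set_integrable lborel {a..b} (\<lambda>_. B)"
    by (intro borel_integrable_atLeastAtMost') auto
  show "set_borel_measurable lborel {a..b} h"
    unfolding set_borel_measurable_def by measurable
  show "AE x in lborel. x \<in> {a..b} \<longrightarrow> norm (h x) \<le> norm B"
    using assms(2) by (auto intro!: AE_I2 order_trans[OF assms(2)])
qed

lemma set_integral_combine: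
  fixes h :: "real \<Rightarrow> 'e::{banach, second_countable_topology}"
  assumes "a \<le> b" "b \<le> c" "set_integrable lborel {a..c} h"
  shows "(LBINT x:{a..c}. h x) = (LBINT x:{a..b}. h x) + (LBINT x:{b..c}. h x)"
proof -
  have "AE x in lborel. x \<noteq> b"
    by (rule AE_lborel_singleton)
  then have "AE x in lborel. \<not> (x \<in> {a..b} \<and> x \<in> {b..c})"
    by (rule eventually_mono) auto
  then have "(LBINT x:{a..b} \<union> {b..c}. h x) = (LBINT x:{a..b}. h x) + (LBINT x:{b..c}. h x)"
    by (rule set_integral_Un_AE)
      (use assms in \<open>auto intro: set_integrable_subset[OF assms(3)]\<close>)
  also have "{a..b} \<union> {b..c} = {a..c}"
    using assms by auto
  finally show ?thesis .
qed

lemma norm_set_integral_le: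
  fixes h :: "real \<Rightarrow> 'e::{banach, second_countable_topology}"
  assumes "set_integrable lborel {a..b} h" "\<And>x. x \<in> {a..b} \<Longrightarrow> norm (h x) \<le> B" "a \<le> b"
  shows "norm (LBINT x:{a..b}. h x) \<le> B * (b - a)"
proof -
  have "norm (LBINT x:{a..b}. h x) \<le> (LBINT x:{a..b}. norm (h x))"
    by (rule set_integral_norm_bound[OF assms(1)])
  also have "\<dots> \<le> (LBINT x:{a..b}. B)"
    by (rule set_integral_mono)
      (use assms in \<open>auto intro!: borel_integrable_atLeastAtMost' set_integrable_norm\<close>)
  also have "\<dots> = B * (b - a)"
    using assms(3) by (simp add: set_lebesgue_integral_def)
  finally show ?thesis .
qed

lemma lipschitz_set_integral:
  fixes h :: "real \<Rightarrow> 'e::{banach, second_countable_topology}"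
  assumes "h \<in> borel_measurable borel" "\<And>x. norm (h x) \<le> B" "s \<in> {0..}" "t \<in> {0..}"
  shows "norm ((LBINT x:{0..t}. h x) - (LBINT x:{0..s}. h x)) \<le> B * \<bar>t - s\<bar>"
proof -
  have *: "norm ((LBINT x:{0..t}. h x) - (LBINT x:{0..s}. h x)) \<le> B * \<bar>t - s\<bar>"
    if "0 \<le> s" "s \<le> t" for s t
  proof -
    have "(LBINT x:{0..t}. h x) - (LBINT x:{0..s}. h x) = (LBINT x:{s..t}. h x)"
      using set_integral_combine[OF that set_integrable_bounded[OF assms(1,2)]] by simp
    then show ?thesis
      using norm_set_integral_le[OF set_integrable_bounded[OF assms(1,2)] assms(2) that(2)] that
      by simp
  qed
  show ?thesis
    using *[of s t] *[of t s] assms(3,4)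
    by (cases "s \<le> t") (auto simp: norm_minus_commute abs_minus_commute)
qed

lemma continuous_on_set_integral:
  fixes h :: "real \<Rightarrow> 'e::{banach, second_countable_topology}"
  assumes "h \<in> borel_measurable borel" "\<And>x. norm (h x) \<le> B"
  shows "continuous_on {0..} (\<lambda>t. LBINT x:{0..t}. h x)"
proof -
  have "0 \<le> B"
    using assms(2) norm_ge_zero order_trans by blast
  then have "B-lipschitz_on {0..} (\<lambda>t. LBINT x:{0..t}. h x)"
    using lipschitz_set_integral[OF assms] unfolding lipschitz_on_def dist_norm by auto
  then show ?thesis
    by (rule lipschitz_on_continuous_on)
qed

lemma set_integral_exp:
  fixes k :: real
  assumes "k > 0" "0 \<le> t"
  shows "(LBINT s:{0..t}. exp (k * s)) = (exp (k * t) - 1) / k"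
proof -
  have "((\<lambda>s. exp (k * s) / k) has_vector_derivative exp (k * s)) (at s within {0..t})" for s
  proof -
    have "((\<lambda>s. exp (k * s) / k) has_real_derivative exp (k * s)) (at s within {0..t})"
      using assms(1) by (auto intro!: derivative_eq_intros)
    then show ?thesis
      by (rule has_real_derivative_iff_has_vector_derivative[THEN iffD1])
  qed
  then have "(LBINT s:{0..t}. exp (k * s)) = exp (k * t) / k - exp (k * 0) / k"
    unfolding set_lebesgue_integral_def
    by (intro integral_FTC_atLeastAtMost assms continuous_intros) auto
  then show ?thesis
    by (simp add: diff_divide_distrib)
qed

text \<open>Retraction of the line onto [0,T]. Data constrained on [0,T] alone become functions of
  the whole line after composition with it, so Borel measurability, products and Fubini can be used
  without restricted spaces; integrals over subintervals of [0,T] do not change.\<close>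

definition clamp_time :: "real \<Rightarrow> real \<Rightarrow> real" where
  "clamp_time T t = max 0 (min T t)"

lemma clamp_time_in [simp]: "0 \<le> T \<Longrightarrow> 0 \<le> clamp_time T t" "0 \<le> T \<Longrightarrow> clamp_time T t \<le> T"
  by (auto simp: clamp_time_def)

lemma clamp_time_eq [simp]: "0 \<le> t \<Longrightarrow> t \<le> T \<Longrightarrow> clamp_time T t = t"
  by (auto simp: clamp_time_def)

lemma continuous_on_clamp_time [continuous_intros]: "continuous_on S (clamp_time T)"
  unfolding clamp_time_def by (intro continuous_intros)

lemma measurable_clamp_time_restrict:
  "0 \<le> T \<Longrightarrow> clamp_time T \<in> borel \<rightarrow>\<^sub>M restrict_space borel {0..T}"
  by (intro measurable_restrict_space2 borel_measurable_continuous_onI continuous_intros) auto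

lemma measurable_clamp_time [measurable]: "clamp_time T \<in> borel_measurable borel"
  by (intro borel_measurable_continuous_onI continuous_intros)

text \<open>
  The unknown of the fixed point problem is \<open>exp (- K s) y s\<close>; this weight makes the Picard map a
  contraction on the whole interval.
\<close>

lemma caratheodory_existence:
  fixes b :: "real \<Rightarrow> 'e::euclidean_space \<Rightarrow> 'e"
  assumes meas: "\<And>y. continuous_on UNIV y \<Longrightarrow> (\<lambda>s. b s (y s)) \<in> borel_measurable borel"
    and lip: "\<And>s x y. norm (b s x - b s y) \<le> L * norm (x - y)"
    and bound: "\<And>s x. norm (b s x) \<le> B"
    and T: "0 \<le> T"
  obtains y where "continuous_on UNIV y"
    "\<And>t. t \<in> {0..T} \<Longrightarrow> y t = x0 + (LBINT s:{0..t}. b s (y s))"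
proof -
  \<comment> \<open>Integrating the Lipschitz estimate against \<open>exp (K * s)\<close> gains a
    factor \<open>1 / K\<close>, so the contraction factor is at most 1/2. The added 1 keeps
    \<open>K\<close> positive when \<open>L\<close> vanishes.\<close>
  define K where "K = 2 * (\<bar>L\<bar> + 1)"
  have K: "K > 0" "\<bar>L\<bar> \<le> K / 2"
    by (auto simp: K_def)
  define y where "y z s = exp (K * s) *\<^sub>R apply_bcontfun z s" for z :: "real \<Rightarrow>\<^sub>C 'e" and s
  have y_cont: "continuous_on UNIV (y z)" for z
    unfolding y_def by (intro continuous_intros continuous_on_apply_bcontfun)
  define I where "I z t = (LBINT s:{0..t}. b s (y z s))" for z t
  \<comment> \<open>Clamping makes \<open>\<Phi> z\<close> bounded on the whole line, as required in
    the complete space of bounded continuous functions.\<close>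
  define \<Phi> where "\<Phi> z t = exp (- K * clamp_time T t) *\<^sub>R (x0 + I z (clamp_time T t))" for z t
  have int: "set_integrable lborel {a..c} (\<lambda>s. b s (y z s))" for z a c
    by (rule set_integrable_bounded[OF meas[OF y_cont] bound])
  have I_le: "norm (I z t) \<le> B * T" if "t \<in> {0..T}" for z t
  proof -
    have "norm (I z t) \<le> B * (t - 0)"
      unfolding I_def by (rule norm_set_integral_le[OF int bound]) (use that in auto)
    also have "\<dots> \<le> B * T"
      using that order_trans[OF norm_ge_zero bound[of 0 0]] by (intro mult_left_mono) auto
    finally show ?thesis .
  qed
  have I_cont: "continuous_on UNIV (\<lambda>t. I z (clamp_time T t))" for z
    unfolding I_def
    by (rule continuous_on_compose2[OF continuous_on_set_integral[OF meas[OF y_cont] bound]])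
      (use T in \<open>auto intro!: continuous_intros\<close>)
  have \<Phi>_in: "\<Phi> z \<in> bcontfun" for z
  proof (rule bcontfun_normI)
    show "continuous_on UNIV (\<Phi> z)"
      unfolding \<Phi>_def using I_cont by (intro continuous_intros)
    show "norm (\<Phi> z t) \<le> norm x0 + B * T" for t
    proof -
      have "norm (\<Phi> z t) \<le> 1 * norm (x0 + I z (clamp_time T t))"
        unfolding \<Phi>_def norm_scaleR using K T by (intro mult_right_mono) auto
      also have "\<dots> \<le> norm x0 + B * T"
        using I_le[of "clamp_time T t" z] T norm_triangle_ineq[of x0 "I z (clamp_time T t)"] by auto
      finally show ?thesis .
    qed
  qed
  have "dist (Bcontfun (\<Phi> z)) (Bcontfun (\<Phi> z')) \<le> 1/2 * dist z z'" for z z'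
  proof (rule dist_bound)
    fix t
    define u where "u = clamp_time T t"
    have u: "0 \<le> u" "u \<le> T"
      using T by (auto simp: u_def)
    have le: "norm (b s (y z s) - b s (y z' s)) \<le> (K / 2 * dist z z') * exp (K * s)" for s
    proof -
      have "norm (b s (y z s) - b s (y z' s)) \<le> L * norm (y z s - y z' s)"
        by (rule lip)
      also have "\<dots> \<le> (K / 2) * norm (y z s - y z' s)"
        using K by (intro mult_right_mono) auto
      also have "norm (y z s - y z' s) = exp (K * s) * dist (apply_bcontfun z s) (apply_bcontfun z' s)"
        by (simp add: y_def dist_norm flip: scaleR_diff_right)
      also have "K / 2 * \<dots> \<le> K / 2 * (exp (K * s) * dist z z')"
        using K by (intro mult_left_mono dist_bounded) auto
      finally show ?thesis
        by (simp add: mult_ac)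
    qed
    have "norm (I z u - I z' u) = norm (LBINT s:{0..u}. b s (y z s) - b s (y z' s))"
      unfolding I_def by (simp add: set_integral_diff int)
    also have "\<dots> \<le> (LBINT s:{0..u}. norm (b s (y z s) - b s (y z' s)))"
      by (intro set_integral_norm_bound set_integral_diff int)
    also have "\<dots> \<le> (LBINT s:{0..u}. (K / 2 * dist z z') * exp (K * s))"
      by (intro set_integral_mono set_integrable_norm set_integral_diff int le
          borel_integrable_atLeastAtMost' continuous_intros)
    also have "\<dots> = (K / 2 * dist z z') * ((exp (K * u) - 1) / K)"
      using set_integral_exp[OF K(1) u(1)] by simp
    also have "\<dots> \<le> (1 / 2 * dist z z') * exp (K * u)"
      using K by (simp add: field_simps)
    finally have *: "norm (I z u - I z' u) \<le> (1 / 2 * dist z z') * exp (K * u)" .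
    have "dist (\<Phi> z t) (\<Phi> z' t) = exp (- K * u) * norm (I z u - I z' u)"
      by (simp add: \<Phi>_def dist_norm flip: scaleR_diff_right u_def)
    also have "\<dots> \<le> exp (- K * u) * ((1 / 2 * dist z z') * exp (K * u))"
      by (rule mult_left_mono[OF *]) auto
    also have "\<dots> = 1 / 2 * dist z z'"
      by (simp add: exp_minus)
    finally show "dist (Bcontfun (\<Phi> z) t) (Bcontfun (\<Phi> z') t) \<le> 1 / 2 * dist z z'"
      by (simp add: Bcontfun_inverse \<Phi>_in)
  qed
  then have "\<exists>!z. Bcontfun (\<Phi> z) = z"
    by (intro banach_fix_type[of "1/2"]) auto
  then obtain z where z: "Bcontfun (\<Phi> z) = z"
    by auto
  have "y z t = x0 + (LBINT s:{0..t}. b s (y z s))" if "t \<in> {0..T}" for t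
  proof -
    have "apply_bcontfun z t = \<Phi> z t"
      by (metis Bcontfun_inverse \<Phi>_in z)
    then have "y z t = exp (K * t) *\<^sub>R \<Phi> z t"
      by (simp add: y_def)
    also have "\<dots> = x0 + I z t"
      using that by (simp add: \<Phi>_def exp_minus)
    finally show ?thesis
      by (simp add: I_def)
  qed
  then show ?thesis
    using that y_cont by blast
qed

text \<open>Jensen's inequality by separation: an average outside \<open>S\<close> would be strictly
  separated from \<open>S\<close> by a linear functional, and linear functionals commute with the
  average.\<close>

lemma set_integral_average_in_convex:
  fixes h :: "real \<Rightarrow> 'e::euclidean_space"
  assumes S: "convex S" "closed S" and h: "set_integrable lborel {a..b} h" and "a < b"
    and in_S: "\<And>s. s \<in> {a..b} \<Longrightarrow> h s \<in> S"
  shows "(1 / (b - a)) *\<^sub>R (LBINT s:{a..b}. h s) \<in> S"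
proof (rule ccontr)
  let ?z = "(1 / (b - a)) *\<^sub>R (LBINT s:{a..b}. h s)"
  assume "?z \<notin> S"
  then obtain v c where v: "inner v ?z < c" "\<And>x. x \<in> S \<Longrightarrow> inner v x > c"
    using separating_hyperplane_closed_point[OF S] by blast
  have "c * (b - a) = (LBINT s:{a..b}. c)"
    using \<open>a < b\<close> by (simp add: set_lebesgue_integral_def)
  also have "\<dots> \<le> (LBINT s:{a..b}. inner v (h s))"
  proof (rule set_integral_mono)
    show "set_integrable lborel {a..b} (\<lambda>s. inner v (h s))"
      using integrable_inner_right[of v lborel "\<lambda>s. indicator {a..b} s *\<^sub>R h s"] h
      by (simp add: set_integrable_def)
  qed (use in_S v(2) in \<open>auto intro!: borel_integrable_atLeastAtMost' less_imp_le\<close>)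
  also have "\<dots> = inner v (LBINT s:{a..b}. h s)"
    using integral_inner_right[of v lborel "\<lambda>s. indicator {a..b} s *\<^sub>R h s"] h
    by (simp add: set_integrable_def set_lebesgue_integral_def)
  also have "\<dots> = (b - a) * inner v ?z"
    using \<open>a < b\<close> by simp
  also have "\<dots> < (b - a) * c"
    using v(1) \<open>a < b\<close> by (intro mult_strict_left_mono) auto
  finally show False
    by (simp add: mult.commute)
qed

text \<open>\<open>n\<close> steps of length \<open>t / n\<close> add at most
  \<open>n * C * (t / n)^2 = C * t^2 / n\<close> in total, which tends to 0. This avoids
  differentiating \<open>\<rho>\<close>, a distance to a set in the application.\<close>

lemma subquadratic_increments_nonpos:
  fixes \<rho> :: "real \<Rightarrow> real"
  assumes "\<rho> 0 \<le> 0" "0 < h0" "0 \<le> t"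
    and step: "\<And>s h. 0 \<le> s \<Longrightarrow> 0 < h \<Longrightarrow> h \<le> h0 \<Longrightarrow> s + h \<le> t \<Longrightarrow> \<rho> (s + h) \<le> \<rho> s + C * h\<^sup>2"
  shows "\<rho> t \<le> 0"
proof (cases "t = 0")
  case False
  then have t: "0 < t"
    using assms by auto
  have bnd: "\<rho> t \<le> C * t\<^sup>2 / real n" if n: "n > 0" "t / real n \<le> h0" for n
  proof -
    define h where "h = t / real n"
    have h: "0 < h" "h \<le> h0" "real n * h = t"
      using n t by (auto simp: h_def)
    have "\<rho> (real k * h) \<le> real k * (C * h\<^sup>2)" if "k \<le> n" for k
      using that
    proof (induction k)
      case (Suc k)
      have "real k * h + h \<le> t"
        using Suc.prems h mult_right_mono[of "real (Suc k)" "real n" h] by (auto simp: algebra_simps)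
      from step[OF _ h(1,2) this] h(1) Suc show ?case
        by (auto simp: algebra_simps)
    qed (use assms in auto)
    from this[of n] have "\<rho> t \<le> real n * (C * h\<^sup>2)"
      using h(3) by simp
    also have "\<dots> = C * t\<^sup>2 / real n"
      using n by (simp add: h_def power2_eq_square field_simps)
    finally show ?thesis .
  qed
  have "eventually (\<lambda>n. n > 0) sequentially"
    by (rule eventually_gt_at_top)
  moreover have "(\<lambda>n. t / real n) \<longlonglongrightarrow> 0"
    by real_asymp
  then have "eventually (\<lambda>n. t / real n < h0) sequentially"
    using \<open>0 < h0\<close> by (rule order_tendstoD)
  ultimately have "eventually (\<lambda>n. \<rho> t \<le> C * t\<^sup>2 / real n) sequentially"
    by eventually_elim (use bnd in auto)
  moreover have "(\<lambda>n. C * t\<^sup>2 / real n) \<longlonglongrightarrow> 0"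
    by real_asymp
  ultimately show ?thesis
    using tendsto_lowerbound[of "\<lambda>n. C * t\<^sup>2 / real n" 0 sequentially "\<rho> t"] by auto
qed (use assms in auto)

text \<open>
  The field is extended by the closest point projection onto \<open>S\<close>. Freezing the projected state over a
  step of length \<open>h\<close> costs \<open>O(h\<^sup>2)\<close>, so the distance of the solution to \<open>S\<close> cannot grow.
\<close>

lemma caratheodory_viability:
  fixes b :: "real \<Rightarrow> 'e::euclidean_space \<Rightarrow> 'e"
  assumes S: "convex S" "closed S" "x0 \<in> S"
    and meas: "\<And>y. continuous_on UNIV y \<Longrightarrow> (\<And>s. y s \<in> S) \<Longrightarrow> (\<lambda>s. b s (y s)) \<in> borel_measurable borel"
    and lip: "\<And>s x y. x \<in> S \<Longrightarrow> y \<in> S \<Longrightarrow> norm (b s x - b s y) \<le> L * norm (x - y)"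
    and bound: "\<And>s x. x \<in> S \<Longrightarrow> norm (b s x) \<le> B"
    and T: "0 \<le> T" and h0: "0 < h0"
    and inward: "\<And>s x h. x \<in> S \<Longrightarrow> 0 < h \<Longrightarrow> h \<le> h0 \<Longrightarrow> x + h *\<^sub>R b s x \<in> S"
  obtains y where "continuous_on UNIV y"
    "\<And>t. t \<in> {0..T} \<Longrightarrow> y t \<in> S \<and> y t = x0 + (LBINT s:{0..t}. b s (y s))"
proof -
  let ?P = "closest_point S"
  have S': "S \<noteq> {}"
    using S by auto
  have P: "?P x \<in> S" for x
    by (rule closest_point_in_set[OF S(2) S'])
  have P_lip: "norm (?P x - ?P y) \<le> norm (x - y)" for x y
    using closest_point_lipschitz[OF S(1,2) S', of x y] by (simp add: dist_norm)
  have L: "L * norm (?P x - ?P y) \<le> \<bar>L\<bar> * norm (x - y)" for x y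
    by (rule mult_mono) (auto intro: P_lip)
  have lip': "norm (b s (?P x) - b s (?P y)) \<le> \<bar>L\<bar> * norm (x - y)" for s x y
    using lip[OF P P] L by (rule order_trans)
  have cont_P: "continuous_on UNIV (\<lambda>s. ?P (y s))" if "continuous_on UNIV y" for y :: "real \<Rightarrow> 'e"
    by (rule continuous_on_compose2[OF continuous_on_closest_point[OF S(1,2) S', of UNIV] that]) auto
  obtain y where y: "continuous_on UNIV y"
    and y_eq: "\<And>t. t \<in> {0..T} \<Longrightarrow> y t = x0 + (LBINT s:{0..t}. b s (?P (y s)))"
    by (rule caratheodory_existence[of "\<lambda>s x. b s (?P x)" "\<bar>L\<bar>" B T x0])
      (use meas[OF cont_P P] lip' bound[OF P] T in auto)
  have int: "set_integrable lborel {a..c} (\<lambda>s. b s (?P (y s)))" for a c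
    by (rule set_integrable_bounded[OF meas[OF cont_P[OF y] P] bound[OF P]])
  have B: "0 \<le> B"
    using order_trans[OF norm_ge_zero bound[OF S(3)]] .
  define \<rho> where "\<rho> s = dist (y s) (?P (y s))" for s
  have step: "\<rho> (s + h) \<le> \<rho> s + (\<bar>L\<bar> * B) * h\<^sup>2"
    if sh: "0 \<le> s" "0 < h" "h \<le> h0" "s + h \<le> T" for s h
  proof -
    define z where "z = ?P (y s)"
    have z: "z \<in> S"
      by (simp add: z_def P)
    have int_z: "set_integrable lborel {s..s+h} (\<lambda>r. b r z)"
      by (rule set_integrable_bounded[OF meas[OF continuous_on_const z] bound[OF z]])
    have y_inc: "y r = y s + (LBINT u:{s..r}. b u (?P (y u)))" if "r \<in> {s..s+h}" for r
      using y_eq[of r] y_eq[of s] set_integral_combine[OF _ _ int, of 0 s r] that sh by auto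
    have y_near: "norm (y r - y s) \<le> B * h" if r: "r \<in> {s..s+h}" for r
    proof -
      have "norm (y r - y s) \<le> B * (r - s)"
        using y_inc[OF r] norm_set_integral_le[OF int bound[OF P], of s r] r by simp
      also have "\<dots> \<le> B * h"
        using r B by (intro mult_left_mono) auto
      finally show ?thesis .
    qed
    \<comment> \<open>The integrand lies in \<open>S\<close> by the inward condition with step
      \<open>h\<close>. Its average is \<open>z\<close> plus the integral of the field frozen at
      \<open>z\<close>, which is therefore a competitor for the point of \<open>S\<close> closest to
      \<open>y (s + h)\<close>.\<close>
    have w: "(1 / (s + h - s)) *\<^sub>R (LBINT r:{s..s+h}. z + h *\<^sub>R b r z) \<in> S"
      by (rule set_integral_average_in_convex[OF S(1,2)])
        (use sh z in \<open>auto intro!: inward set_integral_add(1) set_integrable_scaleR_right int_z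
          borel_integrable_atLeastAtMost'[of _ _ "\<lambda>_. z"]\<close>)
    have w_eq: "(1 / (s + h - s)) *\<^sub>R (LBINT r:{s..s+h}. z + h *\<^sub>R b r z) = z + (LBINT r:{s..s+h}. b r z)"
    proof -
      have "(LBINT r:{s..s+h}. z + h *\<^sub>R b r z) = h *\<^sub>R z + h *\<^sub>R (LBINT r:{s..s+h}. b r z)"
        using int_z sh by (subst set_integral_add)
          (auto intro!: borel_integrable_atLeastAtMost' set_integrable_scaleR_right
            simp: set_lebesgue_integral_def)
      then show ?thesis
        using sh by (simp add: scaleR_add_right)
    qed
    \<comment> \<open>The solution moves by at most \<open>B * h\<close> within the step, so
      freezing changes the field by O(h) and, after integration, the position by O(h^2).\<close>
    have diff: "norm (b r (?P (y r)) - b r z) \<le> \<bar>L\<bar> * (B * h)" if "r \<in> {s..s+h}" for r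
      unfolding z_def by (rule order_trans[OF lip'], intro mult_left_mono y_near that) auto
    have "\<rho> (s + h) \<le> dist (y (s + h)) (z + (LBINT r:{s..s+h}. b r z))"
      unfolding \<rho>_def by (rule closest_point_le[OF S(2)]) (use w w_eq in simp)
    also have "\<dots> = norm ((y s - z) + (LBINT r:{s..s+h}. b r (?P (y r)) - b r z))"
      using y_inc[of "s + h"] sh int int_z by (simp add: dist_norm algebra_simps set_integral_diff)
    also have "\<dots> \<le> norm (y s - z) + norm (LBINT r:{s..s+h}. b r (?P (y r)) - b r z)"
      by (rule norm_triangle_ineq)
    also have "norm (LBINT r:{s..s+h}. b r (?P (y r)) - b r z) \<le> \<bar>L\<bar> * (B * h) * (s + h - s)"
      by (rule norm_set_integral_le[OF _ diff]) (use int int_z sh in auto)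
    finally show ?thesis
      by (simp add: \<rho>_def z_def dist_norm power2_eq_square mult_ac)
  qed
  have in_S: "y t \<in> S" if t: "t \<in> {0..T}" for t
  proof -
    have "y 0 = x0"
    proof -
      have "(LBINT s:{0..0::real}. b s (?P (y s))) = 0"
        using norm_set_integral_le[OF int bound[OF P], of 0 0] by simp
      then show ?thesis
        using y_eq[of 0] T by auto
    qed
    then have "\<rho> 0 \<le> 0"
      by (simp add: \<rho>_def closest_point_self S)
    then have "\<rho> t \<le> 0"
      by (rule subquadratic_increments_nonpos[OF _ h0, where C = "\<bar>L\<bar> * B"]) (use t step in auto)
    then have "y t = ?P (y t)"
      by (simp add: \<rho>_def)
    then show ?thesis
      using P by metis
  qed
  have "y t = x0 + (LBINT s:{0..t}. b s (y s))" if t: "t \<in> {0..T}" for t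
  proof -
    have "(LBINT s:{0..t}. b s (?P (y s))) = (LBINT s:{0..t}. b s (y s))"
    proof (rule set_lebesgue_integral_cong)
      show "\<forall>s. s \<in> {0..t} \<longrightarrow> b s (?P (y s)) = b s (y s)"
      proof (intro allI impI)
        fix s assume "s \<in> {0..t}"
        then have "y s \<in> S"
          using t by (intro in_S) auto
        then show "b s (?P (y s)) = b s (y s)"
          by (simp only: closest_point_self)
      qed
    qed simp
    then show ?thesis
      using y_eq[OF t] by simp
  qed
  then show ?thesis
    using that y in_S by blast
qed

text \<open>\<open>u\<close> itself need not be differentiable, but the right-hand side
  \<open>c + L * U t\<close> is, and its product with \<open>exp (- L * t)\<close> is
  nonincreasing.\<close>

lemma gronwall_constant:
  fixes u :: "real \<Rightarrow> real"
  assumes u: "continuous_on {0..T} u" and L: "0 \<le> L"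
    and le: "\<And>t. t \<in> {0..T} \<Longrightarrow> u t \<le> c + L * (LBINT s:{0..t}. u s)"
    and t: "t \<in> {0..T}"
  shows "u t \<le> c * exp (L * t)"
proof -
  have int: "set_integrable lborel {0..s} u" if "s \<in> {0..T}" for s
    by (rule borel_integrable_atLeastAtMost') (use that in \<open>auto intro: continuous_on_subset[OF u]\<close>)
  define U where "U s = integral {0..s} u" for s
  have U: "(LBINT r:{0..s}. u r) = U s" if "s \<in> {0..T}" for s
    unfolding U_def by (rule set_borel_integral_eq_integral(2)[OF int[OF that]])
  have U': "(U has_real_derivative u s) (at s within {0..T})" if "s \<in> {0..T}" for s
    unfolding U_def by (rule integral_has_real_derivative[OF u that])
  define \<psi> where "\<psi> s = exp (- L * s) * (c + L * U s)" for s
  have "\<psi> t \<le> \<psi> 0"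
  proof (rule DERIV_nonpos_imp_decreasing_open[where f = \<psi> and a = 0 and b = t])
    show "0 \<le> t" using t by simp
    show "\<exists>y. DERIV \<psi> s :> y \<and> y \<le> 0" if s: "0 < s" "s < t" for s
    proof (intro exI conjI)
      have "at s within {0..T} = at s"
        by (rule at_within_interior) (use s t in auto)
      then have [derivative_intros]: "(U has_real_derivative u s) (at s)"
        using U'[of s] s t by auto
      show "DERIV \<psi> s :> exp (- L * s) * (L * (u s - (c + L * U s)))"
        unfolding \<psi>_def by (auto intro!: derivative_eq_intros simp: algebra_simps)
      show "exp (- L * s) * (L * (u s - (c + L * U s))) \<le> 0"
        using le[of s] U[of s] s t L by (auto intro!: mult_nonneg_nonpos)
    qed
    have "continuous_on {0..T} U"
      using U' DERIV_continuous_on by blast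
    then show "continuous_on {0..t} \<psi>"
      unfolding \<psi>_def using t by (auto intro!: continuous_intros elim: continuous_on_subset)
  qed
  then have "exp (- L * t) * (c + L * U t) \<le> c"
    by (simp add: \<psi>_def U_def)
  then have "c + L * U t \<le> c * exp (L * t)"
    by (simp add: exp_minus field_simps)
  moreover have "u t \<le> c + L * U t"
    using le[OF t] unfolding U[OF t] .
  ultimately show ?thesis
    by (rule order_trans[rotated])
qed


subsection \<open>Measurability of controls\<close>

text \<open>Approximate \<open>x\<close> by simple functions and project the approximants onto
  \<open>K\<close>, where \<open>h\<close> is continuous. For a simple function the composite is
  glued from the measurable functions obtained at each of its values. This avoids a product
  sigma-algebra over the type of actions, which carries no countable base.\<close>

lemma caratheodory_measurable:
  fixes h :: "'p::euclidean_space \<Rightarrow> 'b::topological_space \<Rightarrow> real"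
  assumes K: "convex K" "closed K" "K \<noteq> {}"
    and cont: "\<And>a. a \<in> B \<Longrightarrow> continuous_on K (\<lambda>p. h p a)"
    and meas: "\<And>p. p \<in> K \<Longrightarrow> h p \<in> borel_measurable (restrict_space borel B)"
    and \<alpha>: "\<alpha> \<in> M \<rightarrow>\<^sub>M restrict_space borel B"
    and x: "x \<in> borel_measurable M" "\<And>w. w \<in> space M \<Longrightarrow> x w \<in> K"
  shows "(\<lambda>w. h (x w) (\<alpha> w)) \<in> borel_measurable M"
proof -
  let ?P = "closest_point K"
  obtain F where F: "\<And>n. simple_function M (F n)"
    "\<And>w. w \<in> space M \<Longrightarrow> (\<lambda>n. F n w) \<longlonglongrightarrow> x w"
    using borel_measurable_implies_sequence_metric[OF x(1), of 0] by blast
  have P: "?P y \<in> K" for y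
    by (rule closest_point_in_set[OF K(2,3)])
  have \<alpha>_in: "\<alpha> w \<in> B" if "w \<in> space M" for w
    using measurable_space[OF \<alpha> that] by (simp add: space_restrict_space)
  show ?thesis
  proof (rule borel_measurable_LIMSEQ_metric)
    show "(\<lambda>w. h (?P (F n w)) (\<alpha> w)) \<in> borel_measurable M" for n
    proof (rule measurable_compose_countable'[where I = "F n ` space M" and g = "F n"
          and f = "\<lambda>y w. h (?P y) (\<alpha> w)"])
      show "F n \<in> M \<rightarrow>\<^sub>M count_space (F n ` space M)"
        by (rule measurable_count_space_extend[OF subset_UNIV _ measurable_simple_function[OF F(1)]]) auto
      show "countable (F n ` space M)"
        using F(1)[of n] by (auto simp: simple_function_def intro: countable_finite)
    qed (rule measurable_compose[OF \<alpha> meas[OF P]])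
    show "(\<lambda>n. h (?P (F n w)) (\<alpha> w)) \<longlonglongrightarrow> h (x w) (\<alpha> w)" if w: "w \<in> space M" for w
    proof -
      have "(\<lambda>n. ?P (F n w)) \<longlonglongrightarrow> ?P (x w)"
        using continuous_at_closest_point[OF K] F(2)[OF w] by (metis isCont_tendsto_compose)
      then have "(\<lambda>n. ?P (F n w)) \<longlonglongrightarrow> x w"
        using closest_point_self x(2)[OF w] by metis
      then show ?thesis
        by (rule continuous_on_tendsto_compose[OF cont[OF \<alpha>_in[OF w]]])
          (use P x(2)[OF w] in auto)
    qed
  qed
qed

lemma vec_nth_measurable_restrict:
  fixes \<alpha> :: "'w \<Rightarrow> 'a::metric_space^'d::finite"
  assumes \<alpha>: "\<alpha> \<in> M \<rightarrow>\<^sub>M restrict_space borel (action_vectors A)"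
  shows "(\<lambda>w. \<alpha> w $ i) \<in> M \<rightarrow>\<^sub>M restrict_space borel A"
proof (rule measurable_restrict_space2)
  show "(\<lambda>w. \<alpha> w $ i) \<in> space M \<rightarrow> A"
    using measurable_space[OF \<alpha>] by (auto simp: space_restrict_space action_vectors_def)
  have "\<alpha> \<in> borel_measurable M"
    using \<alpha> by (auto simp: measurable_restrict_space2_iff)
  moreover have "(\<lambda>x :: 'a^'d. x $ i) \<in> borel_measurable borel"
    by (intro borel_measurable_continuous_onI continuous_intros)
  ultimately show "(\<lambda>w. \<alpha> w $ i) \<in> borel_measurable M"
    by (rule measurable_compose)
qed

text \<open>Collects the centres of finite nets of radius 1/(n+1). The centres need not lie in
  \<open>A\<close>; density is claimed only at points of \<open>A\<close>, which covers the case of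
  an empty \<open>A\<close> too.\<close>

lemma compact_dense_sequence:
  fixes A :: "'a::metric_space set"
  assumes "compact A"
  obtains d :: "nat \<Rightarrow> 'a" where "\<And>x e. x \<in> A \<Longrightarrow> 0 < e \<Longrightarrow> \<exists>n. dist (d n) x < e"
proof -
  have "\<forall>e>0. \<exists>k. finite k \<and> A \<subseteq> (\<Union>x\<in>k. ball x e)"
    using assms unfolding compact_eq_totally_bounded by (rule conjunct2)
  then have "\<exists>k. finite k \<and> A \<subseteq> (\<Union>x\<in>k. ball x (1 / real (Suc n)))" for n
    by simp
  then obtain k where k: "\<And>n. finite (k n)" "\<And>n. A \<subseteq> (\<Union>x\<in>k n. ball x (1 / real (Suc n)))"
    by metis
  define D where "D = (\<Union>n. k n)"
  have "countable D"
    using k(1) by (auto simp: D_def intro: countable_finite)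
  have "\<exists>n. dist (from_nat_into D n) x < e" if x: "x \<in> A" "0 < e" for x e
  proof -
    obtain n where n: "1 / real (Suc n) < e"
      using nat_approx_posE[OF x(2)] by blast
    obtain c where c: "c \<in> k n" "dist c x < 1 / real (Suc n)"
      using k(2)[of n] x(1) by (meson UN_E mem_ball subsetD)
    then have "c \<in> D"
      by (auto simp: D_def)
    then obtain j where "from_nat_into D j = c"
      using \<open>countable D\<close> from_nat_into_surj[of D c] by blast
    then show ?thesis
      using c n by (intro exI[of _ j]) auto
  qed
  then show ?thesis
    using that by blast
qed

text \<open>
  The type of actions need not be second countable; separability of \<open>A\<close> makes open sets of vectors
  countable unions of boxes, as far as \<open>A\<close> is concerned.
\<close>

lemma measurable_action_vectors:
  fixes A :: "'a::metric_space set" and \<alpha> :: "'w \<Rightarrow> 'a^'d::finite"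
  assumes A: "compact A" and \<alpha>: "\<And>i. (\<lambda>w. \<alpha> w $ i) \<in> M \<rightarrow>\<^sub>M restrict_space borel A"
  shows "\<alpha> \<in> M \<rightarrow>\<^sub>M restrict_space borel (action_vectors A)"
proof (rule measurable_restrict_space2)
  have \<alpha>_in: "\<alpha> w $ i \<in> A" if "w \<in> space M" for w i
    using measurable_space[OF \<alpha> that] by (simp add: space_restrict_space)
  then show "\<alpha> \<in> space M \<rightarrow> action_vectors A"
    by (auto simp: action_vectors_def)
  obtain d where d: "\<And>x e. x \<in> A \<Longrightarrow> 0 < e \<Longrightarrow> \<exists>n::nat. dist (d n) x < e"
    using compact_dense_sequence[OF A] by blast
  \<comment> \<open>The indices form a countable type because \<open>'d\<close> is finite. The boxes
    contained in an open set therefore give a countable union of measurable preimages.\<close>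
  define box where "box = (\<lambda>(k :: 'd \<Rightarrow> nat, n :: nat). {v :: 'a^'d. \<forall>i. v $ i \<in> ball (d (k i)) (1 / Suc n)})"
  show "\<alpha> \<in> borel_measurable M"
  proof (rule borel_measurableI)
    fix U :: "('a^'d) set"
    assume U: "open U"
    have box_sets: "\<alpha> -` box c \<inter> space M \<in> sets M" for c
    proof (cases c)
      case (Pair k n)
      have [measurable]: "(\<lambda>w. \<alpha> w $ i) \<in> borel_measurable M" for i
        using \<alpha>[of i] by (auto simp: measurable_restrict_space2_iff)
      have "\<alpha> -` box c \<inter> space M = (\<Inter>i. (\<lambda>w. \<alpha> w $ i) -` ball (d (k i)) (1 / Suc n) \<inter> space M)"
        by (auto simp: box_def Pair)
      also have "\<dots> \<in> sets M"
        by (intro sets.finite_INT measurable_sets_borel) auto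
      finally show ?thesis .
    qed
    have "\<alpha> -` U \<inter> space M = (\<Union>c\<in>{c. box c \<subseteq> U}. \<alpha> -` box c \<inter> space M)"
    proof (intro equalityI subsetI)
      fix w assume w: "w \<in> \<alpha> -` U \<inter> space M"
      then obtain e where e: "0 < e" "ball (\<alpha> w) e \<subseteq> U"
        using U by (meson IntD1 open_contains_ball vimageE)
      \<comment> \<open>For \<open>v\<close> in the box chosen below, \<open>\<alpha> w $ i\<close>
        and \<open>v $ i\<close> lie within \<open>r\<close> of the same centre, hence within
        \<open>2 * r\<close> of each other; summing over all coordinates gives
        \<open>e\<close>.\<close>
      define r where "r = e / (2 * real CARD('d))"
      have r: "0 < r" using e by (simp add: r_def)
      obtain n where n: "1 / real (Suc n) < r"
        using nat_approx_posE[OF r] by blast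
      have "\<exists>j. dist (d j) (\<alpha> w $ i) < 1 / real (Suc n)" for i
        using w by (intro d \<alpha>_in) auto
      then obtain k where k: "\<And>i. dist (d (k i)) (\<alpha> w $ i) < 1 / real (Suc n)"
        by metis
      have "box (k, n) \<subseteq> ball (\<alpha> w) e"
      proof
        fix v assume v: "v \<in> box (k, n)"
        have "dist (\<alpha> w $ i) (v $ i) < 2 * r" for i
        proof -
          have "dist (d (k i)) (v $ i) < 1 / real (Suc n)"
            using v by (auto simp: box_def)
          then show ?thesis
            using k[of i] n dist_triangle2[of "\<alpha> w $ i" "v $ i" "d (k i)"]
            by (simp add: dist_commute)
        qed
        then have "(\<Sum>i\<in>UNIV. dist (\<alpha> w $ i) (v $ i)) < (\<Sum>i\<in>(UNIV :: 'd set). 2 * r)"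
          by (intro sum_strict_mono) auto
        moreover have "dist (\<alpha> w) v \<le> (\<Sum>i\<in>UNIV. dist (\<alpha> w $ i) (v $ i))"
          unfolding dist_vec_def by (rule L2_set_le_sum) auto
        ultimately show "v \<in> ball (\<alpha> w) e"
          by (simp add: r_def)
      qed
      moreover have "\<alpha> w \<in> box (k, n)"
        using k by (auto simp: box_def)
      ultimately show "w \<in> (\<Union>c\<in>{c. box c \<subseteq> U}. \<alpha> -` box c \<inter> space M)"
        using e w by blast
    qed auto
    also have "\<dots> \<in> sets M"
      using box_sets by (intro sets.countable_UN'') auto
    finally show "\<alpha> -` U \<inter> space M \<in> sets M" .
  qed
qed

lemma borel_measurable_vecI:
  fixes v :: "'w \<Rightarrow> real^'d::finite"
  assumes "\<And>i. (\<lambda>w. v w $ i) \<in> borel_measurable M"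
  shows "v \<in> borel_measurable M"
  unfolding borel_measurable_euclidean_space[where f = v]
  using assms by (auto simp: Basis_vec_def inner_axis)

lemma borel_measurable_vec_nth [measurable]:
  "(\<lambda>v :: real^'d::finite. v $ i) \<in> borel_measurable borel"
  by (intro borel_measurable_continuous_onI continuous_intros)

section \<open>Geometry of the probability simplex\<close>

lemma convex_prob_simplex: "convex (prob_simplex :: (real^'d::finite) set)"
  unfolding prob_simplex_def convex_def by (auto simp: sum.distrib simp flip: sum_distrib_left)

lemma closed_prob_simplex: "closed (prob_simplex :: (real^'d::finite) set)"
proof -
  have "prob_simplex = (\<Inter>i. {m :: real^'d. 0 \<le> m $ i}) \<inter> {m. (\<Sum>i\<in>UNIV. m $ i) = 1}"
    by (auto simp: prob_simplex_def)
  moreover have "closed \<dots>"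
    by (intro closed_Int closed_INT ballI closed_Collect_le closed_Collect_eq continuous_intros)
  ultimately show ?thesis by simp
qed

lemma prob_simplex_le_1: "m \<in> prob_simplex \<Longrightarrow> m $ i \<le> 1" for m :: "real^'d::finite"
  unfolding prob_simplex_def using member_le_sum[of i UNIV "\<lambda>i. m $ i"] by auto

lemma norm_prob_simplex_le: "m \<in> prob_simplex \<Longrightarrow> norm m \<le> 1" for m :: "real^'d::finite"
  using norm_le_l1_cart[of m] by (auto simp: prob_simplex_def)

lemma compact_prob_simplex: "compact (prob_simplex :: (real^'d::finite) set)"
  unfolding compact_eq_bounded_closed
  using closed_prob_simplex norm_prob_simplex_le by (auto simp: bounded_iff)

lemma prob_simplex_nonempty: "prob_simplex \<noteq> ({} :: (real^'d::finite) set)"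
proof -
  have "axis undefined 1 \<in> (prob_simplex :: (real^'d) set)"
    by (auto simp: prob_simplex_def axis_def)
  then show ?thesis by auto
qed

lemma norm_vec_le_card:
  fixes v :: "real^'d::finite"
  assumes "\<And>i. \<bar>v $ i\<bar> \<le> B"
  shows "norm v \<le> real CARD('d) * B"
  using norm_le_l1_cart[of v] sum_mono[of UNIV "\<lambda>i. \<bar>v $ i\<bar>" "\<lambda>_. B"] assms by simp


subsection \<open>The mean field dynamics\<close>

text \<open>Assumption A with its constants made explicit: one Lipschitz constant \<open>L\<close>
  for rates, running cost and terminal cost, a bound \<open>K\<close> of the rates and a bound
  \<open>F_max\<close> of the running cost. \<open>K\<close> is positive so that
  \<open>1 / (D * K)\<close> is a step length. Every later constant is built from these,
  \<open>T\<close> and the number of states, hence does not depend on \<open>N\<close>.\<close>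

locale mean_field =
  fixes T :: real and A :: "'a::metric_space set" and Q :: "('a, 'd::finite) rates"
    and f :: "('a, 'd) running_costs" and g :: "'d terminal_costs" and K L F_max :: real
  assumes T_pos: "0 < T" and compact_A: "compact A"
    and Q_cont: "\<And>i j. continuous_on ({0..T} \<times> A \<times> prob_simplex) (\<lambda>(t, a, m). Q i j t a m)"
    and Q_nonneg: "\<And>i j t a m. t \<in> {0..T} \<Longrightarrow> a \<in> A \<Longrightarrow> m \<in> prob_simplex \<Longrightarrow> 0 \<le> Q i j t a m"
    and Q_le: "\<And>i j t a m. t \<in> {0..T} \<Longrightarrow> a \<in> A \<Longrightarrow> m \<in> prob_simplex \<Longrightarrow> Q i j t a m \<le> K"
    and Q_lip: "\<And>i j t a m p. t \<in> {0..T} \<Longrightarrow> a \<in> A \<Longrightarrow> m \<in> prob_simplex \<Longrightarrow> p \<in> prob_simplex \<Longrightarrow>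
      \<bar>Q i j t a m - Q i j t a p\<bar> \<le> L * norm (m - p)"
    and F_cont: "continuous_on ({0..T} \<times> action_vectors A \<times> prob_simplex) (\<lambda>(t, a, m). running_F f t a m)"
    and F_lip: "\<And>t a m p. t \<in> {0..T} \<Longrightarrow> a \<in> action_vectors A \<Longrightarrow> m \<in> prob_simplex \<Longrightarrow> p \<in> prob_simplex \<Longrightarrow>
      \<bar>running_F f t a m - running_F f t a p\<bar> \<le> L * norm (m - p)"
    and F_bound: "\<And>t a m. t \<in> {0..T} \<Longrightarrow> a \<in> action_vectors A \<Longrightarrow> m \<in> prob_simplex \<Longrightarrow>
      \<bar>running_F f t a m\<bar> \<le> F_max"
    and G_lip: "\<And>m p. m \<in> prob_simplex \<Longrightarrow> p \<in> prob_simplex \<Longrightarrow>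
      \<bar>terminal_G g m - terminal_G g p\<bar> \<le> L * norm (m - p)"
    and K_pos: "0 < K" and L_nonneg: "0 \<le> L"
begin

text \<open>Time and state together form the Euclidean variable, ranging over a closed convex set;
  the action is the variable known to be measurable only.\<close>

lemma continuous_composite_measurable:
  fixes h :: "real \<times> 'b::metric_space \<times> (real^'d) \<Rightarrow> real"
  assumes h: "continuous_on ({0..T} \<times> B \<times> prob_simplex) h"
    and \<alpha>: "\<alpha> \<in> M \<rightarrow>\<^sub>M restrict_space borel B"
    and \<tau>: "\<tau> \<in> borel_measurable M" "\<And>w. w \<in> space M \<Longrightarrow> \<tau> w \<in> {0..T}"
    and m: "m \<in> borel_measurable M" "\<And>w. w \<in> space M \<Longrightarrow> m w \<in> prob_simplex"
  shows "(\<lambda>w. h (\<tau> w, \<alpha> w, m w)) \<in> borel_measurable M"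
proof -
  have "(\<lambda>w. (\<lambda>p a. h (fst p, a, snd p)) (\<tau> w, m w) (\<alpha> w)) \<in> borel_measurable M"
  proof (rule caratheodory_measurable[where K = "{0..T} \<times> prob_simplex" and B = B])
    show "continuous_on ({0..T} \<times> prob_simplex) (\<lambda>p. h (fst p, a, snd p))" if "a \<in> B" for a
      by (rule continuous_on_compose2[OF h]) (use that in \<open>auto intro!: continuous_intros\<close>)
    show "(\<lambda>a. h (fst p, a, snd p)) \<in> borel_measurable (restrict_space borel B)"
      if "p \<in> {0..T} \<times> prob_simplex" for p
      by (intro borel_measurable_continuous_on_restrict continuous_on_compose2[OF h])
        (use that in \<open>auto intro!: continuous_intros\<close>)
    show "convex ({0..T} \<times> (prob_simplex :: (real^'d) set))"
      by (intro convex_Times convex_prob_simplex) auto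
    show "closed ({0..T} \<times> (prob_simplex :: (real^'d) set))"
      by (intro closed_Times closed_prob_simplex) auto
    show "{0..T} \<times> (prob_simplex :: (real^'d) set) \<noteq> {}"
      using prob_simplex_nonempty T_pos by auto
    show "(\<lambda>w. (\<tau> w, m w)) \<in> borel_measurable M"
      using \<tau>(1) m(1) by measurable
  qed (use \<alpha> \<tau> m in auto)
  then show ?thesis by simp
qed

lemma Q_measurable:
  assumes "\<alpha> \<in> M \<rightarrow>\<^sub>M restrict_space borel A"
    and "\<tau> \<in> borel_measurable M" "\<And>w. w \<in> space M \<Longrightarrow> \<tau> w \<in> {0..T}"
    and "m \<in> borel_measurable M" "\<And>w. w \<in> space M \<Longrightarrow> m w \<in> prob_simplex"
  shows "(\<lambda>w. Q i j (\<tau> w) (\<alpha> w) (m w)) \<in> borel_measurable M"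
  using continuous_composite_measurable[OF Q_cont assms] by simp

lemma F_measurable:
  assumes "\<alpha> \<in> M \<rightarrow>\<^sub>M restrict_space borel (action_vectors A)"
    and "\<tau> \<in> borel_measurable M" "\<And>w. w \<in> space M \<Longrightarrow> \<tau> w \<in> {0..T}"
    and "m \<in> borel_measurable M" "\<And>w. w \<in> space M \<Longrightarrow> m w \<in> prob_simplex"
  shows "(\<lambda>w. running_F f (\<tau> w) (\<alpha> w) (m w)) \<in> borel_measurable M"
  using continuous_composite_measurable[OF F_cont assms] by simp

section \<open>Bounds for the drift and invariance of the simplex\<close>

definition D :: real where "D = real CARD('d)"

lemma D_ge_1: "1 \<le> D"
  using zero_less_card_finite[where 'a='d] unfolding D_def by linarith

lemma drift_nth:
  "mf_drift Q \<alpha> t m $ i = (\<Sum>j\<in>UNIV. m $ j * Q j i t (\<alpha> t $ j) m - m $ i * Q i j t (\<alpha> t $ i) m)"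
  by (simp add: mf_drift_def)

lemma weighted_rate_bound:
  assumes "t \<in> {0..T}" "a \<in> A" "m \<in> prob_simplex"
  shows "0 \<le> m $ k * Q i j t a m" "m $ k * Q i j t a m \<le> K"
proof -
  have m: "0 \<le> m $ k" "m $ k \<le> 1"
    using assms prob_simplex_le_1 by (auto simp: prob_simplex_def)
  then show "0 \<le> m $ k * Q i j t a m"
    using Q_nonneg[OF assms] by auto
  have "m $ k * Q i j t a m \<le> 1 * K"
    using m Q_le[OF assms] Q_nonneg[OF assms] by (intro mult_mono) auto
  then show "m $ k * Q i j t a m \<le> K" by simp
qed

lemma drift_bound:
  assumes t: "t \<in> {0..T}" and a: "\<alpha> t \<in> action_vectors A" and m: "m \<in> prob_simplex"
  shows "norm (mf_drift Q \<alpha> t m) \<le> D * (D * K)"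
  unfolding D_def
proof (rule norm_vec_le_card)
  fix i
  have a': "\<alpha> t $ j \<in> A" for j
    using a by (auto simp: action_vectors_def)
  have "\<bar>mf_drift Q \<alpha> t m $ i\<bar> \<le> (\<Sum>j\<in>UNIV. \<bar>m $ j * Q j i t (\<alpha> t $ j) m - m $ i * Q i j t (\<alpha> t $ i) m\<bar>)"
    unfolding drift_nth by (rule sum_abs)
  also have "\<dots> \<le> (\<Sum>j\<in>(UNIV::'d set). K)"
  proof (rule sum_mono)
    fix j
    show "\<bar>m $ j * Q j i t (\<alpha> t $ j) m - m $ i * Q i j t (\<alpha> t $ i) m\<bar> \<le> K"
      using weighted_rate_bound[OF t a' m, of j j i j] weighted_rate_bound[OF t a' m, of i i j i]
      by (auto simp: abs_le_iff)
  qed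
  finally show "\<bar>mf_drift Q \<alpha> t m $ i\<bar> \<le> real CARD('d) * K"
    by simp
qed

lemma weighted_rate_lip:
  assumes "t \<in> {0..T}" "a \<in> A" "m \<in> prob_simplex" "p \<in> prob_simplex"
  shows "\<bar>m $ k * Q i j t a m - p $ k * Q i j t a p\<bar> \<le> (K + L) * norm (m - p)"
proof -
  have "m $ k * Q i j t a m - p $ k * Q i j t a p
      = (m $ k - p $ k) * Q i j t a m + p $ k * (Q i j t a m - Q i j t a p)"
    by (simp add: algebra_simps)
  also have "\<bar>\<dots>\<bar> \<le> \<bar>m $ k - p $ k\<bar> * Q i j t a m + p $ k * \<bar>Q i j t a m - Q i j t a p\<bar>"
    using Q_nonneg[OF assms(1-3), of i j] assms(4)
    by (intro order_trans[OF abs_triangle_ineq]) (simp add: abs_mult prob_simplex_def)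
  also have "\<dots> \<le> norm (m - p) * K + 1 * (L * norm (m - p))"
    using component_le_norm_cart[of "m - p" k] Q_nonneg[OF assms(1-3)] Q_le[OF assms(1-3)] Q_lip[OF assms]
      prob_simplex_le_1[OF assms(4)] assms(4)
    by (intro add_mono mult_mono) (auto simp: prob_simplex_def)
  finally show ?thesis
    by (simp add: algebra_simps)
qed

text \<open>\<open>2 * (K + L)\<close> accounts for the inflow and the outflow of one pair of
  states, one factor \<open>D\<close> for the sum over the second state, the other for estimating
  the norm by the coordinates.\<close>

definition L_drift :: real where "L_drift = D * (D * (2 * (K + L)))"

lemma L_drift_nonneg: "0 \<le> L_drift"
  using D_ge_1 K_pos L_nonneg by (simp add: L_drift_def)

lemma drift_lip:
  assumes t: "t \<in> {0..T}" and a: "\<alpha> t \<in> action_vectors A"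
    and m: "m \<in> prob_simplex" and p: "p \<in> prob_simplex"
  shows "norm (mf_drift Q \<alpha> t m - mf_drift Q \<alpha> t p) \<le> L_drift * norm (m - p)"
proof -
  have a': "\<alpha> t $ j \<in> A" for j
    using a by (auto simp: action_vectors_def)
  have "norm (mf_drift Q \<alpha> t m - mf_drift Q \<alpha> t p) \<le> D * (D * (2 * (K + L) * norm (m - p)))"
    unfolding D_def
  proof (rule norm_vec_le_card)
    fix i
    let ?e = "\<lambda>j. (m $ j * Q j i t (\<alpha> t $ j) m - p $ j * Q j i t (\<alpha> t $ j) p)
        - (m $ i * Q i j t (\<alpha> t $ i) m - p $ i * Q i j t (\<alpha> t $ i) p)"
    have eq: "(mf_drift Q \<alpha> t m - mf_drift Q \<alpha> t p) $ i = (\<Sum>j\<in>UNIV. ?e j)"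
    proof -
      have "(\<Sum>j\<in>UNIV. a j - b j) - (\<Sum>j\<in>UNIV. a' j - b' j) = (\<Sum>j\<in>UNIV. (a j - a' j) - (b j - b' j))"
        for a b a' b' :: "'d \<Rightarrow> real"
        by (simp add: sum_subtractf)
      then show ?thesis
        by (simp only: vector_minus_component drift_nth)
    qed
    have "\<bar>(mf_drift Q \<alpha> t m - mf_drift Q \<alpha> t p) $ i\<bar> \<le> (\<Sum>j\<in>UNIV. \<bar>?e j\<bar>)"
      unfolding eq by (rule sum_abs)
    also have "\<dots> \<le> (\<Sum>j\<in>(UNIV::'d set). 2 * (K + L) * norm (m - p))"
    proof (rule sum_mono)
      fix j
      have "\<bar>?e j\<bar> \<le> \<bar>m $ j * Q j i t (\<alpha> t $ j) m - p $ j * Q j i t (\<alpha> t $ j) p\<bar>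
          + \<bar>m $ i * Q i j t (\<alpha> t $ i) m - p $ i * Q i j t (\<alpha> t $ i) p\<bar>"
        by (rule abs_triangle_ineq4)
      also have "\<dots> \<le> (K + L) * norm (m - p) + (K + L) * norm (m - p)"
        by (rule add_mono[OF weighted_rate_lip[OF t a' m p] weighted_rate_lip[OF t a' m p]])
      also have "\<dots> = 2 * (K + L) * norm (m - p)"
        by (simp only: mult_2 distrib_right)
      finally show "\<bar>?e j\<bar> \<le> 2 * (K + L) * norm (m - p)" .
    qed
    finally show "\<bar>(mf_drift Q \<alpha> t m - mf_drift Q \<alpha> t p) $ i\<bar> \<le> real CARD('d) * (2 * (K + L) * norm (m - p))"
      by (simp only: sum_constant)
  qed
  then show ?thesis
    unfolding L_drift_def mult.assoc .
qed

text \<open>Coordinate \<open>i\<close> of an Euler step is \<open>m $ i\<close> times one minus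
  \<open>h\<close> times the total outflow rate, plus a nonnegative inflow. The outflow rate is at
  most \<open>D * K\<close>, which explains the bound on \<open>h\<close>. Mass is conserved because
  exchanging the two sums turns total inflow into total outflow; the diagonal terms occur in both
  and cancel.\<close>

lemma drift_inward:
  assumes t: "t \<in> {0..T}" and a: "\<alpha> t \<in> action_vectors A" and m: "m \<in> prob_simplex"
    and h: "0 < h" "h \<le> 1 / (D * K)"
  shows "m + h *\<^sub>R mf_drift Q \<alpha> t m \<in> prob_simplex"
proof -
  have a': "\<alpha> t $ j \<in> A" for j
    using a by (auto simp: action_vectors_def)
  have m': "0 \<le> m $ i" for i
    using m by (auto simp: prob_simplex_def)
  have "0 \<le> (m + h *\<^sub>R mf_drift Q \<alpha> t m) $ i" for i
  proof -
    have "h * (\<Sum>j\<in>UNIV. Q i j t (\<alpha> t $ i) m) \<le> h * (\<Sum>j\<in>(UNIV::'d set). K)"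
      by (rule mult_left_mono[OF sum_mono[OF Q_le[OF t a' m]] less_imp_le[OF h(1)]])
    also have "\<dots> = h * (D * K)"
      by (simp add: D_def)
    also have "\<dots> \<le> 1"
    proof -
      have "0 < D * K"
        using D_ge_1 K_pos by simp
      with h(2) show ?thesis
        by (simp only: pos_le_divide_eq)
    qed
    finally have 1: "0 \<le> m $ i * (1 - h * (\<Sum>j\<in>UNIV. Q i j t (\<alpha> t $ i) m))"
      by (intro mult_nonneg_nonneg[OF m']) (simp only: diff_ge_0_iff_ge)
    have 2: "0 \<le> h * (\<Sum>j\<in>UNIV. m $ j * Q j i t (\<alpha> t $ j) m)"
      by (rule mult_nonneg_nonneg[OF less_imp_le[OF h(1)] sum_nonneg]) (rule weighted_rate_bound(1)[OF t a' m])
    have expand: "x + h * (c - x * q) = x * (1 - h * q) + h * c" for x c q :: real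
      by algebra
    have "(m + h *\<^sub>R mf_drift Q \<alpha> t m) $ i =
      m $ i * (1 - h * (\<Sum>j\<in>UNIV. Q i j t (\<alpha> t $ i) m)) + h * (\<Sum>j\<in>UNIV. m $ j * Q j i t (\<alpha> t $ j) m)"
      unfolding vector_add_component vector_scaleR_component drift_nth sum_subtractf real_scaleR_def
      by (simp only: expand flip: sum_distrib_left)
    then show ?thesis
      using add_nonneg_nonneg[OF 1 2] by (simp only:)
  qed
  moreover have "(\<Sum>i\<in>UNIV. (m + h *\<^sub>R mf_drift Q \<alpha> t m) $ i) = 1"
  proof -
    have "(\<Sum>i\<in>UNIV. \<Sum>j\<in>UNIV. m $ j * Q j i t (\<alpha> t $ j) m)
        = (\<Sum>i\<in>UNIV. \<Sum>j\<in>UNIV. m $ i * Q i j t (\<alpha> t $ i) m)"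
      by (rule sum.swap)
    then have "(\<Sum>i\<in>UNIV. mf_drift Q \<alpha> t m $ i) = 0"
      by (simp only: drift_nth sum_subtractf diff_self)
    moreover have "(\<Sum>i\<in>UNIV. m $ i) = 1"
      using m by (simp add: prob_simplex_def)
    ultimately show ?thesis
      by (simp only: vector_add_component vector_scaleR_component sum.distrib
          sum_distrib_left[symmetric] real_scaleR_def)
  qed
  ultimately show ?thesis
    unfolding prob_simplex_def by blast
qed

lemma drift_measurable:
  assumes \<alpha>: "\<alpha> \<in> mf_controls T A"
    and m: "m \<in> borel_measurable borel" "\<And>s. m s \<in> prob_simplex"
  shows "(\<lambda>s. mf_drift Q \<alpha> (clamp_time T s) (m s)) \<in> borel_measurable borel"
proof -
  have T: "0 \<le> T" using T_pos by simp
  have "(\<lambda>s. \<alpha> (clamp_time T s)) \<in> borel \<rightarrow>\<^sub>M restrict_space borel (action_vectors A)"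
    using \<alpha> measurable_compose[OF measurable_clamp_time_restrict[OF T]] by (auto simp: mf_controls_def)
  then have \<alpha>': "(\<lambda>s. \<alpha> (clamp_time T s) $ i) \<in> borel \<rightarrow>\<^sub>M restrict_space borel A" for i
    by (rule vec_nth_measurable_restrict)
  have [measurable]: "(\<lambda>s. Q i j (clamp_time T s) (\<alpha> (clamp_time T s) $ k) (m s)) \<in> borel_measurable borel"
    for i j k
    by (rule Q_measurable[OF \<alpha>' measurable_clamp_time]) (use m T in auto)
  have [measurable]: "(\<lambda>s. m s $ i) \<in> borel_measurable borel" for i
    by (rule measurable_compose[OF m(1)]) (intro borel_measurable_continuous_onI continuous_intros)
  show ?thesis
    by (rule borel_measurable_vecI, unfold drift_nth) measurable
qed

lemma control_in:
  assumes "\<alpha> \<in> mf_controls T A" "t \<in> {0..T}"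
  shows "\<alpha> t \<in> action_vectors A"
  using measurable_space[of \<alpha> "restrict_space borel {0..T}" "restrict_space borel (action_vectors A)" t] assms
  by (simp add: mf_controls_def space_restrict_space)

text \<open>\<open>mf_cost\<close> picks its trajectory by choice, so existence is what ties the
  cost to the dynamics. The time is clamped because the viability result asks for its bounds at all
  real times.\<close>

lemma mf_trajectory_exists:
  assumes \<alpha>: "\<alpha> \<in> mf_controls T A" and m0: "m0 \<in> prob_simplex"
  obtains \<mu> where "mf_trajectory T Q m0 \<alpha> \<mu>"
proof -
  have T: "0 \<le> T" using T_pos by simp
  have in_T: "clamp_time T s \<in> {0..T}" for s
    using T by simp
  obtain y where y: "continuous_on UNIV y"
    "\<And>t. t \<in> {0..T} \<Longrightarrow> y t \<in> prob_simplex \<and>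
      y t = m0 + (LBINT s:{0..t}. mf_drift Q \<alpha> (clamp_time T s) (y s))"
  proof (rule caratheodory_viability[of prob_simplex m0 "\<lambda>s m. mf_drift Q \<alpha> (clamp_time T s) m"
        L_drift "D * (D * K)" T "1 / (D * K)"])
    show "(\<lambda>s. mf_drift Q \<alpha> (clamp_time T s) (y s)) \<in> borel_measurable borel"
      if "continuous_on UNIV y" "\<And>s. y s \<in> prob_simplex" for y
      using that by (intro drift_measurable[OF \<alpha>] borel_measurable_continuous_onI) auto
    show "0 < 1 / (D * K)"
      using D_ge_1 K_pos by simp
  qed (use convex_prob_simplex closed_prob_simplex m0 T in_T control_in[OF \<alpha> in_T]
        drift_lip drift_bound drift_inward in auto)
  have "y t = m0 + (LBINT s:{0..t}. mf_drift Q \<alpha> s (y s))" if "t \<in> {0..T}" for t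
  proof -
    have "(LBINT s:{0..t}. mf_drift Q \<alpha> (clamp_time T s) (y s)) = (LBINT s:{0..t}. mf_drift Q \<alpha> s (y s))"
      by (rule set_lebesgue_integral_cong) (use that in auto)
    then show ?thesis
      using y(2)[OF that] by simp
  qed
  then have "mf_trajectory T Q m0 \<alpha> y"
    unfolding mf_trajectory_def using y(2) continuous_on_subset[OF y(1) subset_UNIV] by blast
  then show ?thesis
    using that by blast
qed

end


subsection \<open>Integrals over bounded time intervals\<close>

lemma set_integral_singleton: "(LBINT x:{a}. h x) = (0 :: 'e::{banach, second_countable_topology})"
  for a :: real
proof -
  have "AE x in lborel. indicator {a :: real} x *\<^sub>R h x = 0"
    using AE_lborel_singleton[of a] by (rule eventually_mono) (auto simp: indicator_def)
  then show ?thesis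
    unfolding set_lebesgue_integral_def by (rule integral_eq_zero_AE)
qed

text \<open>Meant for a transition probability times a rate. Nothing is known of \<open>u\<close>
  off the interval, so the indicator is attached to \<open>u\<close> when measurability of the
  product is shown.\<close>

lemma set_integrable_continuous_mult_bounded:
  fixes u v :: "real \<Rightarrow> real"
  assumes u: "continuous_on {a..b} u"
    and v: "v \<in> borel_measurable borel" "\<And>x. \<bar>v x\<bar> \<le> B"
  shows "set_integrable lborel {a..b} (\<lambda>x. u x * v x)"
proof -
  have int_u: "set_integrable lborel {a..b} u"
    by (rule borel_integrable_atLeastAtMost'[OF u])
  show ?thesis
  proof (rule set_integrable_bound)
    show "set_integrable lborel {a..b} (\<lambda>x. u x * B)"
      using int_u by simp
    have "(\<lambda>x. (indicator {a..b} x *\<^sub>R u x) * v x) \<in> borel_measurable lborel"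
      using int_u v(1) unfolding set_integrable_def by (intro borel_measurable_times) auto
    then show "set_borel_measurable lborel {a..b} (\<lambda>x. u x * v x)"
      unfolding set_borel_measurable_def by (simp add: mult.assoc)
    have "norm (u x * v x) \<le> norm (u x * B)" for x
      unfolding norm_mult using v(2)[of x] by (intro mult_left_mono) auto
    then show "AE x in lborel. x \<in> {a..b} \<longrightarrow> norm (u x * v x) \<le> norm (u x * B)"
      by auto
  qed
qed

lemma (in prob_space) integrable_lborel_pair_bounded:
  fixes F :: "real \<Rightarrow> 'a \<Rightarrow> real"
  assumes F: "(\<lambda>(r, w). F r w) \<in> borel_measurable (borel \<Otimes>\<^sub>M M)"
    and B: "\<And>r w. w \<in> space M \<Longrightarrow> \<bar>F r w\<bar> \<le> B"
  shows "integrable (lborel \<Otimes>\<^sub>M M) (\<lambda>(r, w). indicator {a..b} r *\<^sub>R F r w)"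
proof (rule integrableI_bounded_set[of "{a..b} \<times> space M" _ _ B])
  have [measurable]: "(\<lambda>x. F (fst x) (snd x)) \<in> borel_measurable (lborel \<Otimes>\<^sub>M M)"
    using F by (simp add: case_prod_beta' cong: measurable_cong_sets)
  show "(\<lambda>(r, w). indicator {a..b} r *\<^sub>R F r w) \<in> borel_measurable (lborel \<Otimes>\<^sub>M M)"
    unfolding case_prod_beta' by measurable
  show "emeasure (lborel \<Otimes>\<^sub>M M) ({a..b} \<times> space M) < \<infinity>"
    by (subst emeasure_pair_measure_Times)
      (auto simp: emeasure_space_1 emeasure_lborel_Icc_eq)
qed (use B in \<open>auto simp: space_pair_measure indicator_def intro!: AE_I2 split: if_splits\<close>)

text \<open>Both measures are finite on the region of integration, so joint measurability and a
  bound give all that an exchange of expectation and time integral asks for.\<close>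

lemma (in prob_space) fubini_bounded:
  fixes F :: "real \<Rightarrow> 'a \<Rightarrow> real"
  assumes F: "(\<lambda>(r, w). F r w) \<in> borel_measurable (borel \<Otimes>\<^sub>M M)"
    and B: "\<And>r w. w \<in> space M \<Longrightarrow> \<bar>F r w\<bar> \<le> B"
  shows "(\<lambda>r. expectation (F r)) \<in> borel_measurable borel" "\<bar>expectation (F r)\<bar> \<le> B"
    and "integrable M (F r)"
    and "integrable M (\<lambda>w. LBINT r:{a..b}. F r w)"
    and "expectation (\<lambda>w. LBINT r:{a..b}. F r w) = (LBINT r:{a..b}. expectation (F r))"
proof -
  show "(\<lambda>r. expectation (F r)) \<in> borel_measurable borel"
    by (rule borel_measurable_lebesgue_integral[OF F])
  interpret pair_sigma_finite lborel M ..

  have Fr: "F r \<in> borel_measurable M"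
    using measurable_compose[OF measurable_Pair1'[of r borel M] F] by simp
  show int: "integrable M (F r)"
    by (rule integrable_const_bound[of _ B]) (use B Fr in auto)
  show "\<bar>expectation (F r)\<bar> \<le> B"
  proof -
    have "\<bar>expectation (F r)\<bar> \<le> expectation (\<lambda>w. \<bar>F r w\<bar>)"
      by (rule integral_abs_bound)
    also have "\<dots> \<le> expectation (\<lambda>_. B)"
      by (rule integral_mono) (use int B in auto)
    finally show ?thesis
      by (simp add: prob_space)
  qed
  note I = integrable_lborel_pair_bounded[OF F B, of a b]
  show "integrable M (\<lambda>w. LBINT r:{a..b}. F r w)"
    using integrable_snd[OF I] unfolding set_lebesgue_integral_def by simp
  show "expectation (\<lambda>w. LBINT r:{a..b}. F r w) = (LBINT r:{a..b}. expectation (F r))"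
    using Fubini_integral[OF I] unfolding set_lebesgue_integral_def by simp
qed

text \<open>The square is a double integral over [0,t]^2, whose two triangles contribute equally by
  Fubini. It acts as a chain rule along a path without any differentiation.\<close>

lemma square_set_integral:
  fixes u :: "real \<Rightarrow> real"
  assumes u [measurable]: "u \<in> borel_measurable borel" and B: "\<And>x. \<bar>u x\<bar> \<le> B"
    and t: "0 \<le> t"
  shows "(LBINT s:{0..t}. u s)\<^sup>2 = 2 * (LBINT s:{0..t}. u s * (LBINT r:{s..t}. u r))"
proof -
  have B0: "0 \<le> B"
    using B[of 0] by linarith
  define V where "V s = (LBINT r:{s..t}. u r)" for s
  define U where "U s = (LBINT r:{0..s}. u r)" for s
  have int_u: "set_integrable lborel {a..b} u" for a b
    by (rule set_integrable_bounded[OF u]) (use B in auto)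
  \<comment> \<open>The double integrand cut off to the triangle where \<open>s\<close> is at most
    \<open>r\<close>. Integrating out \<open>r\<close> leaves \<open>u s * V s\<close>, integrating
    out \<open>s\<close> leaves \<open>u r * U r\<close>.\<close>
  let ?w = "\<lambda>s r. if 0 \<le> s \<and> s \<le> r \<and> r \<le> t then u s * u r else 0"
  have I: "integrable (lborel \<Otimes>\<^sub>M lborel) (\<lambda>(s, r). ?w s r)"
  proof (rule integrableI_bounded_set[of "{0..t} \<times> {0..t}" _ _ "B * B"])
    show "(\<lambda>(s, r). ?w s r) \<in> borel_measurable (lborel \<Otimes>\<^sub>M lborel)"
      by measurable
    show "emeasure (lborel \<Otimes>\<^sub>M lborel) ({0..t} \<times> {0..t}) < \<infinity>"
      by (subst lborel.emeasure_pair_measure_Times) (auto simp: emeasure_lborel_Icc_eq ennreal_mult_less_top)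
    have "\<bar>u s * u r\<bar> \<le> B * B" for s r
      unfolding abs_mult by (rule mult_mono[OF B B B0]) auto
    then show "AE x in lborel \<Otimes>\<^sub>M lborel. x \<in> {0..t} \<times> {0..t} \<longrightarrow> norm (case x of (s, r) \<Rightarrow> ?w s r) \<le> B * B"
      using B0 by (intro AE_I2) auto
  qed (auto intro!: AE_I2 split: if_splits)
  have inner: "indicator {0..t} s *\<^sub>R (u s * V s) = (\<integral>r. ?w s r \<partial>lborel)" for s
  proof (cases "s \<in> {0..t}")
    case True
    then have "?w s = (\<lambda>r. u s * (indicator {s..t} r *\<^sub>R u r))"
      by (auto simp: indicator_def fun_eq_iff)
    then show ?thesis
      using True by (simp add: V_def set_lebesgue_integral_def)
  next
    case False
    then have "?w s = (\<lambda>r. 0)"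
      by (auto simp: fun_eq_iff)
    then show ?thesis
      using False by simp
  qed
  have uV: "(LBINT s:{0..t}. u s * V s) = (\<integral>s. (\<integral>r. ?w s r \<partial>lborel) \<partial>lborel)"
    unfolding set_lebesgue_integral_def inner ..
  have uU: "(LBINT r:{0..t}. u r * U r) = (\<integral>r. (\<integral>s. ?w s r \<partial>lborel) \<partial>lborel)"
    unfolding set_lebesgue_integral_def U_def
    by (auto intro!: Bochner_Integration.integral_cong simp: indicator_def mult.commute simp flip: integral_mult_right_zero)
  have swap: "(LBINT r:{0..t}. u r * U r) = (LBINT s:{0..t}. u s * V s)"
    unfolding uV uU using lborel_pair.Fubini_integral[OF I] by simp
  have UV: "(LBINT s:{0..t}. u s) = U s + V s" if "s \<in> {0..t}" for s
    unfolding U_def V_def by (rule set_integral_combine) (use that int_u in auto)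
  have V_meas: "set_integrable lborel {0..t} (\<lambda>s. u s * V s)"
    using lborel_pair.integrable_fst[OF I] unfolding set_integrable_def inner .
  have "(LBINT s:{0..t}. u s)\<^sup>2 = (LBINT s:{0..t}. u s * (LBINT s:{0..t}. u s))"
    by (simp add: power2_eq_square)
  also have "\<dots> = (LBINT s:{0..t}. u s * U s + u s * V s)"
    by (rule set_lebesgue_integral_cong) (auto simp: UV distrib_left)
  also have "\<dots> = (LBINT s:{0..t}. u s * U s) + (LBINT s:{0..t}. u s * V s)"
  proof (rule set_integral_add(2)[OF _ V_meas])
    have "set_integrable lborel {0..t} (\<lambda>s. u s * (LBINT s:{0..t}. u s) - u s * V s)"
      using V_meas int_u by (intro set_integral_diff(1)) auto
    then show "set_integrable lborel {0..t} (\<lambda>s. u s * U s)"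
      unfolding set_integrable_def
      by (rule iffD1[OF Bochner_Integration.integrable_cong[OF refl], rotated])
        (auto simp: indicator_def UV algebra_simps)
  qed
  finally show ?thesis
    unfolding swap V_def by simp
qed


subsection \<open>Finite jump processes\<close>

definition generator :: "'s set \<Rightarrow> (real \<Rightarrow> 's \<Rightarrow> 's \<Rightarrow> real) \<Rightarrow> ('s \<Rightarrow> real) \<Rightarrow> real \<Rightarrow> 's \<Rightarrow> real" where
  "generator S q \<psi> r x = (\<Sum>y\<in>S - {x}. q r x y * (\<psi> y - \<psi> x))"

text \<open>The forward operator acting on laws is the adjoint of the generator acting on functions.
  Sums without the diagonal are written as full sums with zero diagonal terms, so that the order of
  summation can be exchanged.\<close>

lemma sum_forward_generator:
  assumes "finite S"
  shows "(\<Sum>y\<in>S. \<psi> y * ((\<Sum>z\<in>S - {y}. P z * q r z y) - P y * (\<Sum>z\<in>S - {y}. q r y z)))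
    = (\<Sum>z\<in>S. P z * generator S q \<psi> r z)"
proof -
  have *: "(\<Sum>z\<in>S - {y}. F z) = (\<Sum>z\<in>S. if z = y then 0 else F z)" for y and F :: "'a \<Rightarrow> real"
    using assms by (intro sum.mono_neutral_cong_left) auto
  have "(\<Sum>y\<in>S. \<psi> y * ((\<Sum>z\<in>S - {y}. P z * q r z y) - P y * (\<Sum>z\<in>S - {y}. q r y z)))
    = (\<Sum>y\<in>S. \<Sum>z\<in>S. if z = y then 0 else \<psi> y * P z * q r z y)
      - (\<Sum>y\<in>S. \<Sum>z\<in>S. if z = y then 0 else \<psi> y * P y * q r y z)"
    unfolding * right_diff_distrib sum_subtractf sum_distrib_left
    by (intro arg_cong2[where f = "(-)"] sum.cong refl) auto
  also have "(\<Sum>y\<in>S. \<Sum>z\<in>S. if z = y then 0 else \<psi> y * P z * q r z y)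
    = (\<Sum>y\<in>S. \<Sum>z\<in>S. if z = y then 0 else \<psi> z * P y * q r y z)"
    by (subst sum.swap) (intro sum.cong refl, auto)
  also have "(\<Sum>y\<in>S. \<Sum>z\<in>S. if z = y then 0 else \<psi> z * P y * q r y z)
      - (\<Sum>y\<in>S. \<Sum>z\<in>S. if z = y then 0 else \<psi> y * P y * q r y z)
    = (\<Sum>z\<in>S. P z * generator S q \<psi> r z)"
    unfolding generator_def * sum_subtractf[symmetric] sum_distrib_left
    by (intro sum.cong refl) (auto simp: algebra_simps)
  finally show ?thesis .
qed

text \<open>What the second moment computation uses of a Markov jump process: the laws at pairs of
  times, expressed by \<open>p\<close>, and joint measurability in time and path. The latter is how
  the regularity of paths enters.\<close>

locale jump_chain = prob_space P for P :: "'w measure" +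
  fixes T :: real and S :: "'s set" and q :: "real \<Rightarrow> 's \<Rightarrow> 's \<Rightarrow> real" and X :: "real \<Rightarrow> 'w \<Rightarrow> 's"
    and p :: "real \<Rightarrow> real \<Rightarrow> 's \<Rightarrow> 's \<Rightarrow> real" and \<kappa> :: real
  assumes T_nonneg: "0 \<le> T" and finite_S: "finite S"
    and q_measurable: "\<And>x y. x \<in> S \<Longrightarrow> y \<in> S \<Longrightarrow> (\<lambda>r. q (clamp_time T r) x y) \<in> borel_measurable borel"
    and q_bound: "\<And>r x y. r \<in> {0..T} \<Longrightarrow> x \<in> S \<Longrightarrow> y \<in> S \<Longrightarrow> \<bar>q r x y\<bar> \<le> \<kappa>"
    and X_measurable: "\<And>t. t \<in> {0..T} \<Longrightarrow> X t \<in> P \<rightarrow>\<^sub>M count_space S"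
    and X_joint: "(\<lambda>(r, w). X (clamp_time T r) w) \<in> borel \<Otimes>\<^sub>M P \<rightarrow>\<^sub>M count_space S"
    and trans: "transition_probs T S q p"
    and markov: "\<And>s t x y. s \<in> {0..T} \<Longrightarrow> t \<in> {s..T} \<Longrightarrow> x \<in> S \<Longrightarrow> y \<in> S \<Longrightarrow>
      measure P {w \<in> space P. X s w = x \<and> X t w = y}
      = measure P {w \<in> space P. X s w = x} * p s t x y"
begin

lemma X_in: "t \<in> {0..T} \<Longrightarrow> w \<in> space P \<Longrightarrow> X t w \<in> S"
  using measurable_space[OF X_measurable] by fastforce

text \<open>On a finite state space a function of two states is a finite combination of indicators
  of events to which \<open>markov\<close> applies.\<close>

lemma expectation_two_times:
  assumes s: "s \<in> {0..T}" and t: "t \<in> {s..T}"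
  shows "expectation (\<lambda>w. k (X s w) (X t w))
    = (\<Sum>x\<in>S. measure P {w \<in> space P. X s w = x} * (\<Sum>y\<in>S. p s t x y * k x y))"
    and "integrable P (\<lambda>w. k (X s w) (X t w))"
proof -
  have t0: "t \<in> {0..T}"
    using s t by auto
  let ?E = "\<lambda>x y. {w \<in> space P. X s w = x \<and> X t w = y}"
  let ?f = "\<lambda>w. \<Sum>x\<in>S. \<Sum>y\<in>S. k x y * indicator (?E x y) w"
  have sets: "?E x y \<in> sets P" if "x \<in> S" "y \<in> S" for x y
  proof -
    have "?E x y = (X s -` {x} \<inter> space P) \<inter> (X t -` {y} \<inter> space P)"
      by auto
    also have "\<dots> \<in> sets P"
      using that by (intro sets.Int measurable_sets[OF X_measurable[OF s]] measurable_sets[OF X_measurable[OF t0]]) auto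
    finally show ?thesis .
  qed
  have eq: "k (X s w) (X t w) = ?f w" if w: "w \<in> space P" for w
  proof -
    have "?f w = (\<Sum>x\<in>S. if x = X s w then (\<Sum>y\<in>S. if y = X t w then k x y else 0) else 0)"
      using w by (intro sum.cong refl) (auto simp: indicator_def intro!: sum.cong)
    then show ?thesis
      using X_in[OF s w] X_in[OF t0 w] finite_S by simp
  qed
  have int: "integrable P (indicator (?E x y) :: 'w \<Rightarrow> real)" if "x \<in> S" "y \<in> S" for x y
    using sets[OF that] by (intro integrable_real_indicator) (auto simp: emeasure_eq_measure)
  have "integrable P ?f"
    using int by (intro Bochner_Integration.integrable_sum integrable_mult_right)
  then show "integrable P (\<lambda>w. k (X s w) (X t w))"
    by (rule iffD1[OF Bochner_Integration.integrable_cong[OF refl], rotated]) (simp add: eq)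
  have "expectation (\<lambda>w. k (X s w) (X t w)) = expectation ?f"
    by (rule Bochner_Integration.integral_cong[OF refl]) (rule eq)
  also have "\<dots> = (\<Sum>x\<in>S. \<Sum>y\<in>S. k x y * measure P (?E x y))"
  proof -
    have int': "integrable P (\<lambda>w. k x y * indicator (?E x y) w)" if "x \<in> S" "y \<in> S" for x y
      by (rule integrable_mult_right[OF int[OF that]])
    have inner: "expectation (\<lambda>w. \<Sum>y\<in>S. k x y * indicator (?E x y) w) = (\<Sum>y\<in>S. k x y * measure P (?E x y))"
      if x: "x \<in> S" for x
    proof -
      have "expectation (\<lambda>w. \<Sum>y\<in>S. k x y * indicator (?E x y) w)
          = (\<Sum>y\<in>S. expectation (\<lambda>w. k x y * indicator (?E x y) w))"
        by (rule Bochner_Integration.integral_sum) (rule int'[OF x])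
      also have "\<dots> = (\<Sum>y\<in>S. k x y * measure P (?E x y))"
      proof (rule sum.cong[OF refl])
        fix y assume "y \<in> S"
        then have "?E x y \<in> sets P"
          by (rule sets[OF x])
        then show "expectation (\<lambda>w. k x y * indicator (?E x y) w) = k x y * measure P (?E x y)"
          by (simp only: integral_mult_right_zero integral_indicator) (simp add: Int_absorb1 sets.sets_into_space)
      qed
      finally show ?thesis .
    qed
    have "expectation ?f = (\<Sum>x\<in>S. expectation (\<lambda>w. \<Sum>y\<in>S. k x y * indicator (?E x y) w))"
      by (rule Bochner_Integration.integral_sum) (intro Bochner_Integration.integrable_sum int')
    then show ?thesis
      by (simp only: inner cong: sum.cong)
  qed
  also have "\<dots> = (\<Sum>x\<in>S. measure P {w \<in> space P. X s w = x} * (\<Sum>y\<in>S. p s t x y * k x y))"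
    unfolding sum_distrib_left by (intro sum.cong refl) (simp add: markov[OF s t])
  finally show "expectation (\<lambda>w. k (X s w) (X t w))
    = (\<Sum>x\<in>S. measure P {w \<in> space P. X s w = x} * (\<Sum>y\<in>S. p s t x y * k x y))" .
qed

lemma generator_measurable:
  "x \<in> S \<Longrightarrow> (\<lambda>r. generator S q \<psi> (clamp_time T r) x) \<in> borel_measurable borel"
  unfolding generator_def using q_measurable
  by (intro borel_measurable_sum borel_measurable_times) auto

lemma bounded_on_S:
  obtains B where "\<And>x. x \<in> S \<Longrightarrow> \<bar>\<psi> x :: real\<bar> \<le> B" "0 \<le> B"
proof
  show "\<bar>\<psi> x\<bar> \<le> (\<Sum>x\<in>S. \<bar>\<psi> x\<bar>)" if "x \<in> S" for x
    using that finite_S by (intro member_le_sum) auto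
qed (auto intro: sum_nonneg)

lemma generator_bounded:
  obtains B where "\<And>r x. r \<in> {0..T} \<Longrightarrow> x \<in> S \<Longrightarrow> \<bar>generator S q \<psi> r x\<bar> \<le> B" "0 \<le> B"
proof -
  obtain b where b: "\<And>x. x \<in> S \<Longrightarrow> \<bar>\<psi> x\<bar> \<le> b" "0 \<le> b"
    using bounded_on_S by blast
  have "\<bar>generator S q \<psi> r x\<bar> \<le> (\<Sum>y\<in>S. \<bar>\<kappa>\<bar> * (2 * b))" if r: "r \<in> {0..T}" and x: "x \<in> S" for r x
  proof -
    have "\<bar>generator S q \<psi> r x\<bar> \<le> (\<Sum>y\<in>S - {x}. \<bar>q r x y * (\<psi> y - \<psi> x)\<bar>)"
      unfolding generator_def by (rule sum_abs)
    also have "\<dots> \<le> (\<Sum>y\<in>S - {x}. \<bar>\<kappa>\<bar> * (2 * b))"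
    proof (rule sum_mono)
      fix y assume y: "y \<in> S - {x}"
      have "\<bar>\<psi> y - \<psi> x\<bar> \<le> 2 * b"
        using b(1)[OF x] b(1)[of y] y by auto
      moreover have "\<bar>q r x y\<bar> \<le> \<bar>\<kappa>\<bar>"
        using q_bound[OF r x, of y] y by auto
      ultimately show "\<bar>q r x y * (\<psi> y - \<psi> x)\<bar> \<le> \<bar>\<kappa>\<bar> * (2 * b)"
        unfolding abs_mult by (intro mult_mono) auto
    qed
    also have "\<dots> \<le> (\<Sum>y\<in>S. \<bar>\<kappa>\<bar> * (2 * b))"
      using b(2) finite_S by (intro sum_mono2) auto
    finally show ?thesis .
  qed
  moreover have "0 \<le> (\<Sum>y\<in>S. \<bar>\<kappa>\<bar> * (2 * b))"
    using b(2) by (intro sum_nonneg) auto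
  ultimately show ?thesis
    using that by blast
qed

lemma p_integrable:
  assumes s: "s \<in> {0..T}" and t: "t \<in> {s..T}" and "x \<in> S" "z \<in> S"
    and v: "(\<lambda>r. v (clamp_time T r)) \<in> borel_measurable borel" "\<And>r. r \<in> {0..T} \<Longrightarrow> \<bar>v r\<bar> \<le> B"
  shows "set_integrable lborel {s..t} (\<lambda>r. p s r x z * v r)"
proof -
  have "continuous_on {s..t} (\<lambda>r. p s r x z)"
    using trans assms t unfolding transition_probs_def
    by (auto intro: continuous_on_subset[of "{s..T}"])
  then have "set_integrable lborel {s..t} (\<lambda>r. p s r x z * v (clamp_time T r))"
    by (rule set_integrable_continuous_mult_bounded[OF _ v(1), where B = B]) (use v(2) T_nonneg in auto)
  then show ?thesis
    unfolding set_integrable_def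
    by (rule iffD1[OF Bochner_Integration.integrable_cong[OF refl], rotated])
      (use s t in \<open>auto simp: indicator_def\<close>)
qed

lemma forward_generator:
  assumes s: "s \<in> {0..T}" and t: "t \<in> {s..T}" and x: "x \<in> S"
  shows "(\<Sum>y\<in>S. p s t x y * \<psi> y)
    = \<psi> x + (LBINT r:{s..t}. \<Sum>z\<in>S. p s r x z * generator S q \<psi> r z)"
proof -
  let ?k = "\<lambda>r y. (\<Sum>z\<in>S - {y}. p s r x z * q r z y) - p s r x y * (\<Sum>z\<in>S - {y}. q r y z)"
  have p: "p s t x y = (if x = y then 1 else 0) + (LBINT r:{s..t}. ?k r y)" if "y \<in> S" for y
    using trans s t x that unfolding transition_probs_def by auto
  have int: "set_integrable lborel {s..t} (\<lambda>r. ?k r y)" if y: "y \<in> S" for y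
  proof (intro set_integral_diff(1))
    have "set_integrable lborel {s..t} (\<lambda>r. p s r x z * q r z y)" if "z \<in> S - {y}" for z
      by (rule p_integrable[OF s t x, where B = \<kappa>]) (use that y q_measurable q_bound in auto)
    then show "set_integrable lborel {s..t} (\<lambda>r. \<Sum>z\<in>S - {y}. p s r x z * q r z y)"
      unfolding set_integrable_def scaleR_sum_right by (rule Bochner_Integration.integrable_sum)
    have "set_integrable lborel {s..t} (\<lambda>r. p s r x y * q r y z)" if "z \<in> S - {y}" for z
      by (rule p_integrable[OF s t x, where B = \<kappa>]) (use that y q_measurable q_bound in auto)
    then show "set_integrable lborel {s..t} (\<lambda>r. p s r x y * (\<Sum>z\<in>S - {y}. q r y z))"
      unfolding set_integrable_def scaleR_sum_right sum_distrib_left by (rule Bochner_Integration.integrable_sum)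
  qed
  have "(\<Sum>y\<in>S. p s t x y * \<psi> y)
      = (\<Sum>y\<in>S. (if x = y then \<psi> y else 0)) + (\<Sum>y\<in>S. \<psi> y * (LBINT r:{s..t}. ?k r y))"
    unfolding sum.distrib[symmetric] by (intro sum.cong refl) (auto simp: p distrib_right)
  also have "(\<Sum>y\<in>S. (if x = y then \<psi> y else 0)) = \<psi> x"
    using x finite_S by simp
  also have "(\<Sum>y\<in>S. \<psi> y * (LBINT r:{s..t}. ?k r y)) = (LBINT r:{s..t}. \<Sum>y\<in>S. \<psi> y * ?k r y)"
  proof -
    have "(LBINT r:{s..t}. \<Sum>y\<in>S. \<psi> y * ?k r y) = (\<Sum>y\<in>S. LBINT r:{s..t}. \<psi> y * ?k r y)"
      unfolding set_lebesgue_integral_def scaleR_sum_right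
      by (rule Bochner_Integration.integral_sum)
        (use set_integrable_mult_right[OF int] in \<open>auto simp: set_integrable_def\<close>)
    then show ?thesis
      by simp
  qed
  also have "\<dots> = (LBINT r:{s..t}. \<Sum>z\<in>S. p s r x z * generator S q \<psi> r z)"
    unfolding sum_forward_generator[OF finite_S] ..
  finally show ?thesis .
qed

text \<open>The test function may depend on the earlier state, which stays frozen while the
  generator acts on the later one. It is thus a conditional Dynkin formula, and later yields the
  orthogonality of martingale increments to functions of the present state.\<close>

lemma dynkin:
  assumes s: "s \<in> {0..T}" and t: "t \<in> {s..T}"
  shows "expectation (\<lambda>w. h (X s w) (X t w)) = expectation (\<lambda>w. h (X s w) (X s w))
    + (LBINT r:{s..t}. expectation (\<lambda>w. generator S q (h (X s w)) r (X r w)))"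
proof -
  let ?\<pi> = "\<lambda>x. measure P {w \<in> space P. X s w = x}"
  have ss: "s \<in> {s..T}"
    using s by auto
  have int: "set_integrable lborel {s..t} (\<lambda>r. \<Sum>z\<in>S. p s r x z * generator S q (h x) r z)"
    if x: "x \<in> S" for x
  proof -
    obtain B where B: "\<And>r z. r \<in> {0..T} \<Longrightarrow> z \<in> S \<Longrightarrow> \<bar>generator S q (h x) r z\<bar> \<le> B"
      using generator_bounded[of "h x"] by blast
    have "set_integrable lborel {s..t} (\<lambda>r. p s r x z * generator S q (h x) r z)" if "z \<in> S" for z
      by (rule p_integrable[OF s t x that, where v = "\<lambda>r. generator S q (h x) r z" and B = B])
        (rule generator_measurable[OF that], rule B[OF _ that])
    then show ?thesis
      unfolding set_integrable_def scaleR_sum_right by (rule Bochner_Integration.integrable_sum)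
  qed
  have "expectation (\<lambda>w. h (X s w) (X t w))
      = (\<Sum>x\<in>S. ?\<pi> x * (h x x + (LBINT r:{s..t}. \<Sum>z\<in>S. p s r x z * generator S q (h x) r z)))"
    unfolding expectation_two_times(1)[OF s t] by (intro sum.cong refl) (simp add: forward_generator[OF s t])
  also have "\<dots> = (\<Sum>x\<in>S. ?\<pi> x * h x x)
      + (\<Sum>x\<in>S. ?\<pi> x * (LBINT r:{s..t}. \<Sum>z\<in>S. p s r x z * generator S q (h x) r z))"
    by (simp add: distrib_left sum.distrib)
  also have "(\<Sum>x\<in>S. ?\<pi> x * h x x) = expectation (\<lambda>w. h (X s w) (X s w))"
    unfolding expectation_two_times(1)[OF s ss]
    \<comment> \<open>Taken at equal times, with a vanishing time integral, the forward equation
      says that \<open>p s s\<close> is the identity.\<close>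
    by (intro sum.cong refl) (simp add: forward_generator[OF s ss] set_integral_singleton)
  also have "(\<Sum>x\<in>S. ?\<pi> x * (LBINT r:{s..t}. \<Sum>z\<in>S. p s r x z * generator S q (h x) r z))
      = (LBINT r:{s..t}. \<Sum>x\<in>S. ?\<pi> x * (\<Sum>z\<in>S. p s r x z * generator S q (h x) r z))"
  proof -
    have "(LBINT r:{s..t}. \<Sum>x\<in>S. ?\<pi> x * (\<Sum>z\<in>S. p s r x z * generator S q (h x) r z))
        = (\<Sum>x\<in>S. LBINT r:{s..t}. ?\<pi> x * (\<Sum>z\<in>S. p s r x z * generator S q (h x) r z))"
      unfolding set_lebesgue_integral_def scaleR_sum_right[of _ _ S]
      by (rule Bochner_Integration.integral_sum)
        (use set_integrable_mult_right[OF int] in \<open>auto simp: set_integrable_def\<close>)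
    then show ?thesis
      by simp
  qed
  also have "\<dots> = (LBINT r:{s..t}. expectation (\<lambda>w. generator S q (h (X s w)) r (X r w)))"
  proof (rule set_lebesgue_integral_cong)
    show "\<forall>r. r \<in> {s..t} \<longrightarrow> (\<Sum>x\<in>S. ?\<pi> x * (\<Sum>z\<in>S. p s r x z * generator S q (h x) r z))
        = expectation (\<lambda>w. generator S q (h (X s w)) r (X r w))"
      using t by (auto intro!: expectation_two_times(1)[OF s, symmetric])
  qed simp
  finally show ?thesis .
qed

end

lemma generator_cmult: "generator S q (\<lambda>y. c * \<psi> y) r x = c * generator S q \<psi> r x"
  unfolding generator_def sum_distrib_left by (intro sum.cong refl) (simp add: algebra_simps)

text \<open>From (b - c)^2 - (a - c)^2 = (b - a)^2 + 2 (a - c)(b - a). The first part is the squared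
  jump intensity; the second is the cross term that cancels in the second moment of the
  martingale.\<close>

lemma generator_square_shift:
  "generator S q (\<lambda>y. (\<phi> y - c)\<^sup>2) r z
    = (\<Sum>y\<in>S - {z}. q r z y * (\<phi> y - \<phi> z)\<^sup>2) + 2 * ((\<phi> z - c) * generator S q \<phi> r z)"
  unfolding generator_def sum_distrib_left sum.distrib[symmetric]
  by (intro sum.cong refl) (simp add: algebra_simps power2_eq_square)

section \<open>Compensated functions of the chain and their second moment\<close>

context jump_chain
begin

definition genX :: "('s \<Rightarrow> real) \<Rightarrow> real \<Rightarrow> 'w \<Rightarrow> real" where
  "genX \<phi> r w = generator S q \<phi> (clamp_time T r) (X (clamp_time T r) w)"

lemma clamp_in: "clamp_time T r \<in> {0..T}"
  using T_nonneg by simp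

lemma joint_measurable:
  assumes "\<And>x. x \<in> S \<Longrightarrow> (\<lambda>r. k r x) \<in> borel_measurable borel"
  shows "(\<lambda>(r, w). k r (X (clamp_time T r) w) :: real) \<in> borel_measurable (borel \<Otimes>\<^sub>M P)"
proof -
  have "(\<lambda>z. (\<lambda>x z. k (fst z) x) ((\<lambda>(r, w). X (clamp_time T r) w) z) z) \<in> borel_measurable (borel \<Otimes>\<^sub>M P)"
  proof (rule measurable_compose_countable'[where I = S and g = "\<lambda>(r, w). X (clamp_time T r) w"
        and f = "\<lambda>x z. k (fst z) x"])
    show "(\<lambda>z. k (fst z) x) \<in> borel_measurable (borel \<Otimes>\<^sub>M P)" if "x \<in> S" for x
      by (rule measurable_compose[OF measurable_fst assms[OF that]])
  qed (rule X_joint, rule countable_finite[OF finite_S])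
  then show ?thesis
    by (simp add: case_prod_beta')
qed

lemma joint_measurable2:
  assumes "\<And>x0 x. x0 \<in> S \<Longrightarrow> x \<in> S \<Longrightarrow> (\<lambda>r. k r x0 x) \<in> borel_measurable borel"
    and s: "s \<in> {0..T}"
  shows "(\<lambda>(r, w). k r (X s w) (X (clamp_time T r) w) :: real) \<in> borel_measurable (borel \<Otimes>\<^sub>M P)"
proof -
  have "(\<lambda>z. (\<lambda>x0 z. k (fst z) x0 (X (clamp_time T (fst z)) (snd z))) ((\<lambda>z. X s (snd z)) z) z)
      \<in> borel_measurable (borel \<Otimes>\<^sub>M P)"
  proof (rule measurable_compose_countable'[where I = S and g = "\<lambda>z. X s (snd z)"
        and f = "\<lambda>x0 z. k (fst z) x0 (X (clamp_time T (fst z)) (snd z))"])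
    show "(\<lambda>z. k (fst z) x0 (X (clamp_time T (fst z)) (snd z))) \<in> borel_measurable (borel \<Otimes>\<^sub>M P)"
      if "x0 \<in> S" for x0
      using joint_measurable[of "\<lambda>r. k r x0"] assms(1)[OF that] by (simp add: case_prod_beta')
    show "(\<lambda>z. X s (snd z)) \<in> borel \<Otimes>\<^sub>M P \<rightarrow>\<^sub>M count_space S"
      by (rule measurable_compose[OF measurable_snd X_measurable[OF s]])
  qed (rule countable_finite[OF finite_S])
  then show ?thesis
    by (simp add: case_prod_beta')
qed

lemma state_measurable: "t \<in> {0..T} \<Longrightarrow> (\<lambda>w. \<phi> (X t w) :: real) \<in> borel_measurable P"
  by (rule measurable_compose[OF X_measurable]) auto

lemma state_measurable_snd: "t \<in> {0..T} \<Longrightarrow> (\<lambda>z. \<phi> (X t (snd z)) :: real) \<in> borel_measurable (borel \<Otimes>\<^sub>M P)"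
  by (rule measurable_compose[OF measurable_snd state_measurable])

lemma genX_joint: "(\<lambda>(r, w). genX \<phi> r w) \<in> borel_measurable (borel \<Otimes>\<^sub>M P)"
  unfolding genX_def by (rule joint_measurable[OF generator_measurable])

lemma genX_joint' [measurable]: "(\<lambda>z. genX \<phi> (fst z) (snd z)) \<in> borel_measurable (borel \<Otimes>\<^sub>M P)"
  using genX_joint[of \<phi>] by (simp add: case_prod_beta')

lemma path_measurable:
  assumes "(\<lambda>(r, w). F r w) \<in> borel_measurable (borel \<Otimes>\<^sub>M P)" "w \<in> space P"
  shows "(\<lambda>r. F r w :: real) \<in> borel_measurable borel"
  using measurable_compose[OF measurable_Pair2'[OF assms(2), of borel] assms(1)] by simp

text \<open>Moving the variable limits into the integrand makes this an ordinary parameter integral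
  of a jointly measurable function.\<close>

lemma integral_genX_joint:
  assumes [measurable]: "a \<in> borel_measurable borel" "b \<in> borel_measurable borel"
  shows "(\<lambda>(s, w). LBINT r:{a s..b s}. genX \<phi> r w) \<in> borel_measurable (borel \<Otimes>\<^sub>M P)"
proof -
  have "(\<lambda>z. \<integral>r. (if a (fst z) \<le> r \<and> r \<le> b (fst z) then genX \<phi> r (snd z) else 0) \<partial>lborel)
      \<in> borel_measurable (borel \<Otimes>\<^sub>M P)"
  proof (rule lborel.borel_measurable_lebesgue_integral)
    have [measurable]: "(\<lambda>x. genX \<phi> (snd x) (snd (fst x))) \<in> borel_measurable ((borel \<Otimes>\<^sub>M P) \<Otimes>\<^sub>M lborel)"
    proof -
      have "(\<lambda>x. (snd x, snd (fst x))) \<in> (borel \<Otimes>\<^sub>M P) \<Otimes>\<^sub>M lborel \<rightarrow>\<^sub>M borel \<Otimes>\<^sub>M P"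
        by measurable
      from measurable_compose[OF this genX_joint'] show ?thesis
        by simp
    qed
    show "(\<lambda>(z, r). if a (fst z) \<le> r \<and> r \<le> b (fst z) then genX \<phi> r (snd z) else 0)
        \<in> borel_measurable ((borel \<Otimes>\<^sub>M P) \<Otimes>\<^sub>M lborel)"
      unfolding case_prod_beta' by measurable
  qed
  also have "(\<lambda>z. \<integral>r. (if a (fst z) \<le> r \<and> r \<le> b (fst z) then genX \<phi> r (snd z) else 0) \<partial>lborel)
      = (\<lambda>(s, w). LBINT r:{a s..b s}. genX \<phi> r w)"
    unfolding set_lebesgue_integral_def case_prod_beta'
    by (intro ext Bochner_Integration.integral_cong refl) (simp add: indicator_def)
  finally show ?thesis .
qed

text \<open>
  With \<open>Z = \<phi> X\<^sub>t - \<phi> X\<^sub>0\<close> and \<open>l\<^sub>s\<close> the generator along the path, the pathwise identity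
  \<open>(\<integral> l)\<^sup>2 = 2 \<integral> l\<^sub>s (\<integral>\<^sub>s l) ds\<close> gives \<open>M\<^sup>2 = Z\<^sup>2 - 2 \<integral> l\<^sub>s (Z - \<integral>\<^sub>s l) ds\<close>. Its expectation involves
  the law of \<open>X\<close> at two times only, and is given by Dynkin's formula.
\<close>

lemma martingale_second_moment:
  assumes t: "t \<in> {0..T}"
    and \<gamma>: "\<And>r x. r \<in> {0..T} \<Longrightarrow> x \<in> S \<Longrightarrow> (\<Sum>y\<in>S - {x}. q r x y * (\<phi> y - \<phi> x)\<^sup>2) \<le> \<gamma>"
  shows "expectation (\<lambda>w. (\<phi> (X t w) - \<phi> (X 0 w) - (LBINT r:{0..t}. genX \<phi> r w))\<^sup>2) \<le> \<gamma> * t"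
    and "integrable P (\<lambda>w. (\<phi> (X t w) - \<phi> (X 0 w) - (LBINT r:{0..t}. genX \<phi> r w))\<^sup>2)"
proof -
  have t0: "0 \<le> t" "t \<le> T" and zero: "0 \<in> {0..T}" and t': "t \<in> {0..}"
    using t T_nonneg by auto
  obtain b where b: "\<And>x. x \<in> S \<Longrightarrow> \<bar>\<phi> x\<bar> \<le> b" "0 \<le> b"
    using bounded_on_S by blast
  obtain B where B: "\<And>r x. r \<in> {0..T} \<Longrightarrow> x \<in> S \<Longrightarrow> \<bar>generator S q \<phi> r x\<bar> \<le> B" "0 \<le> B"
    using generator_bounded by blast
  have genX_B: "\<bar>genX \<phi> r w\<bar> \<le> B" if "w \<in> space P" for r w
    unfolding genX_def by (rule B(1)[OF clamp_in X_in[OF clamp_in that]])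
  have \<phi>_b: "\<bar>\<phi> (X (clamp_time T r) w)\<bar> \<le> b" if "w \<in> space P" for r w
    by (rule b(1)[OF X_in[OF clamp_in that]])
  define Z where "Z s w = \<phi> (X (clamp_time T s) w) - \<phi> (X 0 w)" for s w
  have Z_le: "\<bar>Z s w\<bar> \<le> 2 * b" if "w \<in> space P" for s w
    using \<phi>_b[OF that, of s] b(1)[OF X_in[OF zero that]] unfolding Z_def by linarith
  have Z_meas: "Z s \<in> borel_measurable P" for s
    unfolding Z_def by (intro borel_measurable_diff state_measurable clamp_in zero)
  have Z_joint [measurable]: "(\<lambda>z. Z (fst z) (snd z)) \<in> borel_measurable (borel \<Otimes>\<^sub>M P)"
  proof -
    have "(\<lambda>z. \<phi> (X (clamp_time T (fst z)) (snd z))) \<in> borel_measurable (borel \<Otimes>\<^sub>M P)"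
      using joint_measurable[of "\<lambda>r. \<phi>"] by (simp add: case_prod_beta')
    then show ?thesis
      unfolding Z_def by (intro borel_measurable_diff state_measurable_snd zero)
  qed
  \<comment> \<open>The lower limit is clamped at \<open>t\<close>, so \<open>R\<close> is jointly
    measurable and bounded by \<open>B * t\<close> for all real \<open>s\<close>; on [0,t] it is the
    remaining integral of the generator.\<close>
  define R where "R s w = (LBINT r:{clamp_time t s..t}. genX \<phi> r w)" for s w
  have R_joint [measurable]: "(\<lambda>z. R (fst z) (snd z)) \<in> borel_measurable (borel \<Otimes>\<^sub>M P)"
    using integral_genX_joint[OF measurable_clamp_time[of t] measurable_const[of t], of \<phi>] by (simp add: R_def case_prod_beta')
  have genX_path: "(\<lambda>r. genX \<phi> r w) \<in> borel_measurable borel" if "w \<in> space P" for w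
    by (rule path_measurable[OF genX_joint that])
  have genX_int: "set_integrable lborel {a..c} (\<lambda>r. genX \<phi> r w)" if "w \<in> space P" for w a c
    by (rule set_integrable_bounded[OF genX_path[OF that], of B]) (use genX_B[OF that] in simp)
  have R_le: "\<bar>R s w\<bar> \<le> B * t" if "w \<in> space P" for s w
  proof -
    have "norm (R s w) \<le> B * (t - clamp_time t s)"
      unfolding R_def by (rule norm_set_integral_le[OF genX_int[OF that]]) (use genX_B[OF that] t0 in auto)
    also have "\<dots> \<le> B * t"
      using B(2) t0 by (intro mult_left_mono) auto
    finally show ?thesis by simp
  qed
  define F where "F s w = genX \<phi> s w * (Z t w - R s w)" for s w
  have Zt_joint [measurable]: "(\<lambda>z. Z t (snd z)) \<in> borel_measurable (borel \<Otimes>\<^sub>M P)"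
    by (rule measurable_compose[OF measurable_snd Z_meas])
  have F_joint: "(\<lambda>(s, w). F s w) \<in> borel_measurable (borel \<Otimes>\<^sub>M P)"
    unfolding F_def case_prod_beta' by measurable
  have F_le: "\<bar>F s w\<bar> \<le> B * (2 * b + B * t)" if w: "w \<in> space P" for s w
    unfolding F_def abs_mult
    by (rule mult_mono[OF genX_B[OF w]])
      (use Z_le[OF w, of t] R_le[OF w, of s] B(2) in \<open>auto intro: order_trans[OF abs_triangle_ineq4]\<close>)
  note F_fub = fubini_bounded[OF F_joint F_le]
  let ?M = "\<lambda>w. \<phi> (X t w) - \<phi> (X 0 w) - (LBINT r:{0..t}. genX \<phi> r w)"
  have square: "(?M w)\<^sup>2 = (Z t w)\<^sup>2 - 2 * (LBINT s:{0..t}. F s w)" if w: "w \<in> space P" for w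
  proof -
    let ?I = "LBINT r:{0..t}. genX \<phi> r w"
    have 1: "?I\<^sup>2 = 2 * (LBINT s:{0..t}. genX \<phi> s w * R s w)"
    proof -
      have "(LBINT s:{0..t}. genX \<phi> s w * (LBINT r:{s..t}. genX \<phi> r w)) = (LBINT s:{0..t}. genX \<phi> s w * R s w)"
        by (rule set_lebesgue_integral_cong) (auto simp: R_def)
      then show ?thesis
        using square_set_integral[OF genX_path[OF w] genX_B[OF w] t0(1)] by simp
    qed
    have int: "set_integrable lborel {0..t} (\<lambda>s. genX \<phi> s w * R s w)"
    proof (rule set_integrable_bounded)
      have "(\<lambda>(s, w). genX \<phi> s w * R s w) \<in> borel_measurable (borel \<Otimes>\<^sub>M P)"
        unfolding case_prod_beta' by measurable
      then show "(\<lambda>s. genX \<phi> s w * R s w) \<in> borel_measurable borel"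
        by (rule path_measurable[OF _ w])
      show "norm (genX \<phi> s w * R s w) \<le> B * (B * t)" for s
        unfolding norm_mult by (rule mult_mono) (use genX_B[OF w] R_le[OF w] B(2) in auto)
    qed
    have "(LBINT s:{0..t}. F s w) = (LBINT s:{0..t}. genX \<phi> s w * Z t w - genX \<phi> s w * R s w)"
      by (simp add: F_def right_diff_distrib)
    also have "\<dots> = ?I * Z t w - (LBINT s:{0..t}. genX \<phi> s w * R s w)"
      using int genX_int[OF w] by (subst set_integral_diff(2)) auto
    finally have 2: "(LBINT s:{0..t}. F s w) = ?I * Z t w - (LBINT s:{0..t}. genX \<phi> s w * R s w)" .
    have "?M w = Z t w - ?I"
      using t0 by (simp add: Z_def)
    then have "(?M w)\<^sup>2 = (Z t w)\<^sup>2 - 2 * (?I * Z t w) + ?I\<^sup>2"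
      by (simp add: power2_diff mult_ac)
    then show ?thesis
      unfolding 1 2 by simp
  qed
  have int_Z2: "integrable P (\<lambda>w. (Z t w)\<^sup>2)"
  proof (rule integrable_const_bound)
    show "AE w in P. norm ((Z t w)\<^sup>2) \<le> (2 * b)\<^sup>2"
      using power_mono[OF Z_le abs_ge_zero, of _ t 2] by (intro AE_I2) simp
  qed (use Z_meas in measurable)
  have "integrable P (\<lambda>w. (Z t w)\<^sup>2 - 2 * (LBINT s:{0..t}. F s w))"
    by (intro Bochner_Integration.integrable_diff int_Z2 integrable_mult_right F_fub(4))
  then show "integrable P (\<lambda>w. (?M w)\<^sup>2)"
    by (rule iffD1[OF Bochner_Integration.integrable_cong[OF refl], rotated]) (simp add: square)
  have "expectation (\<lambda>w. (?M w)\<^sup>2) = expectation (\<lambda>w. (Z t w)\<^sup>2 - 2 * (LBINT s:{0..t}. F s w))"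
    by (rule Bochner_Integration.integral_cong[OF refl square])
  also have "\<dots> = expectation (\<lambda>w. (Z t w)\<^sup>2) - 2 * (LBINT s:{0..t}. expectation (F s))"
    using int_Z2 F_fub(4) by (simp add: F_fub(5))
  finally have EM: "expectation (\<lambda>w. (?M w)\<^sup>2)
    = expectation (\<lambda>w. (Z t w)\<^sup>2) - 2 * (LBINT s:{0..t}. expectation (F s))" .

  define E where "E s w = genX \<phi> s w * Z s w" for s w
  have E_joint: "(\<lambda>(s, w). E s w) \<in> borel_measurable (borel \<Otimes>\<^sub>M P)"
    unfolding E_def case_prod_beta' by measurable
  have E_le: "\<bar>E s w\<bar> \<le> B * (2 * b)" if w: "w \<in> space P" for s w
    unfolding E_def abs_mult by (rule mult_mono[OF genX_B[OF w] Z_le[OF w] B(2)]) auto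
  note E_fub = fubini_bounded[OF E_joint E_le]
  \<comment> \<open>The increment of the martingale from \<open>s\<close> to \<open>t\<close> is
    orthogonal to the generator at time \<open>s\<close>, a function of \<open>X s\<close>. This is
    Dynkin's formula for \<open>?h\<close>, the product of that function and \<open>\<phi>\<close>;
    hence \<open>Z t\<close> minus the remaining integral may be replaced by
    \<open>Z s\<close>.\<close>
  have EF: "expectation (F s) = expectation (E s)" if s: "s \<in> {0..t}" for s
  proof -
    have s': "s \<in> {0..T}" "t \<in> {s..T}" and cs: "clamp_time T s = s" "clamp_time t s = s"
      using s t0 by auto
    define G where "G r w = genX \<phi> s w * genX \<phi> r w" for r w
    have gs: "genX \<phi> s \<in> borel_measurable P"
      unfolding genX_def by (rule state_measurable[OF clamp_in])
    have [measurable]: "(\<lambda>z. genX \<phi> s (snd z)) \<in> borel_measurable (borel \<Otimes>\<^sub>M P)"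
      by (rule measurable_compose[OF measurable_snd gs])
    have G_joint: "(\<lambda>(r, w). G r w) \<in> borel_measurable (borel \<Otimes>\<^sub>M P)"
      unfolding G_def case_prod_beta' by measurable
    have G_le: "\<bar>G r w\<bar> \<le> B * B" if w: "w \<in> space P" for r w
      unfolding G_def abs_mult by (rule mult_mono[OF genX_B[OF w] genX_B[OF w] B(2)]) auto
    note G_fub = fubini_bounded[OF G_joint G_le]
    let ?h = "\<lambda>x y. generator S q \<phi> s x * \<phi> y"
    have st: "expectation (\<lambda>w. genX \<phi> s w * \<phi> (X t w)) = expectation (\<lambda>w. genX \<phi> s w * \<phi> (X s w))
        + (LBINT r:{s..t}. expectation (G r))"
    proof -
      have "(LBINT r:{s..t}. expectation (\<lambda>w. generator S q (?h (X s w)) r (X r w)))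
          = (LBINT r:{s..t}. expectation (G r))"
      proof (rule set_lebesgue_integral_cong)
        show "\<forall>r. r \<in> {s..t} \<longrightarrow> expectation (\<lambda>w. generator S q (?h (X s w)) r (X r w)) = expectation (G r)"
          using s t0 by (auto simp: generator_cmult G_def[abs_def] genX_def cs)
      qed simp
      then show ?thesis
        using dynkin[OF s', of ?h] by (simp add: genX_def cs)
    qed
    have int_t: "integrable P (\<lambda>w. genX \<phi> s w * \<phi> (X t w))" and int_s: "integrable P (\<lambda>w. genX \<phi> s w * \<phi> (X s w))"
      using expectation_two_times(2)[OF s', of ?h] expectation_two_times(2)[OF s'(1), of s ?h] s
      using t0 by (auto simp: genX_def cs)
    have "(\<lambda>w. F s w) = (\<lambda>w. E s w + (genX \<phi> s w * \<phi> (X t w) - genX \<phi> s w * \<phi> (X s w) - (LBINT r:{s..t}. G r w)))"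
      using t0 by (intro ext) (simp add: F_def E_def Z_def R_def G_def cs algebra_simps)
    then have "expectation (F s) = expectation (\<lambda>w. E s w
        + (genX \<phi> s w * \<phi> (X t w) - genX \<phi> s w * \<phi> (X s w) - (LBINT r:{s..t}. G r w)))"
      by simp
    also have "\<dots> = expectation (E s) + (expectation (\<lambda>w. genX \<phi> s w * \<phi> (X t w))
        - expectation (\<lambda>w. genX \<phi> s w * \<phi> (X s w)) - expectation (\<lambda>w. LBINT r:{s..t}. G r w))"
      using E_fub(3)[of s] int_t int_s G_fub(4)
      by (simp add: Bochner_Integration.integral_add Bochner_Integration.integral_diff)
    also have "\<dots> = expectation (E s)"
      using G_fub(5)[of s t] unfolding st by simp
    finally show ?thesis .
  qed
  \<comment> \<open>The generator of the squared distance from the initial state, that state being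
    frozen. By Dynkin's formula its expected time integral is the second moment of
    \<open>Z t\<close>.\<close>
  define H where "H r w = generator S q (\<lambda>y. (\<phi> y - \<phi> (X 0 w))\<^sup>2) (clamp_time T r) (X (clamp_time T r) w)" for r w
  have H_joint: "(\<lambda>(r, w). H r w) \<in> borel_measurable (borel \<Otimes>\<^sub>M P)"
    unfolding H_def
    by (rule joint_measurable2[where k = "\<lambda>r x0 x. generator S q (\<lambda>y. (\<phi> y - \<phi> x0)\<^sup>2) (clamp_time T r) x",
          OF generator_measurable zero])
  have "\<exists>C. \<forall>r x. r \<in> {0..T} \<longrightarrow> x \<in> S \<longrightarrow> \<bar>generator S q (\<lambda>y. (\<phi> y - \<phi> x0)\<^sup>2) r x\<bar> \<le> C" for x0
    using generator_bounded[of "\<lambda>y. (\<phi> y - \<phi> x0)\<^sup>2"] by metis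
  then obtain C where C: "\<And>x0 r x. r \<in> {0..T} \<Longrightarrow> x \<in> S \<Longrightarrow>
      \<bar>generator S q (\<lambda>y. (\<phi> y - \<phi> x0)\<^sup>2) r x\<bar> \<le> C x0"
    by metis
  have H_le: "\<bar>H r w\<bar> \<le> (\<Sum>x0\<in>S. \<bar>C x0\<bar>)" if w: "w \<in> space P" for r w
  proof -
    have "\<bar>H r w\<bar> \<le> \<bar>C (X 0 w)\<bar>"
      unfolding H_def by (rule order_trans[OF C[OF clamp_in X_in[OF clamp_in w]] abs_ge_self])
    also have "\<dots> \<le> (\<Sum>x0\<in>S. \<bar>C x0\<bar>)"
      using X_in[OF zero w] finite_S by (intro member_le_sum) auto
    finally show ?thesis .
  qed
  note H_fub = fubini_bounded[OF H_joint H_le]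
  have EZ2: "expectation (\<lambda>w. (Z t w)\<^sup>2) = (LBINT r:{0..t}. expectation (H r))"
  proof -
    let ?h = "\<lambda>x y. (\<phi> y - \<phi> x)\<^sup>2"
    have "expectation (\<lambda>w. (Z t w)\<^sup>2) = expectation (\<lambda>w. ?h (X 0 w) (X t w))"
      using t0 by (simp add: Z_def)
    also have "\<dots> = (LBINT r:{0..t}. expectation (\<lambda>w. generator S q (?h (X 0 w)) r (X r w)))"
      using dynkin[OF zero t, of ?h] by simp
    also have "\<dots> = (LBINT r:{0..t}. expectation (H r))"
    proof (rule set_lebesgue_integral_cong)
      show "\<forall>r. r \<in> {0..t} \<longrightarrow> expectation (\<lambda>w. generator S q (?h (X 0 w)) r (X r w)) = expectation (H r)"
        using t0 by (auto simp: H_def[abs_def])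
    qed simp
    finally show ?thesis .
  qed
  have int_H: "set_integrable lborel {0..t} (\<lambda>r. expectation (H r))"
    by (rule set_integrable_bounded[OF H_fub(1), where B = "\<Sum>x0\<in>S. \<bar>C x0\<bar>"]) (use H_fub(2) in auto)
  have int_E: "set_integrable lborel {0..t} (\<lambda>r. expectation (E r))"
    by (rule set_integrable_bounded[OF E_fub(1), where B = "B * (2 * b)"]) (use E_fub(2) in auto)
  \<comment> \<open>\<open>H\<close> is the squared jump intensity, at most \<open>\<gamma>\<close>,
    plus twice \<open>E\<close>. The part \<open>2 * E\<close> is exactly what the second moment of
    the martingale subtracts, so \<open>\<gamma> * t\<close> remains.\<close>
  have HE: "expectation (H r) \<le> \<gamma> + 2 * expectation (E r)" if r: "r \<in> {0..t}" for r
  proof -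
    have "expectation (H r) \<le> expectation (\<lambda>w. \<gamma> + 2 * E r w)"
    proof (rule integral_mono)
      show "H r w \<le> \<gamma> + 2 * E r w" if w: "w \<in> space P" for w
        using \<gamma>[OF clamp_in X_in[OF clamp_in w], of r r]
        unfolding H_def E_def generator_square_shift by (simp add: genX_def Z_def mult.commute)
    qed (use H_fub(3) E_fub(3) in auto)
    also have "\<dots> = \<gamma> + 2 * expectation (E r)"
      using E_fub(3)[of r] by (simp add: prob_space)
    finally show ?thesis .
  qed
  have int_\<gamma>: "set_integrable lborel {0..t} (\<lambda>_. \<gamma>)"
    by (intro borel_integrable_atLeastAtMost') auto
  have int_2E: "set_integrable lborel {0..t} (\<lambda>r. 2 * expectation (E r))"
    using int_E by simp
  have "(LBINT r:{0..t}. expectation (H r)) \<le> (LBINT r:{0..t}. \<gamma> + 2 * expectation (E r))"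
    by (rule set_integral_mono[OF int_H set_integral_add(1)[OF int_\<gamma> int_2E] HE])
  also have "\<dots> = \<gamma> * t + 2 * (LBINT r:{0..t}. expectation (E r))"
    using t0 by (simp add: set_integral_add(2)[OF int_\<gamma> int_2E]) (simp add: set_lebesgue_integral_def)
  finally have *: "(LBINT r:{0..t}. expectation (H r)) \<le> \<gamma> * t + 2 * (LBINT r:{0..t}. expectation (E r))" .
  have "(LBINT s:{0..t}. expectation (F s)) = (LBINT s:{0..t}. expectation (E s))"
    by (rule set_lebesgue_integral_cong) (auto simp: EF)
  then show "expectation (\<lambda>w. (?M w)\<^sup>2) \<le> \<gamma> * t"
    unfolding EM EZ2 using * by simp
qed

end


subsection \<open>The initial law\<close>

text \<open>Additivity of the variance for independent centred variables, by splitting off one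
  coordinate of the product law at a time.\<close>

lemma expectation_square_sum_Pi_pmf:
  fixes D :: "'d::finite pmf" and y :: "'d \<Rightarrow> real"
  assumes "finite A" and zero: "measure_pmf.expectation D y = 0"
  shows "measure_pmf.expectation (Pi_pmf A dflt (\<lambda>_. D)) (\<lambda>\<xi>. (\<Sum>k\<in>A. y (\<xi> k))\<^sup>2)
    = real (card A) * measure_pmf.expectation D (\<lambda>x. (y x)\<^sup>2)"
  using \<open>finite A\<close>
proof (induction A rule: finite_induct)
  case (insert x A)
  let ?P = "Pi_pmf A dflt (\<lambda>_. D)"
  let ?S = "\<lambda>\<xi>. \<Sum>k\<in>A. y (\<xi> k)"
  have fin: "finite (set_pmf ?P)"
    by (rule finite_subset[OF set_Pi_pmf_subset'[OF insert.hyps(1)]]) (auto intro!: finite_PiE_dflt insert.hyps)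
  have int: "integrable ?P h" for h :: "_ \<Rightarrow> real"
    by (rule integrable_measure_pmf_finite[OF fin])
  have D: "measure_pmf.expectation D h = (\<Sum>a\<in>UNIV. pmf D a * h a)" for h :: "'d \<Rightarrow> real"
    by (subst integral_measure_pmf[of UNIV]) auto
  have sum_upd: "(\<Sum>k\<in>insert x A. y ((\<xi>(x := a)) k)) = y a + ?S \<xi>" for a \<xi>
  proof -
    have "(\<Sum>k\<in>A. y ((\<xi>(x := a)) k)) = ?S \<xi>"
      using insert.hyps by (intro sum.cong) auto
    then show ?thesis
      using insert.hyps by simp
  qed
  have "Pi_pmf (insert x A) dflt (\<lambda>_. D) = bind_pmf D (\<lambda>a. map_pmf (\<lambda>\<xi>. \<xi>(x := a)) ?P)"
    unfolding Pi_pmf_insert[OF insert.hyps] pair_pmf_def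
    by (simp add: map_bind_pmf map_pmf_def bind_assoc_pmf bind_return_pmf)
  then have "measure_pmf.expectation (Pi_pmf (insert x A) dflt (\<lambda>_. D)) (\<lambda>\<xi>. (\<Sum>k\<in>insert x A. y (\<xi> k))\<^sup>2)
      = (\<Sum>a\<in>UNIV. pmf D a * measure_pmf.expectation ?P (\<lambda>\<xi>. (y a + ?S \<xi>)\<^sup>2))"
    using fin by (simp only:) (subst pmf_expectation_bind[of UNIV], auto simp: sum_upd simp del: sum.insert fun_upd_apply)
  also have "\<dots> = (\<Sum>a\<in>UNIV. pmf D a * ((y a)\<^sup>2 + (2 * measure_pmf.expectation ?P ?S) * y a
      + measure_pmf.expectation ?P (\<lambda>\<xi>. (?S \<xi>)\<^sup>2)))"
  proof (intro sum.cong refl arg_cong2[where f = "(*)"])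
    fix a
    have "measure_pmf.expectation ?P (\<lambda>\<xi>. (y a + ?S \<xi>)\<^sup>2)
        = measure_pmf.expectation ?P (\<lambda>\<xi>. (y a)\<^sup>2 + (2 * y a * ?S \<xi> + (?S \<xi>)\<^sup>2))"
      by (simp add: power2_sum algebra_simps)
    also have "\<dots> = (y a)\<^sup>2 + (2 * y a * measure_pmf.expectation ?P ?S + measure_pmf.expectation ?P (\<lambda>\<xi>. (?S \<xi>)\<^sup>2))"
      by (simp add: Bochner_Integration.integral_add[OF int int] measure_pmf.prob_space)
    finally show "measure_pmf.expectation ?P (\<lambda>\<xi>. (y a + ?S \<xi>)\<^sup>2) = (y a)\<^sup>2
        + (2 * measure_pmf.expectation ?P ?S) * y a + measure_pmf.expectation ?P (\<lambda>\<xi>. (?S \<xi>)\<^sup>2)"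
      by simp
  qed
  \<comment> \<open>The middle term is a product of expectations, by independence, and vanishes
    since \<open>y\<close> is centred.\<close>
  also have "\<dots> = measure_pmf.expectation D (\<lambda>a. (y a)\<^sup>2)
      + (2 * measure_pmf.expectation ?P ?S) * measure_pmf.expectation D y
      + measure_pmf.expectation ?P (\<lambda>\<xi>. (?S \<xi>)\<^sup>2)"
  proof -
    have "(\<Sum>a\<in>UNIV. pmf D a * (c * y a)) = c * (\<Sum>a\<in>UNIV. pmf D a * y a)" for c
      by (simp add: sum_distrib_left mult_ac)
    then show ?thesis
      unfolding D distrib_left sum.distrib by (simp add: sum_pmf_eq_1 flip: sum_distrib_right)
  qed
  finally show ?case
    using insert by (simp add: zero algebra_simps)
qed simp

lemma pmf_of_prob_simplex:
  assumes "m \<in> prob_simplex"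
  shows "pmf (embed_pmf (\<lambda>i. m $ i)) i = m $ i"
proof (rule pmf_embed_pmf)
  show "0 \<le> m $ i" for i
    using assms by (simp add: prob_simplex_def)
  have "(\<integral>\<^sup>+ i. ennreal (m $ i) \<partial>count_space UNIV) = (\<Sum>i\<in>UNIV. ennreal (m $ i))"
    by (rule nn_integral_count_space_finite) simp
  also have "\<dots> = ennreal (\<Sum>i\<in>UNIV. m $ i)"
    using assms by (intro sum_ennreal) (simp add: prob_simplex_def)
  finally show "(\<integral>\<^sup>+ i. ennreal (m $ i) \<partial>count_space UNIV) = 1"
    using assms by (simp add: prob_simplex_def)
qed

lemma finite_set_initial_law:
  "finite (set_pmf (initial_law N (m :: real^'d::finite)))"
  unfolding initial_law_def set_map_pmf
  by (intro finite_imageI finite_subset[OF set_Pi_pmf_subset']) (auto intro!: finite_PiE_dflt)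

text \<open>Coordinate \<open>i\<close> of the empirical measure is the mean of \<open>N\<close>
  independent indicators of state \<open>i\<close>. Centred, each has absolute value at most
  1.\<close>

lemma initial_law_variance:
  fixes m :: "real^'d::finite"
  assumes m: "m \<in> prob_simplex" and N: "1 \<le> N"
  shows "measure_pmf.expectation (initial_law N m) (\<lambda>x. (x $ i - m $ i)\<^sup>2) \<le> 1 / real N"
proof -
  define D where "D = embed_pmf (\<lambda>i. m $ i)"
  define y where "y j = (if j = i then 1 else 0) - m $ i" for j
  have D: "measure_pmf.expectation D h = (\<Sum>a\<in>UNIV. m $ a * h a)" for h :: "'d \<Rightarrow> real"
    by (subst integral_measure_pmf[of UNIV]) (auto simp: D_def pmf_of_prob_simplex[OF m])
  have m1: "(\<Sum>a\<in>UNIV. m $ a) = 1" and m0: "0 \<le> m $ a" "m $ a \<le> 1" for a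
    using m prob_simplex_le_1[OF m] by (auto simp: prob_simplex_def)
  have zero: "measure_pmf.expectation D y = 0"
  proof -
    have "m $ a * y a = (if a = i then m $ i else 0) - m $ a * m $ i" for a
      by (auto simp: y_def algebra_simps)
    then show ?thesis
      unfolding D by (simp add: sum_subtractf m1 flip: sum_distrib_right)
  qed
  have "measure_pmf.expectation D (\<lambda>j. (y j)\<^sup>2) \<le> (\<Sum>a\<in>UNIV. m $ a * 1)"
    unfolding D
  proof (intro sum_mono mult_left_mono m0)
    show "(y a)\<^sup>2 \<le> 1" for a
      using m0[of i] by (auto simp: y_def intro!: power_le_one)
  qed
  then have var: "measure_pmf.expectation D (\<lambda>j. (y j)\<^sup>2) \<le> 1"
    by (simp add: m1)
  have emp: "empirical N \<xi> $ i - m $ i = (1 / real N) * (\<Sum>k<N. y (\<xi> k))" for \<xi>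
  proof -
    have "(\<Sum>k<N. (if \<xi> k = i then 1 else 0 :: real)) = real (card {k. k < N \<and> \<xi> k = i})"
      by (simp add: sum.If_cases Int_def)
    then have "(\<Sum>k<N. y (\<xi> k)) = real (card {k. k < N \<and> \<xi> k = i}) - real N * m $ i"
      unfolding y_def sum_subtractf by simp
    then show ?thesis
      using N by (simp add: empirical_def field_simps)
  qed
  have "measure_pmf.expectation (initial_law N m) (\<lambda>x. (x $ i - m $ i)\<^sup>2)
      = measure_pmf.expectation (Pi_pmf {..<N} undefined (\<lambda>_. D)) (\<lambda>\<xi>. (1 / real N)\<^sup>2 * (\<Sum>k<N. y (\<xi> k))\<^sup>2)"
    unfolding initial_law_def D_def[symmetric] integral_map_pmf emp power_mult_distrib ..
  also have "\<dots> = (1 / real N)\<^sup>2 * (real N * measure_pmf.expectation D (\<lambda>x. (y x)\<^sup>2))"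
    using expectation_square_sum_Pi_pmf[of "{..<N}" D y undefined] zero by simp
  also have "\<dots> \<le> (1 / real N)\<^sup>2 * (real N * 1)"
    using var by (intro mult_left_mono) auto
  also have "\<dots> = 1 / real N"
    using N by (simp add: power2_eq_square)
  finally show ?thesis .
qed

lemma finite_grid:
  assumes "1 \<le> N"
  shows "finite (grid N :: (real^'d::finite) set)"
proof -
  have "grid N \<subseteq> (\<lambda>h. \<chi> i. real (h i) / real N) ` (UNIV \<rightarrow>\<^sub>E {..N} :: ('d \<Rightarrow> nat) set)"
  proof
    fix m :: "real^'d" assume m: "m \<in> grid N"
    then obtain h where h: "\<And>i. m $ i = real (h i) / real N"
      unfolding grid_def by (auto dest!: choice)
    have "h i \<le> N" for i
    proof -
      have "real (h i) / real N \<le> 1"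
        using prob_simplex_le_1[of m i] m h[of i] by (simp add: grid_def)
      then show ?thesis
        using assms by simp
    qed
    then have "h \<in> UNIV \<rightarrow>\<^sub>E {..N}"
      by auto
    moreover have "m = (\<chi> i. real (h i) / real N)"
      using h by (simp add: vec_eq_iff)
    ultimately show "m \<in> (\<lambda>h. \<chi> i. real (h i) / real N) ` (UNIV \<rightarrow>\<^sub>E {..N})"
      by blast
  qed
  then show ?thesis
    by (rule finite_subset) (intro finite_imageI finite_PiE; simp)
qed


subsection \<open>The chain of empirical measures\<close>

text \<open>Sampling the path on a time mesh gives jointly measurable functions, glued from
  countably many variables; refining the mesh from the right, they converge by right
  continuity.\<close>

lemma right_continuous_joint_measurable:
  fixes X :: "real \<Rightarrow> 'w \<Rightarrow> 'e::euclidean_space"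
  assumes T: "0 \<le> T" and S: "finite S"
    and X: "\<And>t. t \<in> {0..T} \<Longrightarrow> X t \<in> P \<rightarrow>\<^sub>M count_space S"
    and right: "\<And>w t. w \<in> space P \<Longrightarrow> t \<in> {0..<T} \<Longrightarrow> ((\<lambda>s. X s w) \<longlongrightarrow> X t w) (at_right t)"
  shows "(\<lambda>(r, w). X (clamp_time T r) w) \<in> borel \<Otimes>\<^sub>M P \<rightarrow>\<^sub>M count_space S"
proof -
  \<comment> \<open>The first multiple of 1/(n+1) strictly after the time, capped at
    \<open>T\<close>. Strictness matters because a limit along \<open>at_right\<close> does not see
    the point itself. At time \<open>T\<close> the cap makes the sequence constant.\<close>
  define \<tau> where "\<tau> n r = clamp_time T ((of_int \<lfloor>real (Suc n) * clamp_time T r\<rfloor> + 1) / real (Suc n))" for n r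
  have X_borel: "X t \<in> borel_measurable P" if "t \<in> {0..T}" for t
    using measurable_compose[OF X[OF that], of "\<lambda>x. x" borel] by simp
  have meas: "(\<lambda>z. X (\<tau> n (fst z)) (snd z)) \<in> borel_measurable (borel \<Otimes>\<^sub>M P)" for n
    unfolding \<tau>_def
  proof (rule measurable_compose_countable[where g = "\<lambda>z. \<lfloor>real (Suc n) * clamp_time T (fst z)\<rfloor>"
        and f = "\<lambda>j z. X (clamp_time T ((of_int j + 1) / real (Suc n))) (snd z)"])
    show "(\<lambda>z. X (clamp_time T ((of_int j + 1) / real (Suc n))) (snd z)) \<in> borel_measurable (borel \<Otimes>\<^sub>M P)" for j
      by (rule measurable_compose[OF measurable_snd X_borel]) (use T in simp)
  qed measurable
  have lim: "(\<lambda>n. X (\<tau> n r) w) \<longlonglongrightarrow> X (clamp_time T r) w" if w: "w \<in> space P" for r w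
  proof -
    define c where "c = clamp_time T r"
    define u where "u n = (of_int \<lfloor>real (Suc n) * c\<rfloor> + 1) / real (Suc n)" for n
    have c: "0 \<le> c" "c \<le> T"
      using T by (auto simp: c_def)
    have u: "c < u n" "u n \<le> c + 1 / real (Suc n)" for n
    proof -
      have "real (Suc n) * c < of_int \<lfloor>real (Suc n) * c\<rfloor> + 1"
        by linarith
      then show "c < u n"
        unfolding u_def by (simp add: pos_less_divide_eq mult.commute)
      have "of_int \<lfloor>real (Suc n) * c\<rfloor> + 1 \<le> real (Suc n) * c + 1"
        by linarith
      then have "u n \<le> (real (Suc n) * c + 1) / real (Suc n)"
        unfolding u_def by (intro divide_right_mono) auto
      also have "\<dots> = c + 1 / real (Suc n)"
        by (simp add: add_divide_distrib)
      finally show "u n \<le> c + 1 / real (Suc n)" .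
    qed
    have \<tau>u: "\<tau> n r = min T (u n)" for n
    proof -
      have "\<tau> n r = clamp_time T (u n)"
        by (simp only: \<tau>_def u_def c_def)
      then show ?thesis
        using u(1)[of n] c by (simp add: clamp_time_def)
    qed
    have "(\<lambda>n. c + 1 / real (Suc n)) \<longlonglongrightarrow> c"
      using tendsto_add[OF tendsto_const LIMSEQ_inverse_real_of_nat, of c] by (simp add: inverse_eq_divide)
    then have u_lim: "u \<longlonglongrightarrow> c"
      using u by (intro tendsto_sandwich[of "\<lambda>_. c" u sequentially "\<lambda>n. c + 1 / real (Suc n)" c])
        (auto intro!: always_eventually less_imp_le simp del: of_nat_Suc)
    show ?thesis
    proof (cases "c < T")
      case True
      have "eventually (\<lambda>n. u n < T) sequentially"
        by (rule order_tendstoD(2)[OF u_lim True])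
      then have ev: "eventually (\<lambda>n. \<tau> n r = u n) sequentially"
        by eventually_elim (simp add: \<tau>u)
      have "filterlim u (at_right c) sequentially"
        unfolding filterlim_at using u_lim u(1) by (auto intro!: always_eventually simp: less_imp_neq[THEN not_sym])
      from filterlim_compose[OF right[OF w] this] have "(\<lambda>n. X (u n) w) \<longlonglongrightarrow> X c w"
        using c True by auto
      moreover have "eventually (\<lambda>n. X (u n) w = X (\<tau> n r) w) sequentially"
        using ev by eventually_elim simp
      ultimately show ?thesis
        unfolding c_def[symmetric] by (rule Lim_transform_eventually)
    next
      case False
      then have "\<tau> n r = c" for n
        using c u(1)[of n] by (simp add: \<tau>u)
      then show ?thesis
        by (simp add: c_def)
    qed
  qed
  have borel: "(\<lambda>z. X (clamp_time T (fst z)) (snd z)) \<in> borel_measurable (borel \<Otimes>\<^sub>M P)"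
  proof (rule borel_measurable_LIMSEQ_metric)
    show "(\<lambda>n. X (\<tau> n (fst z)) (snd z)) \<longlonglongrightarrow> X (clamp_time T (fst z)) (snd z)"
      if "z \<in> space (borel \<Otimes>\<^sub>M P)" for z
      by (rule lim) (use that in \<open>auto simp: space_pair_measure\<close>)
  qed (rule meas)
  \<comment> \<open>The limit was taken in the Borel sense; singletons are Borel and
    \<open>S\<close> is finite, which gives back the discrete sigma-algebra.\<close>
  have "(\<lambda>z. X (clamp_time T (fst z)) (snd z)) \<in> borel \<Otimes>\<^sub>M P \<rightarrow>\<^sub>M count_space S"
    unfolding measurable_count_space_eq2[OF S]
  proof (intro conjI ballI)
    show "(\<lambda>z. X (clamp_time T (fst z)) (snd z)) \<in> space (borel \<Otimes>\<^sub>M P) \<rightarrow> S"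
      using measurable_space[OF X] T by (fastforce simp: space_pair_measure)
    show "(\<lambda>z. X (clamp_time T (fst z)) (snd z)) -` {a} \<inter> space (borel \<Otimes>\<^sub>M P) \<in> sets (borel \<Otimes>\<^sub>M P)" for a
      by (rule measurable_sets[OF borel]) simp
  qed
  then show ?thesis
    by (simp add: case_prod_beta')
qed

definition jump :: "nat \<Rightarrow> 'd::finite \<times> 'd \<Rightarrow> real^'d" where
  "jump N = (\<lambda>(i, j). (1 / real N) *\<^sub>R (axis j 1 - axis i 1))"

lemma jump_nth: "jump N (i, j) $ k = (1 / real N) * ((if k = j then 1 else 0) - (if k = i then 1 else 0))"
  by (simp add: jump_def axis_def)

lemma jump_diag [simp]: "jump N (i, i) = 0"
  by (simp add: jump_def)

lemma jump_nonzero: "1 \<le> N \<Longrightarrow> i \<noteq> j \<Longrightarrow> jump N (i, j) \<noteq> 0"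
proof
  assume "1 \<le> N" "i \<noteq> j" "jump N (i, j) = 0"
  then show False
    using jump_nth[of N i j j] by simp
qed

lemma grid_jump:
  fixes x :: "real^'d::finite"
  assumes x: "x \<in> grid N" and N: "1 \<le> N" and i: "x $ i \<noteq> 0" and ij: "i \<noteq> j"
  shows "x + jump N (i, j) \<in> grid N"
proof -
  obtain h :: "'d \<Rightarrow> nat" where h: "\<And>k. x $ k = real (h k) / real N"
    using x unfolding grid_def by (auto dest!: choice)
  \<comment> \<open>At least one agent is in state \<open>i\<close>, so the count can be lowered
    within the natural numbers.\<close>
  have hi: "1 \<le> h i"
    using i h[of i] by (cases "h i") auto
  define h' where "h' = h(i := h i - 1, j := h j + 1)"
  have eq: "(x + jump N (i, j)) $ k = real (h' k) / real N" for k
    using hi ij N by (auto simp: jump_nth h h'_def of_nat_diff field_simps)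
  have "(\<Sum>k\<in>UNIV. (x + jump N (i, j)) $ k) = (\<Sum>k\<in>UNIV. x $ k)"
    by (simp add: jump_nth sum.distrib sum_subtractf flip: sum_divide_distrib)
  then have "(\<Sum>k\<in>UNIV. (x + jump N (i, j)) $ k) = 1"
    using x by (simp add: grid_def prob_simplex_def)
  moreover have "0 \<le> (x + jump N (i, j)) $ k" for k
    unfolding eq by simp
  ultimately show ?thesis
    unfolding grid_def prob_simplex_def using eq by blast
qed

text \<open>Jumps leaving the grid have rate zero, so the sum over target states is a sum over pairs.\<close>

lemma sum_jump_rate:
  fixes x :: "real^'d::finite"
  assumes x: "x \<in> grid N" and N: "1 \<le> N" and h0: "h x = 0"
  shows "(\<Sum>y\<in>grid N - {x}. jump_rate Q N \<beta> r x y * h y)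
    = (\<Sum>i\<in>UNIV. \<Sum>j\<in>UNIV. real N * x $ i * Q i j r (\<beta> r i x) x * h (x + jump N (i, j)))"
proof -
  let ?D = "{(i, j). i \<noteq> (j :: 'd)}"
  let ?c = "\<lambda>p. real N * x $ fst p * Q (fst p) (snd p) r (\<beta> r (fst p) x) x"
  have rate: "jump_rate Q N \<beta> r x y = (\<Sum>p\<in>?D. if y = x + jump N p then ?c p else 0)" for y
  proof -
    have "jump_rate Q N \<beta> r x y = sum ?c {p \<in> ?D. y = x + jump N p}"
      unfolding jump_rate_def by (intro sum.cong) (auto simp: jump_def)
    then show ?thesis
      by (simp add: sum.If_cases Int_def)
  qed
  have "(\<Sum>y\<in>grid N - {x}. jump_rate Q N \<beta> r x y * h y)
      = (\<Sum>y\<in>grid N - {x}. \<Sum>p\<in>?D. if y = x + jump N p then ?c p * h (x + jump N p) else 0)"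
    unfolding rate sum_distrib_right by (intro sum.cong refl) auto
  also have "\<dots> = (\<Sum>p\<in>?D. \<Sum>y\<in>grid N - {x}. if y = x + jump N p then ?c p * h (x + jump N p) else 0)"
    by (rule sum.swap)
  also have "\<dots> = (\<Sum>p\<in>?D. ?c p * h (x + jump N p))"
  proof (rule sum.cong[OF refl])
    fix p assume "p \<in> ?D"
    then obtain i j where p: "p = (i, j)" "i \<noteq> j"
      by auto
    show "(\<Sum>y\<in>grid N - {x}. if y = x + jump N p then ?c p * h (x + jump N p) else 0) = ?c p * h (x + jump N p)"
    proof (cases "x $ i = 0")
      case True
      then have c0: "?c p = 0"
        by (simp add: p)
      show ?thesis
        unfolding c0 mult_zero_left if_cancel by simp
    next
      case False
      then have "x + jump N p \<in> grid N - {x}"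
        using grid_jump[OF x N False p(2)] jump_nonzero[OF N p(2)] by (simp add: p)
      then show ?thesis
        by (subst sum.delta) (auto simp: finite_grid[OF N])
    qed
  qed
  \<comment> \<open>Adding the diagonal pairs changes nothing because \<open>h\<close> vanishes at
    \<open>x\<close>.\<close>
  also have "\<dots> = (\<Sum>p\<in>UNIV. ?c p * h (x + jump N p))"
    by (rule sum.mono_neutral_left) (auto simp: h0)
  also have "\<dots> = (\<Sum>i\<in>UNIV. \<Sum>j\<in>UNIV. real N * x $ i * Q i j r (\<beta> r i x) x * h (x + jump N (i, j)))"
    unfolding sum.cartesian_product UNIV_Times_UNIV by (simp add: case_prod_beta')
  finally show ?thesis .
qed

lemma grid_subset: "x \<in> grid N \<Longrightarrow> x \<in> prob_simplex"
  by (simp add: grid_def)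

text \<open>Evaluated along a path of the chain, it is the path control. The vector form is needed
  because the running cost is regular only as a function of all actions jointly.\<close>

definition feedback_vec :: "('a, 'd::finite) feedback \<Rightarrow> real \<Rightarrow> real^'d \<Rightarrow> 'a^'d" where
  "feedback_vec \<beta> t x = (\<chi> i. \<beta> t i x)"

context mean_field
begin

lemma T_nonneg: "0 \<le> T"
  using T_pos by simp

lemma feedback_clamp_measurable:
  assumes "\<beta> \<in> feedback_controls T A N" "x \<in> grid N"
  shows "(\<lambda>r. \<beta> (clamp_time T r) i x) \<in> borel \<rightarrow>\<^sub>M restrict_space borel A"
  using assms measurable_compose[OF measurable_clamp_time_restrict[OF T_nonneg]]
  by (auto simp: feedback_controls_def)

lemma feedback_in:
  assumes "\<beta> \<in> feedback_controls T A N" "x \<in> grid N" "t \<in> {0..T}"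
  shows "\<beta> t i x \<in> A"
  using measurable_space[OF feedback_clamp_measurable[OF assms(1,2)], of t i] assms(3)
  by (simp add: space_restrict_space)

lemma feedback_vec_in:
  assumes "\<beta> \<in> feedback_controls T A N" "x \<in> grid N" "t \<in> {0..T}"
  shows "feedback_vec \<beta> t x \<in> action_vectors A"
  using feedback_in[OF assms] by (simp add: action_vectors_def feedback_vec_def)

lemma jump_rate_measurable:
  assumes \<beta>: "\<beta> \<in> feedback_controls T A N" and x: "x \<in> grid N"
  shows "(\<lambda>r. jump_rate Q N \<beta> (clamp_time T r) x y) \<in> borel_measurable borel"
proof -
  have [measurable]: "(\<lambda>r. Q i j (clamp_time T r) (\<beta> (clamp_time T r) i x) x) \<in> borel_measurable borel" for i j
    by (rule Q_measurable[OF feedback_clamp_measurable[OF \<beta> x] measurable_clamp_time])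
      (use T_nonneg grid_subset[OF x] in auto)
  show ?thesis
    unfolding jump_rate_def case_prod_beta' by measurable
qed

lemma jump_rate_bound:
  assumes \<beta>: "\<beta> \<in> feedback_controls T A N" and x: "x \<in> grid N" and r: "r \<in> {0..T}"
  shows "\<bar>jump_rate Q N \<beta> r x y\<bar> \<le> D * (D * (real N * K))"
proof -
  let ?D = "{(i, j). i \<noteq> j \<and> y = x + (1 / real N) *\<^sub>R (axis j 1 - axis i (1 :: real))} :: ('d \<times> 'd) set"
  have "\<bar>jump_rate Q N \<beta> r x y\<bar> \<le> (\<Sum>p\<in>?D. \<bar>case p of (i, j) \<Rightarrow> real N * x $ i * Q i j r (\<beta> r i x) x\<bar>)"
    unfolding jump_rate_def by (rule sum_abs)
  also have "\<dots> \<le> (\<Sum>p\<in>?D. real N * K)"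
  proof (rule sum_mono)
    fix p assume "p \<in> ?D"
    obtain i j where p: "p = (i, j)"
      by (cases p)
    have "\<bar>x $ i * Q i j r (\<beta> r i x) x\<bar> \<le> K"
      using weighted_rate_bound[OF r feedback_in[OF \<beta> x r] grid_subset[OF x], of i i j] by simp
    then have "real N * \<bar>x $ i * Q i j r (\<beta> r i x) x\<bar> \<le> real N * K"
      by (rule mult_left_mono) simp
    then show "\<bar>case p of (i, j) \<Rightarrow> real N * x $ i * Q i j r (\<beta> r i x) x\<bar> \<le> real N * K"
      by (simp add: p abs_mult mult.assoc)
  qed
  also have "\<dots> \<le> (\<Sum>p\<in>(UNIV :: ('d \<times> 'd) set). real N * K)"
    using K_pos by (intro sum_mono2) auto
  also have "\<dots> = D * (D * (real N * K))"
    by (simp add: D_def)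
  finally show ?thesis .
qed

text \<open>The rate carries a factor N and the jump a factor 1/N, and the generator is linear on
  coordinates. So the drift of the chain is exactly the mean field drift, with no error depending on
  \<open>N\<close>.\<close>

lemma generator_coordinate:
  assumes x: "x \<in> grid N" and N: "1 \<le> N" and a: "\<alpha> r = feedback_vec \<beta> r x"
  shows "generator (grid N) (jump_rate Q N \<beta>) (\<lambda>y. y $ k) r x = mf_drift Q \<alpha> r x $ k"
proof -
  have "generator (grid N) (jump_rate Q N \<beta>) (\<lambda>y. y $ k) r x
      = (\<Sum>i\<in>UNIV. \<Sum>j\<in>UNIV. real N * x $ i * Q i j r (\<beta> r i x) x * ((x + jump N (i, j)) $ k - x $ k))"
    unfolding generator_def by (rule sum_jump_rate[OF x N]) simp
  also have "\<dots> = (\<Sum>i\<in>UNIV. \<Sum>j\<in>UNIV. (if k = j then x $ i * Q i j r (\<beta> r i x) x else 0)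
      - (if k = i then x $ i * Q i j r (\<beta> r i x) x else 0))"
    using N by (intro sum.cong refl) (simp add: jump_nth)
  also have "\<dots> = (\<Sum>i\<in>UNIV. x $ i * Q i k r (\<beta> r i x) x) - (\<Sum>j\<in>UNIV. x $ k * Q k j r (\<beta> r k x) x)"
  proof -
    have "(\<Sum>i\<in>UNIV. \<Sum>j\<in>UNIV. if k = i then x $ i * Q i j r (\<beta> r i x) x else 0)
        = (\<Sum>j\<in>UNIV. x $ k * Q k j r (\<beta> r k x) x)"
      by (subst sum.swap) simp
    then show ?thesis
      by (simp add: sum_subtractf)
  qed
  also have "\<dots> = mf_drift Q \<alpha> r x $ k"
    by (simp add: drift_nth sum_subtractf a feedback_vec_def)
  finally show ?thesis .
qed

text \<open>For squares the factor N of the rate meets 1/N^2 from the jump, leaving 1/N. This is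
  where the martingale part of the chain becomes small.\<close>

lemma square_jump_bound:
  assumes \<beta>: "\<beta> \<in> feedback_controls T A N" and x: "x \<in> grid N" and r: "r \<in> {0..T}" and N: "1 \<le> N"
  shows "(\<Sum>y\<in>grid N - {x}. jump_rate Q N \<beta> r x y * (y $ k - x $ k)\<^sup>2) \<le> D * D * K / real N"
proof -
  have "(\<Sum>y\<in>grid N - {x}. jump_rate Q N \<beta> r x y * (y $ k - x $ k)\<^sup>2)
      = (\<Sum>i\<in>UNIV. \<Sum>j\<in>UNIV. real N * x $ i * Q i j r (\<beta> r i x) x * ((x + jump N (i, j)) $ k - x $ k)\<^sup>2)"
    by (rule sum_jump_rate[OF x N]) simp
  also have "\<dots> \<le> (\<Sum>i\<in>(UNIV::'d set). \<Sum>j\<in>(UNIV::'d set). real N * K * (1 / real N)\<^sup>2)"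
  proof (rule sum_mono, rule sum_mono, rule mult_mono)
    fix i j
    note w = weighted_rate_bound[OF r feedback_in[OF \<beta> x r] grid_subset[OF x], of i i j]
    show "real N * x $ i * Q i j r (\<beta> r i x) x \<le> real N * K"
      unfolding mult.assoc by (rule mult_left_mono[OF w(2)]) simp
    have "\<bar>jump N (i, j) $ k\<bar> \<le> 1 / real N"
      by (simp add: jump_nth)
    then have "\<bar>jump N (i, j) $ k\<bar>\<^sup>2 \<le> (1 / real N)\<^sup>2"
      by (rule power_mono) simp
    then show "((x + jump N (i, j)) $ k - x $ k)\<^sup>2 \<le> (1 / real N)\<^sup>2"
      by simp
    show "0 \<le> real N * K"
      using K_pos by simp
  qed simp
  also have "\<dots> = D * D * K / real N"
    using N by (simp add: D_def power2_eq_square)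
  finally show ?thesis .
qed

lemma agent_chain_jump_chain:
  assumes \<beta>: "\<beta> \<in> feedback_controls T A N" and N: "1 \<le> N" and chain: "agent_chain T Q m0 N \<beta> P X"
  obtains p where "jump_chain P T (grid N) (jump_rate Q N \<beta>) X p (D * (D * (real N * K)))"
proof -
  have mjp: "markov_jump_process T (grid N) (jump_rate Q N \<beta>) P X"
    using chain unfolding agent_chain_def by (rule conjunct1)
  note mjp' = mjp[unfolded markov_jump_process_def]
  note P = mjp'[THEN conjunct1]
  note X = mjp'[THEN conjunct2, THEN conjunct1, THEN bspec]
  have right: "((\<lambda>s. X s w) \<longlongrightarrow> X t w) (at_right t)" if "w \<in> space P" "t \<in> {0..<T}" for w t
    by (rule mjp'[THEN conjunct2, THEN conjunct2, THEN conjunct1, THEN bspec, OF that(1), THEN conjunct1,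
          THEN bspec, OF that(2)])
  obtain p where p: "transition_probs T (grid N) (jump_rate Q N \<beta>) p \<and>
        (\<forall>s\<in>{0..T}. \<forall>t\<in>{s..T}. \<forall>I v. \<forall>x\<in>grid N. \<forall>y\<in>grid N. finite I \<and> I \<subseteq> {0..s} \<longrightarrow>
           measure P {\<omega> \<in> space P. (\<forall>r\<in>I. X r \<omega> = v r) \<and> X s \<omega> = x \<and> X t \<omega> = y}
           = measure P {\<omega> \<in> space P. (\<forall>r\<in>I. X r \<omega> = v r) \<and> X s \<omega> = x} * p s t x y)"
    using mjp'[THEN conjunct2, THEN conjunct2, THEN conjunct2] by (rule exE)
  have markov: "measure P {w \<in> space P. X s w = x \<and> X t w = y} = measure P {w \<in> space P. X s w = x} * p s t x y"
    if "s \<in> {0..T}" "t \<in> {s..T}" "x \<in> grid N" "y \<in> grid N" for s t x y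
    \<comment> \<open>With no earlier observation times, the Markov property reduces to its two-time
      form.\<close>
    using p[THEN conjunct2, rule_format, OF that, of "{}"] by simp
  have "jump_chain P T (grid N) (jump_rate Q N \<beta>) X p (D * (D * (real N * K)))"
  proof (intro jump_chain.intro P jump_chain_axioms.intro)
    show "(\<lambda>(r, w). X (clamp_time T r) w) \<in> borel \<Otimes>\<^sub>M P \<rightarrow>\<^sub>M count_space (grid N)"
      by (rule right_continuous_joint_measurable[OF T_nonneg finite_grid[OF N] X right])
  qed (rule T_nonneg finite_grid[OF N] jump_rate_measurable[OF \<beta>] jump_rate_bound[OF \<beta>] X p[THEN conjunct1]
      markov; assumption)+
  then show ?thesis
    using that by blast
qed

end


subsection \<open>Deviation of the chain from the mean field trajectory\<close>

text \<open>Used with weight sqrt N: a second moment of order 1/N gives a first moment of order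
  1/sqrt N, as Cauchy-Schwarz would.\<close>

lemma abs_le_weighted_square:
  fixes z a :: real
  assumes "0 < a"
  shows "\<bar>z\<bar> \<le> (a * z\<^sup>2 + 1 / a) / 2"
proof -
  have "0 \<le> a * (\<bar>z\<bar> - 1 / a)\<^sup>2"
    using assms by simp
  also have "\<dots> = a * z\<^sup>2 + 1 / a - 2 * \<bar>z\<bar>"
    using assms by (simp add: power2_diff power2_eq_square field_simps)
  finally show ?thesis by simp
qed

context jump_chain
begin

text \<open>The process compensated as in Dynkin's formula. Only its measurability, boundedness and
  moments at fixed times are used, no filtration.\<close>

definition mart :: "('s \<Rightarrow> real) \<Rightarrow> real \<Rightarrow> 'w \<Rightarrow> real" where
  "mart \<phi> t w = \<phi> (X t w) - \<phi> (X 0 w) - (LBINT r:{0..t}. genX \<phi> r w)"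

lemma expectation_one_time:
  assumes s: "s \<in> {0..T}"
  shows "expectation (\<lambda>w. \<psi> (X s w)) = (\<Sum>x\<in>S. measure P {w \<in> space P. X s w = x} * \<psi> x)"
proof -
  have ss: "s \<in> {s..T}"
    using s by auto
  have "(\<Sum>y\<in>S. p s s x y * \<psi> x) = \<psi> x" if "x \<in> S" for x
    using forward_generator[OF s ss that, of "\<lambda>_. \<psi> x"] by (simp add: set_integral_singleton)
  then show ?thesis
    unfolding expectation_two_times(1)[OF s ss, of "\<lambda>x y. \<psi> x"] by (intro sum.cong refl) simp
qed

lemma mart_joint: "(\<lambda>(t, w). mart \<phi> (clamp_time T t) w) \<in> borel_measurable (borel \<Otimes>\<^sub>M P)"
proof -
  have "(\<lambda>z. \<phi> (X (clamp_time T (fst z)) (snd z))) \<in> borel_measurable (borel \<Otimes>\<^sub>M P)"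
    using joint_measurable[of "\<lambda>r. \<phi>"] by (simp add: case_prod_beta')
  moreover have "(\<lambda>z. \<phi> (X 0 (snd z))) \<in> borel_measurable (borel \<Otimes>\<^sub>M P)"
    by (rule state_measurable_snd) (use T_nonneg in simp)
  moreover have "(\<lambda>z. LBINT r:{0..clamp_time T (fst z)}. genX \<phi> r (snd z)) \<in> borel_measurable (borel \<Otimes>\<^sub>M P)"
    using integral_genX_joint[OF measurable_const[of 0] measurable_clamp_time[of T], of \<phi>]
    by (simp add: case_prod_beta')
  ultimately show ?thesis
    unfolding mart_def case_prod_beta' by (intro borel_measurable_diff)
qed

lemma mart_bounded:
  obtains B where "\<And>t w. w \<in> space P \<Longrightarrow> \<bar>mart \<phi> (clamp_time T t) w\<bar> \<le> B"
proof -
  obtain b where b: "\<And>x. x \<in> S \<Longrightarrow> \<bar>\<phi> x\<bar> \<le> b" "0 \<le> b"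
    using bounded_on_S by blast
  obtain B where B: "\<And>r x. r \<in> {0..T} \<Longrightarrow> x \<in> S \<Longrightarrow> \<bar>generator S q \<phi> r x\<bar> \<le> B" "0 \<le> B"
    using generator_bounded by blast
  have "\<bar>mart \<phi> (clamp_time T t) w\<bar> \<le> 2 * b + B * T" if w: "w \<in> space P" for t w
  proof -
    have gB: "norm (genX \<phi> r w) \<le> B" for r
      unfolding genX_def real_norm_def by (rule B(1)[OF clamp_in X_in[OF clamp_in w]])
    have "norm (LBINT r:{0..clamp_time T t}. genX \<phi> r w) \<le> B * (clamp_time T t - 0)"
      by (rule norm_set_integral_le[OF set_integrable_bounded[OF path_measurable[OF genX_joint w] gB] gB])
        (use T_nonneg in simp)
    also have "\<dots> \<le> B * T"
      using B(2) T_nonneg by (intro mult_left_mono) auto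
    finally have "\<bar>LBINT r:{0..clamp_time T t}. genX \<phi> r w\<bar> \<le> B * T"
      by simp
    moreover have "\<bar>\<phi> (X (clamp_time T t) w)\<bar> \<le> b" "\<bar>\<phi> (X 0 w)\<bar> \<le> b"
      using b(1)[OF X_in[OF clamp_in w]] b(1)[OF X_in[OF _ w]] T_nonneg by auto
    ultimately show ?thesis
      unfolding mart_def by linarith
  qed
  then show ?thesis
    using that by blast
qed

lemma mart_abs_moment:
  assumes t: "t \<in> {0..T}" and a: "0 < a"
    and \<gamma>: "\<And>r x. r \<in> {0..T} \<Longrightarrow> x \<in> S \<Longrightarrow> (\<Sum>y\<in>S - {x}. q r x y * (\<phi> y - \<phi> x)\<^sup>2) \<le> \<gamma>" "0 \<le> \<gamma>"
  shows "integrable P (\<lambda>w. \<bar>mart \<phi> t w\<bar>)" "expectation (\<lambda>w. \<bar>mart \<phi> t w\<bar>) \<le> (a * (\<gamma> * T) + 1 / a) / 2"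
proof -
  note M = martingale_second_moment[OF t \<gamma>(1), folded mart_def]
  obtain B where B: "\<And>t w. w \<in> space P \<Longrightarrow> \<bar>mart \<phi> (clamp_time T t) w\<bar> \<le> B"
    using mart_bounded by blast
  have ct: "clamp_time T t = t"
    using t by simp
  show int: "integrable P (\<lambda>w. \<bar>mart \<phi> t w\<bar>)"
    using fubini_bounded(3)[OF mart_joint B, of t] unfolding ct by (intro integrable_abs) auto
  have "expectation (\<lambda>w. \<bar>mart \<phi> t w\<bar>) \<le> expectation (\<lambda>w. (a * (mart \<phi> t w)\<^sup>2 + 1 / a) / 2)"
    by (rule integral_mono[OF int]) (use M(2) abs_le_weighted_square[OF a] in auto)
  also have "\<dots> = (a * expectation (\<lambda>w. (mart \<phi> t w)\<^sup>2) + 1 / a) / 2"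
    using M(2) by (simp add: prob_space)
  also have "\<dots> \<le> (a * (\<gamma> * T) + 1 / a) / 2"
  proof -
    have "expectation (\<lambda>w. (mart \<phi> t w)\<^sup>2) \<le> \<gamma> * T"
      using M(1) t \<gamma>(2) by (auto intro: order_trans mult_left_mono)
    then have "a * expectation (\<lambda>w. (mart \<phi> t w)\<^sup>2) \<le> a * (\<gamma> * T)"
      using a by (intro mult_left_mono) auto
    then show ?thesis by simp
  qed
  finally show "expectation (\<lambda>w. \<bar>mart \<phi> t w\<bar>) \<le> (a * (\<gamma> * T) + 1 / a) / 2" .
qed

end

context mean_field
begin

text \<open>The exponential comes from Gronwall's inequality. It enters the running cost over time
  \<open>T\<close> and the terminal cost once more, whence \<open>T + 1\<close>.\<close>

definition path_factor :: real where
  "path_factor = (T + 1) * exp (L_drift * T)"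

lemma path_factor_nonneg: "0 \<le> path_factor"
  using T_nonneg by (simp add: path_factor_def)

text \<open>The deterministic core, for a single path: \<open>J\<close> stands for the size of the
  martingale, and nothing is assumed of the jumps of \<open>x\<close> beyond the bound
  \<open>xJ\<close>.\<close>

lemma path_cost_estimate:
  fixes x :: "real \<Rightarrow> real^'d"
  assumes a: "a \<in> mf_controls T A" and m0: "m0 \<in> prob_simplex"
    and x: "(\<lambda>r. x (clamp_time T r)) \<in> borel_measurable borel" "\<And>t. t \<in> {0..T} \<Longrightarrow> x t \<in> prob_simplex"
    and \<mu>: "mf_trajectory T Q m0 a \<mu>"
    and J: "(\<lambda>r. J (clamp_time T r)) \<in> borel_measurable borel" "\<And>r. \<bar>J (clamp_time T r)\<bar> \<le> B"
    and xJ: "\<And>t. t \<in> {0..T} \<Longrightarrow>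
      norm (x t - x 0 - (LBINT r:{0..t}. mf_drift Q a (clamp_time T r) (x (clamp_time T r)))) \<le> J t"
  shows "\<bar>((LBINT t:{0..T}. running_F f t (a t) (x t)) + terminal_G g (x T))
      - ((LBINT t:{0..T}. running_F f t (a t) (\<mu> t)) + terminal_G g (\<mu> T))\<bar>
    \<le> L * (path_factor * (norm (x 0 - m0) + L_drift * (LBINT r:{0..T}. J (clamp_time T r)))
      + (LBINT r:{0..T}. J (clamp_time T r)) + J T)"
proof -
  note T = T_nonneg
  define x' where "x' r = x (clamp_time T r)" for r
  define \<mu>' where "\<mu>' r = \<mu> (clamp_time T r)" for r
  define J' where "J' r = J (clamp_time T r)" for r
  have clamp: "clamp_time T r \<in> {0..T}" for r
    using T by simp
  have \<mu>_cont: "continuous_on {0..T} \<mu>" and \<mu>_in: "\<And>t. t \<in> {0..T} \<Longrightarrow> \<mu> t \<in> prob_simplex"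
    and \<mu>_eq: "\<And>t. t \<in> {0..T} \<Longrightarrow> \<mu> t = m0 + (LBINT s:{0..t}. mf_drift Q a s (\<mu> s))"
    using \<mu> unfolding mf_trajectory_def by blast+
  have x'_in: "x' r \<in> prob_simplex" and \<mu>'_in: "\<mu>' r \<in> prob_simplex" for r
    unfolding x'_def \<mu>'_def by (rule x(2)[OF clamp], rule \<mu>_in[OF clamp])
  have x'_meas: "x' \<in> borel_measurable borel"
    using x(1) unfolding x'_def .
  have \<mu>'_meas: "\<mu>' \<in> borel_measurable borel"
    unfolding \<mu>'_def
    by (intro borel_measurable_continuous_onI continuous_on_compose2[OF \<mu>_cont] continuous_on_clamp_time)
      (use T in auto)
  define V where "V s = mf_drift Q a (clamp_time T s) (x' s)" for s
  define W where "W s = mf_drift Q a (clamp_time T s) (\<mu>' s)" for s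
  have V_meas: "V \<in> borel_measurable borel" and W_meas: "W \<in> borel_measurable borel"
    unfolding V_def W_def by (rule drift_measurable[OF a x'_meas x'_in], rule drift_measurable[OF a \<mu>'_meas \<mu>'_in])
  have V_le: "norm (V s) \<le> D * (D * K)" and W_le: "norm (W s) \<le> D * (D * K)" for s
    unfolding V_def W_def
    by (rule drift_bound[where \<alpha> = a, OF clamp control_in[OF a clamp] x'_in],
        rule drift_bound[where \<alpha> = a, OF clamp control_in[OF a clamp] \<mu>'_in])
  have V_int: "set_integrable lborel {s..t} V" and W_int: "set_integrable lborel {s..t} W" for s t
    by (rule set_integrable_bounded[OF V_meas V_le], rule set_integrable_bounded[OF W_meas W_le])
  \<comment> \<open>A path with jumps is not continuous, so Gronwall's inequality is applied to the
    part without \<open>J\<close>, which is continuous. The difference \<open>x - \<mu>\<close> is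
    recovered by adding \<open>J\<close>.\<close>
  define w where "w t = x 0 + (LBINT s:{0..t}. V s) - \<mu> t" for t
  define u where "u t = norm (w t)" for t
  have \<mu>_W: "\<mu> t = m0 + (LBINT s:{0..t}. W s)" if t: "t \<in> {0..T}" for t
  proof -
    have "(LBINT s:{0..t}. mf_drift Q a s (\<mu> s)) = (LBINT s:{0..t}. W s)"
      by (rule set_lebesgue_integral_cong) (use t in \<open>auto simp: W_def \<mu>'_def\<close>)
    then show ?thesis
      using \<mu>_eq[OF t] by simp
  qed
  have diff: "norm (x t - \<mu> t) \<le> u t + J t" if t: "t \<in> {0..T}" for t
  proof -
    have "x t - \<mu> t = w t + (x t - x 0 - (LBINT s:{0..t}. V s))"
      by (simp add: w_def)
    then have "norm (x t - \<mu> t) \<le> norm (w t) + norm (x t - x 0 - (LBINT s:{0..t}. V s))"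
      by (metis norm_triangle_ineq)
    then show ?thesis
      using xJ[OF t] unfolding u_def V_def x'_def by linarith
  qed
  have J'_nonneg: "0 \<le> J' r" for r
    using order_trans[OF norm_ge_zero xJ[OF clamp]] unfolding J'_def .
  have J'_int: "set_integrable lborel {s..t} J'" for s t
    unfolding J'_def by (rule set_integrable_bounded[OF J(1), of B]) (use J(2) in simp)
  have u_cont: "continuous_on {0..T} u"
    unfolding u_def w_def
    by (intro continuous_intros \<mu>_cont continuous_on_subset[OF continuous_on_set_integral[OF V_meas V_le]])
      auto
  have u_int: "set_integrable lborel {0..t} u" if "t \<in> {0..T}" for t
    by (intro borel_integrable_atLeastAtMost' continuous_on_subset[OF u_cont]) (use that in auto)
  define IJ where "IJ = (LBINT r:{0..T}. J' r)"
  have IJ_le: "(LBINT r:{0..t}. J' r) \<le> IJ" if t: "t \<in> {0..T}" for t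
  proof -
    have "IJ = (LBINT r:{0..t}. J' r) + (LBINT r:{t..T}. J' r)"
      unfolding IJ_def by (rule set_integral_combine) (use t J'_int in auto)
    moreover have "0 \<le> (LBINT r:{t..T}. J' r)"
      unfolding set_lebesgue_integral_def by (rule Bochner_Integration.integral_nonneg) (simp add: J'_nonneg)
    ultimately show ?thesis by simp
  qed
  define c where "c = norm (x 0 - m0) + L_drift * IJ"
  have IJ_nonneg: "0 \<le> IJ"
    unfolding IJ_def set_lebesgue_integral_def by (rule Bochner_Integration.integral_nonneg) (simp add: J'_nonneg)
  have c_nonneg: "0 \<le> c"
    unfolding c_def using L_drift_nonneg IJ_nonneg by simp
  have step: "u t \<le> c + L_drift * (LBINT s:{0..t}. u s)" if t: "t \<in> {0..T}" for t
  proof -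
    have t0: "0 \<le> t" "t \<le> T"
      using t by auto
    have VW: "norm (V s - W s) \<le> L_drift * (u s + J' s)" if s: "s \<in> {0..t}" for s
    proof -
      have s': "s \<in> {0..T}" "clamp_time T s = s"
        using s t0 by auto
      have "norm (V s - W s) \<le> L_drift * norm (x' s - \<mu>' s)"
        unfolding V_def W_def by (rule drift_lip[where \<alpha> = a, OF clamp control_in[OF a clamp] x'_in \<mu>'_in])
      also have "\<dots> \<le> L_drift * (u s + J' s)"
        using diff[OF s'(1)] by (intro mult_left_mono L_drift_nonneg) (simp add: x'_def \<mu>'_def J'_def s'(2))
      finally show ?thesis .
    qed
    have "w t = (x 0 - m0) + (LBINT s:{0..t}. V s - W s)"
      using \<mu>_W[OF t] by (simp add: w_def set_integral_diff(2)[OF V_int W_int])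
    then have "u t \<le> norm (x 0 - m0) + norm (LBINT s:{0..t}. V s - W s)"
      unfolding u_def by (metis norm_triangle_ineq)
    moreover have "norm (LBINT s:{0..t}. V s - W s) \<le> (LBINT s:{0..t}. norm (V s - W s))"
      by (rule set_integral_norm_bound[OF set_integral_diff(1)[OF V_int W_int]])
    moreover have "(LBINT s:{0..t}. norm (V s - W s)) \<le> (LBINT s:{0..t}. L_drift * (u s + J' s))"
      by (rule set_integral_mono[OF set_integrable_norm[OF set_integral_diff(1)[OF V_int W_int]] _ VW])
        (intro set_integrable_mult_right set_integral_add(1) u_int[OF t] J'_int)
    moreover have "(LBINT s:{0..t}. L_drift * (u s + J' s))
        = L_drift * (LBINT s:{0..t}. u s) + L_drift * (LBINT s:{0..t}. J' s)"
      by (simp add: set_integral_add(2)[OF u_int[OF t] J'_int]) (simp add: distrib_left)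
    moreover have "L_drift * (LBINT s:{0..t}. J' s) \<le> L_drift * IJ"
      by (rule mult_left_mono[OF IJ_le[OF t] L_drift_nonneg])
    ultimately show ?thesis
      unfolding c_def by linarith
  qed
  define E where "E = c * exp (L_drift * T)"
  have u_le: "u t \<le> E" if t: "t \<in> {0..T}" for t
  proof -
    have "u t \<le> c * exp (L_drift * t)"
      by (rule gronwall_constant[OF u_cont L_drift_nonneg step t])
    also have "\<dots> \<le> E"
      unfolding E_def using t L_drift_nonneg by (intro mult_left_mono c_nonneg) (auto intro: mult_left_mono)
    finally show ?thesis .
  qed
  define Fx where "Fx s = running_F f (clamp_time T s) (a (clamp_time T s)) (x' s)" for s
  define Fm where "Fm s = running_F f (clamp_time T s) (a (clamp_time T s)) (\<mu>' s)" for s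
  have a_meas: "(\<lambda>s. a (clamp_time T s)) \<in> borel \<rightarrow>\<^sub>M restrict_space borel (action_vectors A)"
    using a measurable_compose[OF measurable_clamp_time_restrict[OF T]] by (simp add: mf_controls_def)
  have Fx_meas: "Fx \<in> borel_measurable borel"
    unfolding Fx_def by (rule F_measurable[OF a_meas measurable_clamp_time clamp x'_meas x'_in])
  have Fm_meas: "Fm \<in> borel_measurable borel"
    unfolding Fm_def by (rule F_measurable[OF a_meas measurable_clamp_time clamp \<mu>'_meas \<mu>'_in])
  have Fx_int: "set_integrable lborel {0..T} Fx"
    by (rule set_integrable_bounded[OF Fx_meas, of F_max])
      (simp only: Fx_def real_norm_def, rule F_bound[OF clamp control_in[OF a clamp] x'_in])
  have Fm_int: "set_integrable lborel {0..T} Fm"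
    by (rule set_integrable_bounded[OF Fm_meas, of F_max])
      (simp only: Fm_def real_norm_def, rule F_bound[OF clamp control_in[OF a clamp] \<mu>'_in])
  have F_diff: "norm (Fx s - Fm s) \<le> L * (E + J' s)" if s: "s \<in> {0..T}" for s
  proof -
    have "norm (Fx s - Fm s) \<le> L * norm (x' s - \<mu>' s)"
      unfolding Fx_def Fm_def real_norm_def by (rule F_lip[OF clamp control_in[OF a clamp] x'_in \<mu>'_in])
    also have "\<dots> \<le> L * (E + J' s)"
      using diff[OF s] u_le[OF s] s by (intro mult_left_mono L_nonneg) (simp add: x'_def \<mu>'_def J'_def)
    finally show ?thesis .
  qed
  have E_int: "set_integrable lborel {0..T} (\<lambda>_. E)"
    by (intro borel_integrable_atLeastAtMost') auto
  have "\<bar>(LBINT s:{0..T}. Fx s) - (LBINT s:{0..T}. Fm s)\<bar> = norm (LBINT s:{0..T}. Fx s - Fm s)"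
    by (simp add: set_integral_diff(2)[OF Fx_int Fm_int])
  also have "\<dots> \<le> (LBINT s:{0..T}. norm (Fx s - Fm s))"
    by (rule set_integral_norm_bound[OF set_integral_diff(1)[OF Fx_int Fm_int]])
  also have "\<dots> \<le> (LBINT s:{0..T}. L * (E + J' s))"
    by (rule set_integral_mono[OF set_integrable_norm[OF set_integral_diff(1)[OF Fx_int Fm_int]] _ F_diff])
      (intro set_integrable_mult_right set_integral_add(1) E_int J'_int)
  also have "\<dots> = L * (E * T + IJ)"
    using T by (simp add: set_integral_add(2)[OF E_int J'_int] IJ_def) (simp add: set_lebesgue_integral_def)
  finally have run: "\<bar>(LBINT s:{0..T}. Fx s) - (LBINT s:{0..T}. Fm s)\<bar> \<le> L * (E * T + IJ)" .
  have TT: "T \<in> {0..T}"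
    using T by simp
  have "\<bar>terminal_G g (x T) - terminal_G g (\<mu> T)\<bar> \<le> L * norm (x T - \<mu> T)"
    by (rule G_lip[OF x(2)[OF TT] \<mu>_in[OF TT]])
  also have "\<dots> \<le> L * (E + J T)"
    using diff[OF TT] u_le[OF TT] by (intro mult_left_mono L_nonneg) simp
  finally have terminal: "\<bar>terminal_G g (x T) - terminal_G g (\<mu> T)\<bar> \<le> L * (E + J T)" .
  have Fx_eq: "(LBINT t:{0..T}. running_F f t (a t) (x t)) = (LBINT s:{0..T}. Fx s)"
    by (rule set_lebesgue_integral_cong) (auto simp: Fx_def x'_def)
  have Fm_eq: "(LBINT t:{0..T}. running_F f t (a t) (\<mu> t)) = (LBINT s:{0..T}. Fm s)"
    by (rule set_lebesgue_integral_cong) (auto simp: Fm_def \<mu>'_def)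
  have "L * (path_factor * c + IJ + J T) = L * (E * T + IJ) + L * (E + J T)"
    unfolding path_factor_def E_def by (simp add: algebra_simps)
  then show ?thesis
    using run terminal unfolding Fx_eq Fm_eq c_def IJ_def J'_def by linarith
qed

end


subsection \<open>Comparison of the costs\<close>

context mean_field
begin

text \<open>With weight sqrt N and \<open>\<gamma> = D * D * K / N\<close>, each coordinate
  contributes \<open>(D * D * K * T + 1) / 2\<close> over sqrt N to the first moment of the
  martingale; there are \<open>D\<close> coordinates.\<close>

definition mart_const :: real where
  "mart_const = D * ((D * D * K * T + 1) / 2)"

text \<open>The path estimate in expectation, times sqrt N: the initial deviation contributes
  \<open>D\<close>, the martingale \<open>mart_const\<close> at each time.\<close>

definition cost_const :: real where
  "cost_const = L * (path_factor * (D + L_drift * (mart_const * T)) + mart_const * T + mart_const)"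

text \<open>Instead of showing that the initial law lives on the grid, the sum is enlarged by the
  support of that law, after which it is the full expectation.\<close>

lemma initial_deviation:
  fixes m0 :: "real^'d"
  assumes m0: "m0 \<in> prob_simplex" and N: "1 \<le> N"
  shows "(\<Sum>x\<in>grid N. pmf (initial_law N m0) x * (x $ k - m0 $ k)\<^sup>2) \<le> 1 / real N"
proof -
  let ?I = "initial_law N m0"
  have "(\<Sum>x\<in>grid N. pmf ?I x * (x $ k - m0 $ k)\<^sup>2)
      \<le> (\<Sum>x\<in>grid N \<union> set_pmf ?I. pmf ?I x * (x $ k - m0 $ k)\<^sup>2)"
    using finite_grid[OF N] finite_set_initial_law[of N m0] by (intro sum_mono2) auto
  also have "\<dots> = measure_pmf.expectation ?I (\<lambda>x. (x $ k - m0 $ k)\<^sup>2)"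
    using finite_grid[OF N, where 'd = 'd] finite_set_initial_law[of N m0]
    by (subst integral_measure_pmf[of "grid N \<union> set_pmf ?I"]) auto
  also have "\<dots> \<le> 1 / real N"
    by (rule initial_law_variance[OF m0 N])
  finally show ?thesis .
qed

text \<open>\<open>c\<close> and \<open>\<Delta>\<close> are delivered as functions on the
  probability space so that the comparison can be made path by path, before taking
  expectations.\<close>

lemma agent_cost_estimate:
  fixes \<beta> :: "('a, 'd) feedback"
  assumes m0: "m0 \<in> prob_simplex" and N: "1 \<le> N" and \<beta>: "\<beta> \<in> feedback_controls T A N"
    and chain: "agent_chain T Q m0 N \<beta> P X"
  obtains c \<Delta> where "prob_space P" "integrable P c" "integrable P \<Delta>"
    "agent_cost T f g \<beta> P X = (LINT w|P. c w)" "(LINT w|P. \<Delta> w) \<le> cost_const / sqrt (real N)"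
    "\<And>w. w \<in> space P \<Longrightarrow> (\<lambda>t. feedback_vec \<beta> t (X t w)) \<in> mf_controls T A"
    "\<And>w. w \<in> space P \<Longrightarrow> \<bar>c w - mf_cost T Q f g m0 (\<lambda>t. feedback_vec \<beta> t (X t w))\<bar> \<le> \<Delta> w"
proof -
  let ?S = "grid N :: (real^'d) set" and ?q = "jump_rate Q N \<beta>" and ?\<kappa> = "D * (D * (real N * K))"
  obtain p where "jump_chain P T ?S ?q X p ?\<kappa>"
    by (rule agent_chain_jump_chain[OF \<beta> N chain])
  then interpret jump_chain P T ?S ?q X p ?\<kappa> .
  define s where "s = sqrt (real N)"
  have s: "0 < s" "s * s = real N"
    using N by (auto simp: s_def)
  have TT: "T \<in> {0..T}" and zero: "0 \<in> {0..T}"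
    using T_nonneg by auto
  have clamp: "clamp_time T r \<in> {0..T}" for r
    using T_nonneg by simp
  have X_grid: "X t w \<in> ?S" and X_simplex: "X t w \<in> prob_simplex" if "w \<in> space P" "t \<in> {0..T}" for t w
    using X_in[OF that(2,1)] grid_subset by auto
  let ?\<phi> = "\<lambda>k (y :: real^'d). y $ k"
  have \<gamma>: "(\<Sum>y\<in>?S - {x}. ?q r x y * (y $ k - x $ k)\<^sup>2) \<le> D * D * K / real N"
    if "r \<in> {0..T}" "x \<in> ?S" for r x k
    by (rule square_jump_bound[OF \<beta> that(2,1) N])
  have \<gamma>0: "0 \<le> D * D * K / real N"
    using D_ge_1 K_pos by simp

  \<comment> \<open>Sums of absolute coordinates dominate the Euclidean norm and reduce the vector
    case to real test functions, the coordinates.\<close>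
  define J where "J t w = (\<Sum>k\<in>UNIV. \<bar>mart (?\<phi> k) t w\<bar>)" for t w
  define I where "I w = (\<Sum>k\<in>UNIV. \<bar>X 0 w $ k - m0 $ k\<bar>)" for w
  define \<Delta> where "\<Delta> w = L * (path_factor * (I w + L_drift * (LBINT r:{0..T}. J (clamp_time T r) w))
      + (LBINT r:{0..T}. J (clamp_time T r) w) + J T w)" for w

  have "\<exists>B. \<forall>t w. w \<in> space P \<longrightarrow> \<bar>mart (?\<phi> k) (clamp_time T t) w\<bar> \<le> B" for k
    using mart_bounded[of "?\<phi> k"] by metis
  then obtain B where B: "\<And>k t w. w \<in> space P \<Longrightarrow> \<bar>mart (?\<phi> k) (clamp_time T t) w\<bar> \<le> B k"
    by metis
  have J_joint: "(\<lambda>(r, w). J (clamp_time T r) w) \<in> borel_measurable (borel \<Otimes>\<^sub>M P)"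
  proof -
    have [measurable]: "(\<lambda>z. mart (?\<phi> k) (clamp_time T (fst z)) (snd z)) \<in> borel_measurable (borel \<Otimes>\<^sub>M P)" for k
      using mart_joint[of "?\<phi> k"] by (simp add: case_prod_beta')
    show ?thesis
      unfolding J_def case_prod_beta' by measurable
  qed
  have J_B: "\<bar>J (clamp_time T r) w\<bar> \<le> (\<Sum>k\<in>UNIV. B k)" if "w \<in> space P" for r w
    unfolding J_def by (subst abs_of_nonneg) (auto intro!: sum_nonneg sum_mono B[OF that])
  note J_fub = fubini_bounded[OF J_joint J_B]
  have EJ: "expectation (J t) \<le> mart_const / s" and J_int: "integrable P (J t)" if t: "t \<in> {0..T}" for t
  proof -
    note M = mart_abs_moment[OF t s(1) \<gamma> \<gamma>0]
    show "integrable P (J t)"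
      unfolding J_def by (intro Bochner_Integration.integrable_sum M(1))
    have "expectation (J t) = (\<Sum>k\<in>UNIV. expectation (\<lambda>w. \<bar>mart (?\<phi> k) t w\<bar>))"
      unfolding J_def by (rule Bochner_Integration.integral_sum) (rule M(1))
    also have "\<dots> \<le> (\<Sum>k\<in>(UNIV::'d set). (s * (D * D * K / real N * T) + 1 / s) / 2)"
      by (rule sum_mono) (rule M(2))
    also have "\<dots> = mart_const / s"
      using s unfolding s(2)[symmetric] by (simp add: D_def mart_const_def field_simps)
    finally show "expectation (J t) \<le> mart_const / s" .
  qed
  have int_IJ: "integrable P (\<lambda>w. LBINT r:{0..T}. J (clamp_time T r) w)"
    by (rule J_fub(4))
  have E_IJ: "expectation (\<lambda>w. LBINT r:{0..T}. J (clamp_time T r) w) \<le> mart_const / s * T"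
  proof -
    have "expectation (\<lambda>w. LBINT r:{0..T}. J (clamp_time T r) w) = (LBINT r:{0..T}. expectation (J (clamp_time T r)))"
      by (rule J_fub(5))
    also have "\<dots> \<le> (LBINT r:{0..T}. mart_const / s)"
    proof (rule set_integral_mono)
      show "set_integrable lborel {0..T} (\<lambda>r. expectation (J (clamp_time T r)))"
        by (rule set_integrable_bounded[OF J_fub(1), where B = "\<Sum>k\<in>UNIV. B k"]) (use J_fub(2) in auto)
      show "set_integrable lborel {0..T} (\<lambda>r. mart_const / s)"
        by (intro borel_integrable_atLeastAtMost') auto
    qed (rule EJ[OF clamp])
    also have "\<dots> = mart_const / s * T"
      using T_nonneg by (simp add: set_lebesgue_integral_def)
    finally show ?thesis .
  qed
  have init: "measure P {w \<in> space P. X 0 w = x} = pmf (initial_law N m0) x" if "x \<in> ?S" for x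
    using chain that unfolding agent_chain_def by (elim conjE) (erule (1) bspec)
  have I_int: "integrable P I" and EI: "expectation I \<le> D / s"
  proof -
    have int1: "integrable P (\<lambda>w. \<psi> (X 0 w))" for \<psi> :: "real^'d \<Rightarrow> real"
      using expectation_two_times(2)[OF zero zero, of "\<lambda>x y. \<psi> x"] .
    have int: "integrable P (\<lambda>w. \<bar>X 0 w $ k - m0 $ k\<bar>)" for k
      by (rule int1[of "\<lambda>x. \<bar>x $ k - m0 $ k\<bar>"])
    then show "integrable P I"
      unfolding I_def by (intro Bochner_Integration.integrable_sum)
    have Ek: "expectation (\<lambda>w. \<bar>X 0 w $ k - m0 $ k\<bar>) \<le> 1 / s" for k
    proof -
      have int2: "integrable P (\<lambda>w. (X 0 w $ k - m0 $ k)\<^sup>2)"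
        by (rule int1[of "\<lambda>x. (x $ k - m0 $ k)\<^sup>2"])
      have "expectation (\<lambda>w. \<bar>X 0 w $ k - m0 $ k\<bar>) \<le> expectation (\<lambda>w. (s * (X 0 w $ k - m0 $ k)\<^sup>2 + 1 / s) / 2)"
        by (rule integral_mono[OF int]) (use int2 abs_le_weighted_square[OF s(1)] in auto)
      also have "\<dots> = (s * expectation (\<lambda>w. (X 0 w $ k - m0 $ k)\<^sup>2) + 1 / s) / 2"
        using int2 by (simp add: prob_space)
      also have "expectation (\<lambda>w. (X 0 w $ k - m0 $ k)\<^sup>2) = (\<Sum>x\<in>?S. pmf (initial_law N m0) x * (x $ k - m0 $ k)\<^sup>2)"
        unfolding expectation_one_time[OF zero, of "\<lambda>x. (x $ k - m0 $ k)\<^sup>2"]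
        by (intro sum.cong refl) (simp add: init)
      also have "(s * (\<Sum>x\<in>?S. pmf (initial_law N m0) x * (x $ k - m0 $ k)\<^sup>2) + 1 / s) / 2
          \<le> (s * (1 / real N) + 1 / s) / 2"
        using s(1) by (intro divide_right_mono add_right_mono mult_left_mono initial_deviation[OF m0 N]) auto
      also have "\<dots> = 1 / s"
        using s unfolding s(2)[symmetric] by (simp add: field_simps)
      finally show ?thesis .
    qed
    have "expectation I = (\<Sum>k\<in>UNIV. expectation (\<lambda>w. \<bar>X 0 w $ k - m0 $ k\<bar>))"
      unfolding I_def by (rule Bochner_Integration.integral_sum) (rule int)
    also have "\<dots> \<le> (\<Sum>k\<in>(UNIV::'d set). 1 / s)"
      by (rule sum_mono) (rule Ek)
    also have "\<dots> = D / s"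
      by (simp add: D_def)
    finally show "expectation I \<le> D / s" .
  qed
  have \<Delta>_int: "integrable P \<Delta>"
    unfolding \<Delta>_def
    by (intro integrable_mult_right Bochner_Integration.integrable_add I_int int_IJ J_int[OF TT])
  have E\<Delta>: "expectation \<Delta> \<le> cost_const / s"
  proof -
    have "expectation \<Delta> = L * (path_factor * (expectation I
        + L_drift * expectation (\<lambda>w. LBINT r:{0..T}. J (clamp_time T r) w))
        + expectation (\<lambda>w. LBINT r:{0..T}. J (clamp_time T r) w) + expectation (J T))"
      unfolding \<Delta>_def using I_int int_IJ J_int[OF TT] by simp
    also have "\<dots> \<le> L * (path_factor * (D / s + L_drift * (mart_const / s * T)) + mart_const / s * T + mart_const / s)"
      by (intro mult_left_mono add_mono EI E_IJ EJ TT L_nonneg path_factor_nonneg L_drift_nonneg)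
    also have "\<dots> = cost_const / s"
      using s(1) by (simp add: cost_const_def field_simps)
    finally show ?thesis .
  qed

  define Fc where "Fc r w = running_F f (clamp_time T r) (feedback_vec \<beta> (clamp_time T r) (X (clamp_time T r) w))
      (X (clamp_time T r) w)" for r w
  define c where "c w = (LBINT r:{0..T}. Fc r w) + terminal_G g (X T w)" for w
  have Fc_joint: "(\<lambda>(r, w). Fc r w) \<in> borel_measurable (borel \<Otimes>\<^sub>M P)"
    unfolding Fc_def
  proof (rule joint_measurable[where k = "\<lambda>r x. running_F f (clamp_time T r) (feedback_vec \<beta> (clamp_time T r) x) x"])
    fix x assume x: "x \<in> ?S"
    have "(\<lambda>r. feedback_vec \<beta> (clamp_time T r) x) \<in> borel \<rightarrow>\<^sub>M restrict_space borel (action_vectors A)"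
      by (rule measurable_action_vectors[OF compact_A])
        (simp add: feedback_vec_def feedback_clamp_measurable[OF \<beta> x])
    then show "(\<lambda>r. running_F f (clamp_time T r) (feedback_vec \<beta> (clamp_time T r) x) x) \<in> borel_measurable borel"
      by (rule F_measurable) (use clamp grid_subset[OF x] in auto)
  qed
  have Fc_le: "\<bar>Fc r w\<bar> \<le> F_max" if w: "w \<in> space P" for r w
    unfolding Fc_def by (rule F_bound[OF clamp feedback_vec_in[OF \<beta> X_grid[OF w clamp] clamp] X_simplex[OF w clamp]])
  note Fc_fub = fubini_bounded[OF Fc_joint Fc_le]
  have G_int: "integrable P (\<lambda>w. terminal_G g (X T w))"
    using expectation_two_times(2)[OF TT, of T "\<lambda>x y. terminal_G g x"] by simp
  have c_int: "integrable P c"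
    unfolding c_def by (intro Bochner_Integration.integrable_add G_int Fc_fub(4))
  have c_path: "c w = (LBINT t:{0..T}. running_F f t (feedback_vec \<beta> t (X t w)) (X t w)) + terminal_G g (X T w)" for w
    unfolding c_def by (intro arg_cong2[where f = "(+)"] refl set_lebesgue_integral_cong) (auto simp: Fc_def)
  have cost_eq: "agent_cost T f g \<beta> P X = expectation c"
    unfolding agent_cost_def c_path running_F_def terminal_G_def feedback_vec_def by simp

  \<comment> \<open>The path is measurable in time with finitely many values, so the control is
    glued from the measurable functions of time given by the feedback at each grid point.\<close>
  have control: "(\<lambda>t. feedback_vec \<beta> t (X t w)) \<in> mf_controls T A" if w: "w \<in> space P" for w
    unfolding mf_controls_def
  proof (rule measurable_action_vectors[OF compact_A])
    fix i
    have "(\<lambda>r. X (clamp_time T r) w) \<in> borel \<rightarrow>\<^sub>M count_space ?S"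
      using measurable_compose[OF measurable_Pair2'[OF w, of borel] X_joint] by simp
    then have "(\<lambda>r. X (clamp_time T r) w) \<in> restrict_space borel {0..T} \<rightarrow>\<^sub>M count_space ?S"
      by (rule measurable_restrict_space1)
    then have path: "(\<lambda>r. X r w) \<in> restrict_space borel {0..T} \<rightarrow>\<^sub>M count_space ?S"
      by (rule iffD1[OF measurable_cong, rotated]) (auto simp: space_restrict_space)
    have "(\<lambda>t. \<beta> t i (X t w)) \<in> restrict_space borel {0..T} \<rightarrow>\<^sub>M restrict_space borel A"
    proof (rule measurable_compose_countable'[where f = "\<lambda>x t. \<beta> t i x" and g = "\<lambda>t. X t w" and I = ?S])
      show "(\<lambda>t. \<beta> t i x) \<in> restrict_space borel {0..T} \<rightarrow>\<^sub>M restrict_space borel A" if "x \<in> ?S" for x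
        using \<beta> that by (simp add: feedback_controls_def)
    qed (rule path, rule countable_finite[OF finite_grid[OF N]])
    then show "(\<lambda>t. feedback_vec \<beta> t (X t w) $ i) \<in> restrict_space borel {0..T} \<rightarrow>\<^sub>M restrict_space borel A"
      by (simp add: feedback_vec_def)
  qed
  have estimate: "\<bar>c w - mf_cost T Q f g m0 (\<lambda>t. feedback_vec \<beta> t (X t w))\<bar> \<le> \<Delta> w" if w: "w \<in> space P" for w
  proof -
    let ?a = "\<lambda>t. feedback_vec \<beta> t (X t w)"
    define \<mu> where "\<mu> = (SOME \<mu>. mf_trajectory T Q m0 ?a \<mu>)"
    have \<mu>: "mf_trajectory T Q m0 ?a \<mu>"
      unfolding \<mu>_def using mf_trajectory_exists[OF control[OF w] m0] by (metis someI_ex)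
    define x where "x t = X t w" for t
    have x_meas: "(\<lambda>r. x (clamp_time T r)) \<in> borel_measurable borel"
    proof -
      have "(\<lambda>r. X (clamp_time T r) w) \<in> borel \<rightarrow>\<^sub>M count_space ?S"
        using measurable_compose[OF measurable_Pair2'[OF w, of borel] X_joint] by simp
      then have "(\<lambda>r. (\<lambda>y. y) (X (clamp_time T r) w)) \<in> borel_measurable borel"
        by (rule measurable_compose) simp
      then show ?thesis
        by (simp add: x_def)
    qed
    have x_in: "x t \<in> prob_simplex" if "t \<in> {0..T}" for t
      unfolding x_def by (rule X_simplex[OF w that])
    define V where "V r = mf_drift Q ?a (clamp_time T r) (x (clamp_time T r))" for r
    have V_int: "set_integrable lborel {0..t} V" for t
    proof (rule set_integrable_bounded)
      show "V \<in> borel_measurable borel"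
        unfolding V_def by (rule drift_measurable[OF control[OF w] x_meas x_in[OF clamp]])
      show "norm (V r) \<le> D * (D * K)" for r
        unfolding V_def by (rule drift_bound[where \<alpha> = ?a, OF clamp control_in[OF control[OF w] clamp] x_in[OF clamp]])
    qed
    \<comment> \<open>The mean field drift at the path control is the generator along the path, so
      the deviation bounded by \<open>J\<close> is the vector of the compensated
      coordinates.\<close>
    have V_nth: "V r $ k = genX (?\<phi> k) r w" for r k
      unfolding V_def genX_def x_def
      by (rule generator_coordinate[where \<alpha> = ?a, OF X_grid[OF w clamp] N refl, symmetric])
    have int_nth: "(LBINT r:{0..t}. V r) $ k = (LBINT r:{0..t}. genX (?\<phi> k) r w)" for t k
    proof -
      have "(LBINT r:{0..t}. V r) $ k = (\<integral>r. (indicator {0..t} r *\<^sub>R V r) $ k \<partial>lborel)"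
        unfolding set_lebesgue_integral_def
        using integral_bounded_linear[OF bounded_linear_vec_nth[of k] V_int[of t, unfolded set_integrable_def]]
        by simp
      then show ?thesis
        by (simp add: set_lebesgue_integral_def V_nth)
    qed
    have J_le: "norm (x t - x 0 - (LBINT r:{0..t}. V r)) \<le> J t w" for t
    proof -
      have "norm (x t - x 0 - (LBINT r:{0..t}. V r)) \<le> (\<Sum>k\<in>UNIV. \<bar>(x t - x 0 - (LBINT r:{0..t}. V r)) $ k\<bar>)"
        by (rule norm_le_l1_cart)
      also have "\<dots> = J t w"
        unfolding J_def mart_def x_def by (simp add: int_nth)
      finally show ?thesis .
    qed
    have J_path: "(\<lambda>r. J (clamp_time T r) w) \<in> borel_measurable borel"
      by (rule path_measurable[OF J_joint w])
    have "\<bar>c w - mf_cost T Q f g m0 ?a\<bar>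
        \<le> L * (path_factor * (norm (x 0 - m0) + L_drift * (LBINT r:{0..T}. J (clamp_time T r) w))
          + (LBINT r:{0..T}. J (clamp_time T r) w) + J T w)"
      using path_cost_estimate[OF control[OF w] m0 x_meas x_in \<mu> J_path J_B[OF w] J_le[unfolded V_def]]
      unfolding c_path mf_cost_def Let_def \<mu>_def[symmetric] x_def .
    also have "\<dots> \<le> \<Delta> w"
    proof -
      have "norm (x 0 - m0) \<le> I w"
        using norm_le_l1_cart[of "x 0 - m0"] by (simp add: I_def x_def)
      then show ?thesis
        unfolding \<Delta>_def
        by (intro mult_left_mono add_right_mono L_nonneg path_factor_nonneg)
    qed
    finally show ?thesis .
  qed
  show ?thesis
    by (rule that[OF prob_space_axioms c_int \<Delta>_int cost_eq E\<Delta>[unfolded s_def] control estimate])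
qed

text \<open>A real infimum can serve as a lower bound only over a set bounded below. The factor 2
  bounds the diameter of the simplex.\<close>

lemma mf_cost_bounded_below:
  assumes m0: "m0 \<in> prob_simplex" and \<alpha>: "\<alpha> \<in> mf_controls T A"
  shows "terminal_G g m0 - L * 2 - F_max * T \<le> mf_cost T Q f g m0 \<alpha>"
proof -
  define \<mu> where "\<mu> = (SOME \<mu>. mf_trajectory T Q m0 \<alpha> \<mu>)"
  have \<mu>: "mf_trajectory T Q m0 \<alpha> \<mu>"
    unfolding \<mu>_def using mf_trajectory_exists[OF \<alpha> m0] by (metis someI_ex)
  have \<mu>_cont: "continuous_on {0..T} \<mu>" and \<mu>_in: "\<And>t. t \<in> {0..T} \<Longrightarrow> \<mu> t \<in> prob_simplex"
    using \<mu> unfolding mf_trajectory_def by blast+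
  have clamp: "clamp_time T r \<in> {0..T}" for r
    using T_nonneg by simp
  define F where "F s = running_F f (clamp_time T s) (\<alpha> (clamp_time T s)) (\<mu> (clamp_time T s))" for s
  have F_meas: "F \<in> borel_measurable borel"
    unfolding F_def
  proof (rule F_measurable)
    show "(\<lambda>s. \<alpha> (clamp_time T s)) \<in> borel \<rightarrow>\<^sub>M restrict_space borel (action_vectors A)"
      using \<alpha> measurable_compose[OF measurable_clamp_time_restrict[OF T_nonneg]] by (simp add: mf_controls_def)
    show "(\<lambda>s. \<mu> (clamp_time T s)) \<in> borel_measurable borel"
      by (intro borel_measurable_continuous_onI continuous_on_compose2[OF \<mu>_cont] continuous_on_clamp_time)
        (use T_nonneg in auto)
  qed (use clamp \<mu>_in in auto)
  have F_le: "norm (F s) \<le> F_max" for s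
    unfolding F_def real_norm_def by (rule F_bound[OF clamp control_in[OF \<alpha> clamp] \<mu>_in[OF clamp]])
  have "norm (LBINT s:{0..T}. F s) \<le> F_max * (T - 0)"
    by (rule norm_set_integral_le[OF set_integrable_bounded[OF F_meas F_le] F_le T_nonneg])
  moreover have "(LBINT t:{0..T}. running_F f t (\<alpha> t) (\<mu> t)) = (LBINT s:{0..T}. F s)"
    by (rule set_lebesgue_integral_cong) (auto simp: F_def)
  moreover have "\<bar>terminal_G g (\<mu> T) - terminal_G g m0\<bar> \<le> L * 2"
  proof -
    have \<mu>T: "\<mu> T \<in> prob_simplex"
      using T_nonneg by (intro \<mu>_in) simp
    have "norm (\<mu> T - m0) \<le> 2"
      using norm_triangle_ineq4[of "\<mu> T" m0] norm_prob_simplex_le[OF \<mu>T] norm_prob_simplex_le[OF m0] by linarith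
    then show ?thesis
      using G_lip[OF \<mu>T m0] mult_left_mono[OF _ L_nonneg] order_trans by blast
  qed
  ultimately show ?thesis
    unfolding mf_cost_def Let_def \<mu>_def[symmetric] by (simp add: abs_le_iff)
qed

lemma open_loop_feedback: "\<alpha> \<in> mf_controls T A \<Longrightarrow> open_loop \<alpha> \<in> feedback_controls T A N"
  unfolding mf_controls_def feedback_controls_def open_loop_def by (auto intro: vec_nth_measurable_restrict)

text \<open>Two comparisons are made, one from below for all feedbacks and one from above for the
  open loop; each costs \<open>cost_const / sqrt (real N)\<close>, hence the factor 2.\<close>

lemma open_loop_near_optimal:
  fixes P :: "('a, 'd) feedback \<Rightarrow> 'w measure"
  assumes m0: "m0 \<in> prob_simplex" and N: "1 \<le> N"
    and chain: "\<And>\<beta>. \<beta> \<in> feedback_controls T A N \<Longrightarrow> agent_chain T Q m0 N \<beta> (P \<beta>) (X \<beta>)"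
    and \<alpha>: "\<alpha> \<in> mf_controls T A"
    and opt: "mf_cost T Q f g m0 \<alpha> \<le> (INF \<alpha>'\<in>mf_controls T A. mf_cost T Q f g m0 \<alpha>') + \<epsilon>"
  shows "agent_cost T f g (open_loop \<alpha>) (P (open_loop \<alpha>)) (X (open_loop \<alpha>))
    \<le> (INF \<beta>\<in>feedback_controls T A N. agent_cost T f g \<beta> (P \<beta>) (X \<beta>))
      + 2 * cost_const / sqrt (real N) + \<epsilon>"
proof -
  let ?I = "INF \<alpha>'\<in>mf_controls T A. mf_cost T Q f g m0 \<alpha>'" and ?e = "cost_const / sqrt (real N)"
  have bdd: "bdd_below (mf_cost T Q f g m0 ` mf_controls T A)"
    using mf_cost_bounded_below[OF m0] by (auto simp: bdd_below_def)
  have lower: "?I - ?e \<le> agent_cost T f g \<beta> (P \<beta>) (X \<beta>)" if \<beta>: "\<beta> \<in> feedback_controls T A N" for \<beta>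
  proof -
    obtain c \<Delta> where c: "prob_space (P \<beta>)" "integrable (P \<beta>) c" "integrable (P \<beta>) \<Delta>"
      "agent_cost T f g \<beta> (P \<beta>) (X \<beta>) = (LINT w|P \<beta>. c w)" "(LINT w|P \<beta>. \<Delta> w) \<le> ?e"
      "\<And>w. w \<in> space (P \<beta>) \<Longrightarrow> (\<lambda>t. feedback_vec \<beta> t (X \<beta> t w)) \<in> mf_controls T A"
      "\<And>w. w \<in> space (P \<beta>) \<Longrightarrow> \<bar>c w - mf_cost T Q f g m0 (\<lambda>t. feedback_vec \<beta> t (X \<beta> t w))\<bar> \<le> \<Delta> w"
      by (rule agent_cost_estimate[OF m0 N \<beta> chain[OF \<beta>]]) blast
    interpret prob_space "P \<beta>" by (rule c(1))
    have "?I - \<Delta> w \<le> c w" if w: "w \<in> space (P \<beta>)" for w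
      using c(7)[OF w] cINF_lower[OF bdd c(6)[OF w]] by linarith
    then have "expectation (\<lambda>w. ?I - \<Delta> w) \<le> expectation c"
      using c(2,3) by (intro integral_mono) auto
    then show ?thesis
      using c(3,4,5) by (simp add: prob_space)
  qed
  let ?\<beta> = "open_loop \<alpha>"
  have \<beta>: "?\<beta> \<in> feedback_controls T A N"
    by (rule open_loop_feedback[OF \<alpha>])
  have "agent_cost T f g ?\<beta> (P ?\<beta>) (X ?\<beta>) \<le> mf_cost T Q f g m0 \<alpha> + ?e"
  proof -
    obtain c \<Delta> where c: "prob_space (P ?\<beta>)" "integrable (P ?\<beta>) c" "integrable (P ?\<beta>) \<Delta>"
      "agent_cost T f g ?\<beta> (P ?\<beta>) (X ?\<beta>) = (LINT w|P ?\<beta>. c w)" "(LINT w|P ?\<beta>. \<Delta> w) \<le> ?e"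
      "\<And>w. w \<in> space (P ?\<beta>) \<Longrightarrow> \<bar>c w - mf_cost T Q f g m0 (\<lambda>t. feedback_vec ?\<beta> t (X ?\<beta> t w))\<bar> \<le> \<Delta> w"
      by (rule agent_cost_estimate[OF m0 N \<beta> chain[OF \<beta>]]) blast
    interpret prob_space "P ?\<beta>" by (rule c(1))
    \<comment> \<open>The path control is the same on all paths, so its mean field cost is a
      constant and comes out of the expectation.\<close>
    have "(\<lambda>t. feedback_vec ?\<beta> t (X ?\<beta> t w)) = \<alpha>" for w
      by (simp add: feedback_vec_def open_loop_def fun_eq_iff)
    then have "c w \<le> mf_cost T Q f g m0 \<alpha> + \<Delta> w" if w: "w \<in> space (P ?\<beta>)" for w
      using c(6)[OF w] by (simp add: abs_le_iff)
    then have "expectation c \<le> expectation (\<lambda>w. mf_cost T Q f g m0 \<alpha> + \<Delta> w)"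
      using c(2,3) by (intro integral_mono) auto
    then show ?thesis
      using c(3,4,5) by (simp add: prob_space)
  qed
  moreover have "?I - ?e \<le> (INF \<beta>\<in>feedback_controls T A N. agent_cost T f g \<beta> (P \<beta>) (X \<beta>))"
    by (rule cINF_greatest) (use \<beta> lower in auto)
  ultimately show ?thesis
    using opt by simp
qed

end

text \<open>
  Varying one action at a time reduces boundedness to compactness of \<open>A\<close>, without compactness of
  the product.
\<close>

lemma running_F_bounded:
  fixes f :: "('a::metric_space, 'd::finite) running_costs" and A :: "'a set"
  assumes T: "0 \<le> T" and A: "compact A"
    and cont: "continuous_on ({0..T} \<times> action_vectors A \<times> prob_simplex) (\<lambda>(t, a, m). running_F f t a m)"
    and lip: "\<And>t s a m p. t \<in> {0..T} \<Longrightarrow> s \<in> {0..T} \<Longrightarrow> a \<in> action_vectors A \<Longrightarrow> m \<in> prob_simplex \<Longrightarrow>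
      p \<in> prob_simplex \<Longrightarrow> \<bar>running_F f t a m - running_F f s a p\<bar> \<le> C * (\<bar>t - s\<bar> + norm (m - p))"
    and C: "0 \<le> C"
  obtains B where "\<And>t a m. t \<in> {0..T} \<Longrightarrow> a \<in> action_vectors A \<Longrightarrow> m \<in> prob_simplex \<Longrightarrow> \<bar>running_F f t a m\<bar> \<le> B"
proof (cases "A = {}")
  case True
  then have "a \<notin> action_vectors A" for a :: "'a^'d"
    by (simp add: action_vectors_def)
  then show ?thesis
    using that[of 0] by blast
next
  case False
  then obtain b where b: "b \<in> A"
    by auto
  obtain p :: "real^'d" where p: "p \<in> prob_simplex"
    using prob_simplex_nonempty by auto
  define v where "v i c = (\<chi> j. if j = i then c else b)" for i :: 'd and c
  define u where "u = (\<chi> j :: 'd. b)"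
  have v_in: "v i c \<in> action_vectors A" if "c \<in> A" for i c
    using that b by (simp add: v_def action_vectors_def)
  have "\<exists>B. \<forall>c\<in>A. \<bar>running_F f 0 (v i c) p\<bar> \<le> B" for i
  proof -
    have "continuous_on A (\<lambda>c. (0 :: real, v i c, p))"
    proof -
      have "continuous_on A (v i)"
        unfolding v_def
      proof (rule continuous_on_vec_lambda)
        show "continuous_on A (\<lambda>c. if j = i then c else b)" for j
          by (cases "j = i") auto
      qed
      then show ?thesis
        by (intro continuous_intros)
    qed
    then have "continuous_on A (\<lambda>c. (case (0 :: real, v i c, p) of (t, a, m) \<Rightarrow> running_F f t a m))"
      by (rule continuous_on_compose2[OF cont]) (use v_in p T in auto)
    then have "compact ((\<lambda>c. running_F f 0 (v i c) p) ` A)"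
      using A by (intro compact_continuous_image) auto
    then have "bounded ((\<lambda>c. running_F f 0 (v i c) p) ` A)"
      by (rule compact_imp_bounded)
    then show ?thesis
      unfolding bounded_iff by auto
  qed
  then obtain B where B: "\<And>i c. c \<in> A \<Longrightarrow> \<bar>running_F f 0 (v i c) p\<bar> \<le> B i"
    by metis
  \<comment> \<open>\<open>C * (T + 2)\<close> pays for moving the time to 0 and the state to
    \<open>p\<close>, at distance at most 2; the rest bounds the value at time 0 and state
    \<open>p\<close>.\<close>
  define R where "R = (\<Sum>i\<in>UNIV. B i + \<bar>running_F f 0 u p\<bar>) + \<bar>running_F f 0 u p\<bar> + C * (T + 2)"
  have bound: "\<bar>running_F f t a m\<bar> \<le> R" if t: "t \<in> {0..T}" and a: "a \<in> action_vectors A" and m: "m \<in> prob_simplex" for t a m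
  proof -
    have a': "a $ i \<in> A" for i
      using a by (simp add: action_vectors_def)
    \<comment> \<open>At fixed time and state the running cost is a sum of functions of single
      actions, so it is determined by its values at vectors that differ from the constant vector
      \<open>u\<close> in one entry.\<close>
    have "p $ i * f i 0 (a $ i) p = running_F f 0 (v i (a $ i)) p - running_F f 0 u p + p $ i * f i 0 b p" for i
    proof -
      have "running_F f 0 (v i (a $ i)) p - running_F f 0 u p
          = (\<Sum>j\<in>UNIV. if j = i then p $ i * f i 0 (a $ i) p - p $ i * f i 0 b p else 0)"
        unfolding running_F_def sum_subtractf[symmetric] by (intro sum.cong refl) (auto simp: v_def u_def)
      then show ?thesis
        by simp
    qed
    then have "running_F f 0 a p = (\<Sum>i\<in>UNIV. running_F f 0 (v i (a $ i)) p - running_F f 0 u p + p $ i * f i 0 b p)"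
      unfolding running_F_def[of f 0 a] by simp
    also have "\<dots> = (\<Sum>i\<in>UNIV. running_F f 0 (v i (a $ i)) p - running_F f 0 u p) + running_F f 0 u p"
      unfolding sum.distrib by (simp add: running_F_def u_def)
    finally have eq: "running_F f 0 a p = (\<Sum>i\<in>UNIV. running_F f 0 (v i (a $ i)) p - running_F f 0 u p) + running_F f 0 u p" .
    have "\<bar>\<Sum>i\<in>UNIV. running_F f 0 (v i (a $ i)) p - running_F f 0 u p\<bar>
        \<le> (\<Sum>i\<in>UNIV. \<bar>running_F f 0 (v i (a $ i)) p - running_F f 0 u p\<bar>)"
      by (rule sum_abs)
    moreover have "\<dots> \<le> (\<Sum>i\<in>UNIV. B i + \<bar>running_F f 0 u p\<bar>)"
    proof (rule sum_mono)
      show "\<bar>running_F f 0 (v i (a $ i)) p - running_F f 0 u p\<bar> \<le> B i + \<bar>running_F f 0 u p\<bar>" for i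
        using B[OF a', of i i] by linarith
    qed
    moreover have "\<bar>running_F f t a m - running_F f 0 a p\<bar> \<le> C * (T + 2)"
    proof -
      have "\<bar>running_F f t a m - running_F f 0 a p\<bar> \<le> C * (\<bar>t - 0\<bar> + norm (m - p))"
        by (rule lip[OF t _ a m p]) (use T in simp)
      also have "\<dots> \<le> C * (T + 2)"
        using t C norm_triangle_ineq4[of m p] norm_prob_simplex_le[OF m] norm_prob_simplex_le[OF p]
        by (intro mult_left_mono) auto
      finally show ?thesis .
    qed
    ultimately show ?thesis
      unfolding R_def using eq by linarith
  qed
  show ?thesis
    by (rule that[OF bound])
qed

lemma assumption_A_mean_field:
  fixes f :: "('a::metric_space, 'd::finite) running_costs"
  assumes T: "0 < T" and nonneg: "nonneg_rates T A Q" and asm: "assumption_A T A Q f g"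
  obtains K L F_max where "mean_field T A Q f g K L F_max"
proof -
  note asm' = asm[unfolded assumption_A_def]
  note A = asm'[THEN conjunct1]
  note Q_cont = asm'[THEN conjunct2, THEN conjunct1, rule_format]
  obtain CQ where CQ: "\<forall>i j. \<forall>t\<in>{0..T}. \<forall>s\<in>{0..T}. \<forall>a\<in>A. \<forall>m\<in>prob_simplex. \<forall>p\<in>prob_simplex.
        \<bar>Q i j t a m - Q i j s a p\<bar> \<le> CQ * (\<bar>t - s\<bar> + norm (m - p))"
    using asm'[THEN conjunct2, THEN conjunct2, THEN conjunct1] by (rule exE)
  note F_cont = asm'[THEN conjunct2, THEN conjunct2, THEN conjunct2, THEN conjunct1]
  obtain CF where CF: "\<forall>t\<in>{0..T}. \<forall>s\<in>{0..T}. \<forall>a\<in>action_vectors A. \<forall>m\<in>prob_simplex. \<forall>p\<in>prob_simplex.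
        \<bar>running_F f t a m - running_F f s a p\<bar> \<le> CF * (\<bar>t - s\<bar> + norm (m - p))"
    using asm'[THEN conjunct2, THEN conjunct2, THEN conjunct2, THEN conjunct2, THEN conjunct1] by (rule exE)
  obtain CG where CG: "\<forall>m\<in>prob_simplex. \<forall>p\<in>prob_simplex. \<bar>terminal_G g m - terminal_G g p\<bar> \<le> CG * norm (m - p)"
    using asm'[THEN conjunct2, THEN conjunct2, THEN conjunct2, THEN conjunct2, THEN conjunct2] by (rule exE)
  \<comment> \<open>One constant for all three Lipschitz bounds. The maximum with 0 is taken because
    assumption A leaves the signs of its constants open.\<close>
  define L where "L = max 0 (max CQ (max CF CG))"
  have L: "0 \<le> L" "CQ \<le> L" "CF \<le> L" "CG \<le> L"
    by (auto simp: L_def)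
  have lift: "x \<le> L * d" if "x \<le> C * d" "C \<le> L" "0 \<le> d" for x C d :: real
    using mult_right_mono[OF that(2,3)] that(1) by linarith
  have "\<exists>K. \<forall>z\<in>{0..T} \<times> A \<times> prob_simplex. \<bar>case z of (t, a, m) \<Rightarrow> Q i j t a m\<bar> \<le> K" for i j
  proof -
    have "compact ({0..T} \<times> A \<times> (prob_simplex :: (real^'d) set))"
      by (intro compact_Times compact_prob_simplex A) auto
    then have "compact ((\<lambda>(t, a, m). Q i j t a m) ` ({0..T} \<times> A \<times> prob_simplex))"
      by (rule compact_continuous_image[OF Q_cont])
    then have "bounded ((\<lambda>(t, a, m). Q i j t a m) ` ({0..T} \<times> A \<times> prob_simplex))"
      by (rule compact_imp_bounded)
    then show ?thesis
      unfolding bounded_iff by auto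
  qed
  then obtain K where K: "\<And>i j z. z \<in> {0..T} \<times> A \<times> prob_simplex \<Longrightarrow> \<bar>case z of (t, a, m) \<Rightarrow> Q i j t a m\<bar> \<le> K i j"
    by metis
  define K' where "K' = 1 + (\<Sum>i\<in>UNIV. \<Sum>j\<in>UNIV. \<bar>K i j\<bar>)"
  have Q_le: "Q i j t a m \<le> K'" if "t \<in> {0..T}" "a \<in> A" "m \<in> prob_simplex" for i j t a m
  proof -
    have "Q i j t a m \<le> \<bar>K i j\<bar>"
      using K[of "(t, a, m)" i j] that by auto
    also have "\<dots> \<le> (\<Sum>j\<in>UNIV. \<bar>K i j\<bar>)"
      by (rule member_le_sum) auto
    also have "\<dots> \<le> (\<Sum>i\<in>UNIV. \<Sum>j\<in>UNIV. \<bar>K i j\<bar>)"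
      by (rule member_le_sum[of i UNIV "\<lambda>i. \<Sum>j\<in>UNIV. \<bar>K i j\<bar>"]) (auto intro: sum_nonneg)
    finally show ?thesis
      by (simp add: K'_def)
  qed
  have K'_pos: "0 < K'"
    unfolding K'_def by (intro add_pos_nonneg sum_nonneg) auto
  have F_lip: "\<bar>running_F f t a m - running_F f s a p\<bar> \<le> L * (\<bar>t - s\<bar> + norm (m - p))"
    if "t \<in> {0..T}" "s \<in> {0..T}" "a \<in> action_vectors A" "m \<in> prob_simplex" "p \<in> prob_simplex" for t s a m p
    by (rule lift[OF CF[rule_format, OF that] L(3)]) simp
  obtain F_max where F_max: "\<And>t a m. t \<in> {0..T} \<Longrightarrow> a \<in> action_vectors A \<Longrightarrow> m \<in> prob_simplex \<Longrightarrow>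
      \<bar>running_F f t a m\<bar> \<le> F_max"
    using running_F_bounded[OF less_imp_le[OF T] A F_cont F_lip L(1)] by blast
  have "mean_field T A Q f g K' L F_max"
  proof (rule mean_field.intro)
    show "\<bar>Q i j t a m - Q i j t a p\<bar> \<le> L * norm (m - p)"
      if "t \<in> {0..T}" "a \<in> A" "m \<in> prob_simplex" "p \<in> prob_simplex" for i j t a m p
      using lift[OF CQ[rule_format, OF that(1) that(1) that(2-4), of i j] L(2)] by simp
    show "\<bar>running_F f t a m - running_F f t a p\<bar> \<le> L * norm (m - p)"
      if "t \<in> {0..T}" "a \<in> action_vectors A" "m \<in> prob_simplex" "p \<in> prob_simplex" for t a m p
      using F_lip[OF that(1) that(1) that(2-4)] by simp
    show "\<bar>terminal_G g m - terminal_G g p\<bar> \<le> L * norm (m - p)"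
      if "m \<in> prob_simplex" "p \<in> prob_simplex" for m p
      by (rule lift[OF CG[rule_format, OF that] L(4)]) simp
    show "0 \<le> Q i j t a m" if "t \<in> {0..T}" "a \<in> A" "m \<in> prob_simplex" for i j t a m
      using nonneg that unfolding nonneg_rates_def by simp
  qed (fact T A Q_cont Q_le F_cont F_max K'_pos L(1))+
  then show ?thesis
    by (rule that)
qed

theorem theorem11:
  fixes T :: real and A :: "'a::metric_space set" and Q :: "('a, 'd::finite) rates"
    and f :: "('a, 'd) running_costs" and g :: "'d terminal_costs" and m\<^sub>0 :: "real^'d"
  assumes "CARD('d) \<ge> 2" and "T > 0" and "m\<^sub>0 \<in> prob_simplex"
    and "nonneg_rates T A Q" and "assumption_A T A Q f g"
  shows "\<exists>C. \<forall>N\<ge>1. \<forall>(P :: ('a, 'd) feedback \<Rightarrow> 'w measure) X.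
    (\<forall>\<beta>\<in>feedback_controls T A N. agent_chain T Q m\<^sub>0 N \<beta> (P \<beta>) (X \<beta>)) \<longrightarrow>
    (\<forall>\<epsilon>>0. \<forall>\<alpha>\<in>mf_controls T A.
       mf_cost T Q f g m\<^sub>0 \<alpha> \<le> (INF \<alpha>'\<in>mf_controls T A. mf_cost T Q f g m\<^sub>0 \<alpha>') + \<epsilon> \<longrightarrow>
       agent_cost T f g (open_loop \<alpha>) (P (open_loop \<alpha>)) (X (open_loop \<alpha>))
         \<le> (INF \<beta>\<in>feedback_controls T A N. agent_cost T f g \<beta> (P \<beta>) (X \<beta>))
           + C / sqrt (real N) + \<epsilon>)"
proof -
  obtain K L F_max where "mean_field T A Q f g K L F_max"
    by (rule assumption_A_mean_field[OF assms(2,4,5)])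
  then interpret mean_field T A Q f g K L F_max .
  show ?thesis
  \<comment> \<open>The witness, left to unification, is \<open>2 * cost_const\<close>; it is fixed
    before \<open>N\<close>, the probability spaces, \<open>\<epsilon>\<close> and
    \<open>\<alpha>\<close>.\<close>
  proof (intro exI allI impI ballI)
    fix N :: nat and P :: "('a, 'd) feedback \<Rightarrow> 'w measure" and X \<epsilon> \<alpha>
    assume "1 \<le> N" "\<forall>\<beta>\<in>feedback_controls T A N. agent_chain T Q m\<^sub>0 N \<beta> (P \<beta>) (X \<beta>)"
      "\<alpha> \<in> mf_controls T A"
      "mf_cost T Q f g m\<^sub>0 \<alpha> \<le> (INF \<alpha>'\<in>mf_controls T A. mf_cost T Q f g m\<^sub>0 \<alpha>') + \<epsilon>"
    then show "agent_cost T f g (open_loop \<alpha>) (P (open_loop \<alpha>)) (X (open_loop \<alpha>))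
         \<le> (INF \<beta>\<in>feedback_controls T A N. agent_cost T f g \<beta> (P \<beta>) (X \<beta>))
           + 2 * cost_const / sqrt (real N) + \<epsilon>"
      by (intro open_loop_near_optimal[OF assms(3)]) auto
  qed
qed

end
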